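(* Let $F_2$ be the free group of rank $2$, $\varphi\in\mathrm{Aut}(F_2)$ and $G=F_2\rtimes_\varphi\mathbb{Z}$. For the lower central series of $G$ there are only three possibilities: (a) $\gamma_\omega(G)=\gamma_2(G)$; (b) $\gamma_\omega(G)=1$; (c) $\gamma_{\omega^2}(G)=1$ and the length of the lower central series of $G$ is equal to $\omega^2$.
   Context: $F_2\rtimes_\varphi\mathbb{Z}=\langle x,y,t\mid t^{-1}xt=\varphi(x),\ t^{-1}yt=\varphi(y)\rangle$, where $F_2=\langle x,y\rangle$. The transfinite lower central series is $\gamma_1(G)=G$, $\gamma_{\alpha+1}(G)=[\gamma_\alpha(G),G]$, $\gamma_\alpha(G)=\bigcap_{\beta<\alpha}\gamma_\beta(G)$ for limit ordinals $\alpha$; its length is the smallest ordinal $\alpha$ with $\gamma_\alpha(G)=\gamma_{\alpha+1}(G)$. *)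

theory Defs
  imports "HOL-Algebra.Algebra"
begin

section \<open>Free groups as groups of reduced words\<close>

text \<open>The letter \<open>(a, True)\<close> stands for the generator \<open>a\<close> and \<open>(a, False)\<close> for its inverse.\<close>

type_synonym 'a word = "('a \<times> bool) list"

definition inv_letter :: "'a \<times> bool \<Rightarrow> 'a \<times> bool" where
  "inv_letter l = (fst l, \<not> snd l)"

definition reduced :: "'a word \<Rightarrow> bool" where
  "reduced w \<longleftrightarrow> successively (\<lambda>l m. m \<noteq> inv_letter l) w"

fun push :: "'a \<times> bool \<Rightarrow> 'a word \<Rightarrow> 'a word" where
  "push l [] = [l]"
| "push l (m # w) = (if m = inv_letter l then w else l # m # w)"

text \<open>The product of two reduced words is the reduced form of their concatenation: the letters
  of \<open>u\<close> are put in front of \<open>v\<close> one after the other, cancelling where possible.\<close>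

definition free_group :: "'a word monoid" where
  "free_group = \<lparr>carrier = {w. reduced w}, monoid.mult = (\<lambda>u v. foldr push u v), one = []\<rparr>"

datatype gen = X | Y

definition F2 :: "gen word monoid" where
  "F2 = free_group"

lemma inv_letter_inv_letter [simp]: "inv_letter (inv_letter l) = l"
  by (simp add: inv_letter_def)

lemma inv_letter_neq [simp]: "inv_letter l \<noteq> l" "l \<noteq> inv_letter l"
  by (auto simp: inv_letter_def prod_eq_iff)

lemma reduced_Nil [simp]: "reduced []"
  by (simp add: reduced_def)

lemma reduced_Cons: "reduced (l # w) \<longleftrightarrow> reduced w \<and> (w = [] \<or> hd w \<noteq> inv_letter l)"
  by (auto simp: reduced_def successively_Cons)

lemma reduced_push [simp]: "reduced w \<Longrightarrow> reduced (push l w)"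
  by (cases w) (auto simp: reduced_Cons)

lemma push_inv_letter:
  assumes "reduced w"
  shows "push l (push (inv_letter l) w) = w" "push (inv_letter l) (push l w) = w"
  using assms by (cases w; cases "tl w"; auto simp: reduced_Cons)+

lemma push_reduced: "reduced (l # w) \<Longrightarrow> push l w = l # w"
  by (cases w) (auto simp: reduced_Cons)

lemma reduced_foldr_push [simp]: "reduced w \<Longrightarrow> reduced (foldr push u w)"
  by (induction u) auto

lemma foldr_push_push:
  assumes "reduced w"
  shows "foldr push (push l u) w = push l (foldr push u w)"
proof (cases u)
  case (Cons m v)
  have "reduced (foldr push v w)"
    using assms by simp
  then show ?thesis
    using Cons by (simp add: push_inv_letter)
qed simp

lemma foldr_push_assoc:
  "reduced w \<Longrightarrow> foldr push (foldr push u v) w = foldr push u (foldr push v w)"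
  by (induction u) (simp_all add: foldr_push_push)

lemma foldr_push_Nil: "reduced w \<Longrightarrow> foldr push w [] = w"
  by (induction w) (simp_all add: push_reduced reduced_Cons)

lemma foldr_push_inverse:
  "reduced w \<Longrightarrow> foldr push (rev (map inv_letter u)) (foldr push u w) = w"
  by (induction u arbitrary: w) (simp_all add: push_inv_letter)

lemma group_free_group: "group (free_group :: 'a word monoid)"
proof (rule groupI)
  fix w :: "'a word"
  assume "w \<in> carrier free_group"
  then have w: "reduced w"
    by (simp add: free_group_def)
  let ?v = "foldr push (rev (map inv_letter w)) []"
  have "foldr push ?v w = foldr push (rev (map inv_letter w)) (foldr push w [])"
    using w by (simp add: foldr_push_assoc foldr_push_Nil)
  also have "\<dots> = []"
    by (simp add: foldr_push_inverse)
  finally show "\<exists>v\<in>carrier free_group. v \<otimes>\<^bsub>free_group\<^esub> w = \<one>\<^bsub>free_group\<^esub>"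
    by (intro bexI[of _ ?v]) (simp_all add: free_group_def)
qed (auto simp: free_group_def foldr_push_assoc)

lemma group_F2: "group F2"
  by (simp add: F2_def group_free_group)


section \<open>The semidirect product with the integers\<close>

text \<open>The pair \<open>(m, u)\<close> stands for the element \<open>t\<^sup>m u\<close>. The relation \<open>t\<^sup>-\<^sup>1 u t = \<phi> u\<close> gives
  \<open>(t\<^sup>m u) (t\<^sup>n v) = t\<^sup>m\<^sup>+\<^sup>n \<phi>\<^sup>n(u) v\<close>.\<close>

definition semidirect_int ::
    "('a, 'b) monoid_scheme \<Rightarrow> ('a \<Rightarrow> 'a) \<Rightarrow> (int \<times> 'a) monoid" where
  "semidirect_int F \<phi> =
    \<lparr>carrier = UNIV \<times> carrier F,
     monoid.mult = (\<lambda>(m, u) (n, v). (m + n, (\<phi> [^]\<^bsub>AutoGroup F\<^esub> n) u \<otimes>\<^bsub>F\<^esub> v)),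
     one = (0, \<one>\<^bsub>F\<^esub>)\<rparr>"

context group
begin

lemma AutoGroup_pow_auto:
  fixes n :: int
  assumes "\<phi> \<in> auto G"
  shows "\<phi> [^]\<^bsub>AutoGroup G\<^esub> n \<in> auto G"
  using group.int_pow_closed[OF AutoGroup, of \<phi> n] assms by (simp add: AutoGroup_def)

lemma AutoGroup_mult_apply:
  assumes "f \<in> auto G" "g \<in> auto G" "u \<in> carrier G"
  shows "(f \<otimes>\<^bsub>AutoGroup G\<^esub> g) u = f (g u)"
  using assms by (simp add: AutoGroup_def BijGroup_def auto_def compose_def)

lemma AutoGroup_pow_add:
  fixes m n :: int
  assumes "\<phi> \<in> auto G" "u \<in> carrier G"
  shows "(\<phi> [^]\<^bsub>AutoGroup G\<^esub> (m + n)) u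
    = (\<phi> [^]\<^bsub>AutoGroup G\<^esub> m) ((\<phi> [^]\<^bsub>AutoGroup G\<^esub> n) u)"
proof -
  have "\<phi> \<in> carrier (AutoGroup G)"
    using assms by (simp add: AutoGroup_def)
  then show ?thesis
    using assms by (simp add: group.int_pow_mult[OF AutoGroup] AutoGroup_mult_apply AutoGroup_pow_auto)
qed

lemma AutoGroup_pow_commute:
  fixes m n :: int
  assumes "\<phi> \<in> auto G" "u \<in> carrier G"
  shows "(\<phi> [^]\<^bsub>AutoGroup G\<^esub> m) ((\<phi> [^]\<^bsub>AutoGroup G\<^esub> n) u)
    = (\<phi> [^]\<^bsub>AutoGroup G\<^esub> n) ((\<phi> [^]\<^bsub>AutoGroup G\<^esub> m) u)"
  using AutoGroup_pow_add[OF assms] by (metis add.commute)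

lemma AutoGroup_one_apply: "u \<in> carrier G \<Longrightarrow> \<one>\<^bsub>AutoGroup G\<^esub> u = u"
  by (simp add: AutoGroup_def BijGroup_def)

lemma AutoGroup_pow_1: "\<phi> \<in> auto G \<Longrightarrow> \<phi> [^]\<^bsub>AutoGroup G\<^esub> (1::int) = \<phi>"
  using group.int_pow_1[OF AutoGroup] by (simp add: AutoGroup_def)

lemma auto_closed: "\<phi> \<in> auto G \<Longrightarrow> u \<in> carrier G \<Longrightarrow> \<phi> u \<in> carrier G"
  by (auto simp: auto_def hom_def)

lemma auto_mult:
  "\<phi> \<in> auto G \<Longrightarrow> u \<in> carrier G \<Longrightarrow> v \<in> carrier G \<Longrightarrow> \<phi> (u \<otimes> v) = \<phi> u \<otimes> \<phi> v"
  by (auto simp: auto_def hom_def)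

lemma auto_one:
  assumes "\<phi> \<in> auto G"
  shows "\<phi> \<one> = \<one>"
  using assms by (metis IntD1 auto_def hom_one is_group)

lemma group_semidirect_int:
  assumes "\<phi> \<in> auto G"
  shows "group (semidirect_int G \<phi>)"
proof (rule groupI)
  fix a
  assume "a \<in> carrier (semidirect_int G \<phi>)"
  then obtain m u where a: "a = (m, u)" and u: "u \<in> carrier G"
    by (auto simp: semidirect_int_def)
  let ?P = "\<lambda>n::int. \<phi> [^]\<^bsub>AutoGroup G\<^esub> n"
  let ?b = "(- m, ?P (- m) (inv u))"
  have "?P m (?P (- m) (inv u)) = inv u"
    using AutoGroup_pow_add[OF assms, of "inv u" m "- m"] u by (simp add: AutoGroup_one_apply)
  then show "\<exists>b\<in>carrier (semidirect_int G \<phi>).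
      b \<otimes>\<^bsub>semidirect_int G \<phi>\<^esub> a = \<one>\<^bsub>semidirect_int G \<phi>\<^esub>"
    using u a AutoGroup_pow_auto[OF assms]
    by (intro bexI[of _ ?b]) (auto simp: semidirect_int_def auto_closed)
qed (use AutoGroup_pow_auto[OF assms] in
  \<open>auto simp: semidirect_int_def auto_closed auto_mult auto_one AutoGroup_one_apply
    AutoGroup_pow_add[OF assms] AutoGroup_pow_commute[OF assms] m_assoc\<close>)

lemma semidirect_int_conj:
  assumes "\<phi> \<in> auto G" "u \<in> carrier G"
  defines "t \<equiv> (1, \<one>)"
  shows "inv\<^bsub>semidirect_int G \<phi>\<^esub> t \<otimes>\<^bsub>semidirect_int G \<phi>\<^esub> (0, u) \<otimes>\<^bsub>semidirect_int G \<phi>\<^esub> t = (0, \<phi> u)"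
proof -
  interpret S: group "semidirect_int G \<phi>"
    using assms(1) by (rule group_semidirect_int)
  have "inv\<^bsub>semidirect_int G \<phi>\<^esub> t = (- 1, \<one>)"
    using AutoGroup_pow_auto[OF assms(1)]
    by (intro S.inv_equality) (auto simp: semidirect_int_def t_def auto_one)
  then show ?thesis
    using assms(1,2) AutoGroup_pow_auto[OF assms(1)]
    by (simp add: semidirect_int_def t_def AutoGroup_one_apply AutoGroup_pow_1 auto_closed)
qed

end


section \<open>Ordinals below \<open>\<omega>\<^sup>3\<close>\<close>

text \<open>\<open>Ord a b c\<close> is the ordinal \<open>\<omega>\<^sup>2 a + \<omega> b + c\<close> in Cantor normal form; the order is
  lexicographic. The successors are the \<open>Ord a b (Suc c)\<close>, the limit ordinals the nonzero
  \<open>Ord a b 0\<close>.\<close>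

datatype ord = Ord nat nat nat

instantiation ord :: wellorder
begin

fun less_ord :: "ord \<Rightarrow> ord \<Rightarrow> bool" where
  "Ord a b c < Ord a' b' c' \<longleftrightarrow> a < a' \<or> a = a' \<and> (b < b' \<or> b = b' \<and> c < c')"

definition less_eq_ord :: "ord \<Rightarrow> ord \<Rightarrow> bool" where
  "\<alpha> \<le> \<beta> \<longleftrightarrow> \<alpha> < \<beta> \<or> \<alpha> = (\<beta> :: ord)"

instance
proof
  fix \<alpha> \<beta> \<delta> :: ord
  show "\<alpha> < \<beta> \<longleftrightarrow> \<alpha> \<le> \<beta> \<and> \<not> \<beta> \<le> \<alpha>" "\<alpha> \<le> \<alpha>"
    "\<alpha> \<le> \<beta> \<Longrightarrow> \<beta> \<le> \<delta> \<Longrightarrow> \<alpha> \<le> \<delta>" "\<alpha> \<le> \<beta> \<Longrightarrow> \<beta> \<le> \<alpha> \<Longrightarrow> \<alpha> = \<beta>" "\<alpha> \<le> \<beta> \<or> \<beta> \<le> \<alpha>"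
    by (cases \<alpha>; cases \<beta>; cases \<delta>; auto simp: less_eq_ord_def)+
next
  fix P :: "ord \<Rightarrow> bool" and \<alpha> :: ord
  assume step: "\<And>\<alpha>. (\<And>\<beta>. \<beta> < \<alpha> \<Longrightarrow> P \<beta>) \<Longrightarrow> P \<alpha>"
  let ?R = "inv_image (less_than <*lex*> less_than <*lex*> less_than)
    (\<lambda>\<alpha>. case \<alpha> of Ord a b c \<Rightarrow> (a, b, c))"
  have "wf ?R"
    by (intro wf_inv_image wf_lex_prod wf_less_than)
  then show "P \<alpha>"
  proof (induction \<alpha> rule: wf_induct_rule)
    case (less \<alpha>)
    show ?case
    proof (rule step)
      fix \<beta>
      assume "\<beta> < \<alpha>"
      then have "(\<beta>, \<alpha>) \<in> ?R"
        by (cases \<alpha>; cases \<beta>) auto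
      then show "P \<beta>"
        by (rule less)
    qed
  qed
qed

end

fun ord_succ :: "ord \<Rightarrow> ord" where
  "ord_succ (Ord a b c) = Ord a b (Suc c)"

definition ord_fin :: "nat \<Rightarrow> ord" where
  "ord_fin n = Ord 0 0 n"

definition ord_omega :: ord where
  "ord_omega = Ord 0 1 0"

definition ord_omega_sq :: ord where
  "ord_omega_sq = Ord 1 0 0"


section \<open>The transfinite lower central series\<close>

definition commutator_subgroup ::
    "('a, 'b) monoid_scheme \<Rightarrow> 'a set \<Rightarrow> 'a set \<Rightarrow> 'a set" where
  "commutator_subgroup G H K =
    generate G (\<Union>h\<in>H. \<Union>k\<in>K. {h \<otimes>\<^bsub>G\<^esub> k \<otimes>\<^bsub>G\<^esub> inv\<^bsub>G\<^esub> h \<otimes>\<^bsub>G\<^esub> inv\<^bsub>G\<^esub> k})"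

text \<open>The series starts at index \<open>1\<close>. The index \<open>0\<close> is not part of it: the second equation
  gives it the dummy value \<open>carrier G\<close>, and it takes no part in the intersections at limit ordinals
  nor in the definition of the length.\<close>

function lower_central :: "('a, 'b) monoid_scheme \<Rightarrow> ord \<Rightarrow> 'a set" where
  "lower_central G (Ord a b (Suc c)) =
    (if Ord a b c = ord_fin 0 then carrier G
     else commutator_subgroup G (lower_central G (Ord a b c)) (carrier G))"
| "lower_central G (Ord a b 0) =
    carrier G \<inter> (\<Inter>\<beta> \<in> {ord_fin 1..<Ord a b 0}. lower_central G \<beta>)"
  by (metis ord.exhaust not0_implies_Suc surj_pair) auto
termination
  by (relation "inv_image {(\<alpha>, \<beta>). \<alpha> < \<beta>} snd") (auto intro: wf_inv_image wf)

definition lower_central_length :: "('a, 'b) monoid_scheme \<Rightarrow> ord \<Rightarrow> bool" where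
  "lower_central_length G \<alpha> \<longleftrightarrow>
    ord_fin 1 \<le> \<alpha> \<and> lower_central G \<alpha> = lower_central G (ord_succ \<alpha>) \<and>
    (\<forall>\<beta>. ord_fin 1 \<le> \<beta> \<longrightarrow> \<beta> < \<alpha> \<longrightarrow> lower_central G \<beta> \<noteq> lower_central G (ord_succ \<beta>))"

end

theory Submission
  imports Defs
begin

text \<open>Let \<open>A\<close> be the matrix of \<open>\<phi>\<close> on \<open>F\<^sup>a\<^sup>b = \<int>\<^sup>2\<close>, with trace \<open>N\<close> and determinant \<open>D = \<plusminus>1\<close>.
  If \<open>det (A - 1) = 1 - N + D\<close> is a unit, then \<open>\<gamma>\<^sub>2(G) = \<gamma>\<^sub>3(G) = F\<close>. If \<open>A\<close> is unipotent modulo some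
  \<open>p\<close>, then all tensor powers of \<open>A\<close> are unipotent modulo \<open>p\<close>, so the Magnus coefficients of the
  elements of \<open>\<gamma>\<^sub>n(G)\<close> become divisible by any given power of \<open>p\<close>, and \<open>\<gamma>\<^sub>\<omega>(G) = 1\<close>. What remains is
  the case \<open>D = -1\<close> with \<open>N\<close> odd and \<open>\<bar>N\<bar> \<ge> 3\<close>.

  In this case the eigenvalues \<open>\<mu>\<close> of the tensor powers of \<open>A\<close> are quadratic integers, and the norm of
  \<open>\<mu> - 1\<close> is never a unit; hence no nonzero tensor lies in the image of every power of \<open>A\<^sup>\<otimes>\<^sup>k - 1\<close>,
  each limit step of the lower central series raises the order of the Magnus expansion, and the
  series is trivial at \<open>\<omega>\<^sup>2\<close>. On the other hand \<open>u = [x, y]\<close> lies in every \<open>\<gamma>\<^sub>n(G)\<close>: modulo \<open>[\<gamma>\<^sub>n(G), G]\<close> the map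
  \<open>\<phi>\<close> inverts \<open>u\<close>, which gives \<open>u\<^sup>2 = 1\<close>, and \<open>A - 1\<close> is invertible modulo \<open>2\<close>, which gives
  \<open>u\<^sup>k = 1\<close> for some odd \<open>k\<close>. As \<open>[\<gamma>\<^sub>\<alpha>, \<gamma>\<^sub>n] \<subseteq> \<gamma>\<^sub>\<alpha>\<^sub>+\<^sub>n\<close>, the nontrivial commutator \<open>[x, u, \<dots>, u]\<close> with \<open>j\<close> entries
  \<open>u\<close> lies in \<open>\<gamma>\<^sub>\<omega>\<^sub>j(G)\<close>, so the series cannot stop before \<open>\<omega>\<^sup>2\<close>.\<close>

section \<open>The Magnus expansion\<close>

text \<open>The product of two formal power series in noncommuting variables, given by coefficients
  on words. Peeling off the first letter suits induction on words; \<open>conv_sum\<close> is the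
  usual sum over all splittings.\<close>

fun conv :: "('a list \<Rightarrow> int) \<Rightarrow> ('a list \<Rightarrow> int) \<Rightarrow> 'a list \<Rightarrow> int" where
  "conv f g [] = f [] * g []"
| "conv f g (b # w) = f [] * g (b # w) + conv (\<lambda>u. f (b # u)) g w"

lemma conv_sum: "conv f g w = (\<Sum>i\<le>length w. f (take i w) * g (drop i w))"
  by (induction w arbitrary: f) (simp_all add: sum.atMost_Suc_shift del: sum.atMost_Suc)

text \<open>A congruence rule for the later recursion of \<open>subst\<close> through
  \<open>conv\<close>: only words no longer than \<open>w\<close> are inspected, which gives
  termination.\<close>

lemma conv_cong [fundef_cong]:
  assumes "w = w'" "\<And>u. length u \<le> length w' \<Longrightarrow> f u = f' u" "\<And>u. length u \<le> length w' \<Longrightarrow> g u = g' u"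
  shows "conv f g w = conv f' g' w'"
  unfolding conv_sum using assms by (intro sum.cong) auto

lemma conv_add_left: "conv (\<lambda>u. f u + f' u) g w = conv f g w + conv f' g w"
  by (simp add: conv_sum sum.distrib algebra_simps)

lemma conv_minus_left: "conv (\<lambda>u. - f u) g w = - conv f g w"
  by (simp add: conv_sum sum_negf)

lemma conv_zero_left: "conv (\<lambda>u. 0) g w = 0"
  by (simp add: conv_sum)

lemma conv_add_right: "conv f (\<lambda>u. g u + g' u) w = conv f g w + conv f g' w"
  by (simp add: conv_sum sum.distrib algebra_simps)

lemma conv_zero_right: "conv f (\<lambda>u. 0) w = 0"
  by (simp add: conv_sum)

lemma conv_assoc: "conv (conv f g) h w = conv f (conv g h) w"
proof (induction w arbitrary: f)
  case (Cons b w)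
  have "conv (\<lambda>u. conv f g (b # u)) h w
    = conv (\<lambda>u. f [] * g (b # u)) h w + conv (conv (\<lambda>u. f (b # u)) g) h w"
    by (simp add: conv_add_left)
  moreover have "conv (\<lambda>u. f [] * g (b # u)) h w = f [] * conv (\<lambda>u. g (b # u)) h w"
    by (simp add: conv_sum sum_distrib_left mult.assoc)
  ultimately show ?case
    using Cons.IH by (simp add: algebra_simps)
qed simp

text \<open>The coefficient of a monomial in the image of a group word under a |-> 1 + a. An inverse
  letter needs no infinite series: h = (1 + a)^-1 g satisfies h = g - a h, and this equation is the
  recursion.\<close>

function magnus :: "'a word \<Rightarrow> 'a list \<Rightarrow> int" where
  "magnus g [] = 1"
| "magnus [] (b # w) = 0"
| "magnus ((a, s) # g) (b # w) =
    magnus g (b # w) + (if a = b then if s then magnus g w else - magnus ((a, s) # g) w else 0)"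
  by pat_completeness auto
termination
  by (relation "measure (\<lambda>(g, w). length g + length w)") auto

lemma conv_magnus_Nil: "conv (magnus []) f w = f w"
  by (cases w) (simp_all add: conv_zero_left)

lemma magnus_cancel: "magnus (l # inv_letter l # g) w = magnus g w"
proof (induction w)
  case (Cons b w)
  then show ?case
    by (cases l) (auto simp: inv_letter_def)
qed simp

lemma magnus_push: "magnus (push l g) w = magnus (l # g) w"
  by (cases g) (auto simp: magnus_cancel)

lemma magnus_foldr_push: "magnus (foldr push u v) w = conv (magnus u) (magnus v) w"
proof (induction u arbitrary: w)
  case Nil
  show ?case by (simp add: conv_magnus_Nil)
next
  case (Cons l u)
  obtain a s where l: "l = (a, s)" by force
  \<comment> \<open>The inner induction on the monomial serves inverse letters, for which
    \<open>magnus\<close> shortens the monomial but keeps the group word.\<close>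
  show ?case
  proof (induction w)
    case (Cons b w)
    have "conv (\<lambda>v. if a = b then f v else 0) h w = (if a = b then conv f h w else 0)" for f h
      by (simp add: conv_zero_left)
    then show ?case
      using Cons.IH \<open>\<And>w. magnus (foldr push u v) w = conv (magnus u) (magnus v) w\<close>
      by (auto simp: magnus_push l conv_add_left conv_minus_left)
  qed simp
qed

lemma carrier_free_group: "carrier free_group = {w. reduced w}"
  by (simp add: free_group_def)

lemma magnus_mult: "magnus (u \<otimes>\<^bsub>free_group\<^esub> v) w = conv (magnus u) (magnus v) w"
  by (simp add: free_group_def magnus_foldr_push)

lemma magnus_one: "w \<noteq> [] \<Longrightarrow> magnus \<one>\<^bsub>free_group\<^esub> w = 0"
  by (cases w) (simp_all add: free_group_def)

text \<open>For a reduced word with syllables \<open>x\<^sub>1^e\<^sub>1 \<dots> x\<^sub>r^e\<^sub>r\<close> the coefficient of the word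
  \<open>x\<^sub>1 \<dots> x\<^sub>r\<close> is \<open>e\<^sub>1 \<cdots> e\<^sub>r\<close>, and longer words without equal adjacent letters have
  coefficient \<open>0\<close>.\<close>

lemma magnus_reduced:
  assumes "reduced (l # g)"
  shows "\<exists>w e. distinct_adj (fst l # w) \<and> (if snd l then e > 0 else e < 0) \<and>
    magnus (l # g) (fst l # w) = e * magnus (l # g) w \<and> magnus (l # g) w \<noteq> 0 \<and>
    (\<forall>u. distinct_adj u \<longrightarrow> length u > length w \<longrightarrow> u \<noteq> [] \<longrightarrow> hd u \<noteq> fst l \<or> length u > Suc (length w) \<longrightarrow>
      magnus (l # g) u = 0)"
  using assms
proof (induction g arbitrary: l)
  case Nil
  obtain a s where l: "l = (a, s)" by force
  have "magnus [l] u = 0" if "distinct_adj u" "u \<noteq> []" "hd u \<noteq> a \<or> length u > Suc 0" for u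
    using that by (cases u rule: remdups_adj.cases) (auto simp: l)
  then show ?case
    by (intro exI[of _ "[]"] exI[of _ "if snd l then 1 else -1"]) (auto simp: l)
next
  case (Cons m g)
  obtain a s where l: "l = (a, s)" by force
  obtain b r where m: "m = (b, r)" by force
  have red: "reduced (m # g)" "m \<noteq> inv_letter l"
    using Cons.prems by (auto simp: reduced_Cons)
  from Cons.IH[OF red(1)] obtain w e where w: "distinct_adj (b # w)" "if r then e > 0 else e < 0"
    "magnus (m # g) (b # w) = e * magnus (m # g) w" "magnus (m # g) w \<noteq> 0"
    and z: "\<And>u. distinct_adj u \<Longrightarrow> length u > length w \<Longrightarrow> u \<noteq> [] \<Longrightarrow> hd u \<noteq> b \<or> length u > Suc (length w) \<Longrightarrow>
      magnus (m # g) u = 0"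
    by (auto simp: m)
  have other: "magnus (l # m # g) u = magnus (m # g) u" if "u = [] \<or> hd u \<noteq> a" for u
    using that by (cases u) (auto simp: l)
  show ?case
  proof (cases "a = b")
    \<comment> \<open>The first syllable gets longer. Reducedness forces equal signs, so its
      exponent \<open>e\<close> moves away from 0.\<close>
    case True
    then have s: "s = r"
      using red(2) by (auto simp: l m inv_letter_def)
    have w': "magnus (l # m # g) w = magnus (m # g) w"
      using w(1) by (intro other) (cases w; auto simp: True)
    have *: "magnus (l # m # g) (a # w) = (e + (if s then 1 else -1)) * magnus (l # m # g) w"
      using w(3) w' by (cases s) (simp_all add: l True algebra_simps)
    have "magnus (l # m # g) u = 0" if u: "distinct_adj u" "length u > length w" "u \<noteq> []"
      "hd u \<noteq> a \<or> length u > Suc (length w)" for u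
    proof (cases "hd u = a")
      case False
      then show ?thesis using other z u True by simp
    next
      case True
      then obtain v where v: "u = a # v" using u(3) by (cases u) auto
      have "magnus (m # g) u = 0" using z u \<open>a = b\<close> by simp
      moreover have len: "length v > length w" using u v \<open>hd u = a\<close> by auto
      moreover have hd: "hd v \<noteq> a" "v \<noteq> []" using u(1) len by (cases v; auto simp: v)+
      moreover have "magnus (m # g) v = 0" using z[of v] u(1) hd len \<open>a = b\<close> by (auto simp: v distinct_adj_Cons)
      moreover have "magnus (l # m # g) v = 0" using other[of v] hd calculation by auto
      ultimately show ?thesis by (auto simp: v l)
    qed
    then show ?thesis
      using w(1,2,4) * w' True s
      by (intro exI[of _ w] exI[of _ "e + (if s then 1 else -1)"]) (auto simp: l split: if_splits)
  next
    \<comment> \<open>A new syllable begins, with exponent 1 or -1, and the witness grows by the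
      letter \<open>b\<close> of the former first syllable.\<close>
    case False
    have w': "magnus (l # m # g) (b # w) = magnus (m # g) (b # w)"
      using False by (intro other) auto
    have z': "magnus (m # g) (a # b # w) = 0"
      using z[of "a # b # w"] w(1) False by auto
    have "magnus (l # m # g) u = 0" if u: "distinct_adj u" "length u > length (b # w)" "u \<noteq> []"
      "hd u \<noteq> a \<or> length u > Suc (length (b # w))" for u
    proof (cases "hd u = a")
      case False
      then show ?thesis using other z u by simp
    next
      case True
      then obtain v where v: "u = a # v" using u(3) by (cases u) auto
      have "magnus (m # g) u = 0" using z u by simp
      moreover have len: "length v > Suc (length w)" using u v True by auto
      moreover have hd: "hd v \<noteq> a" "v \<noteq> []" using u(1) len by (cases v; auto simp: v)+
      moreover have "magnus (m # g) v = 0" using z[of v] u(1) hd len by (auto simp: v distinct_adj_Cons)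
      moreover have "magnus (l # m # g) v = 0" using other[of v] hd calculation by auto
      ultimately show ?thesis by (auto simp: v l)
    qed
    moreover have "e \<noteq> 0" using w(2) by (auto split: if_splits)
    ultimately show ?thesis
      using w z' w' False
      by (intro exI[of _ "b # w"] exI[of _ "if s then 1 else -1"]) (auto simp: l)
  qed
qed

lemma magnus_faithful:
  assumes "reduced g" "\<And>w. w \<noteq> [] \<Longrightarrow> magnus g w = 0"
  shows "g = []"
proof (cases g)
  case (Cons l h)
  then obtain w e where "if snd l then e > 0 else e < (0::int)"
    "magnus g (fst l # w) = e * magnus g w" "magnus g w \<noteq> 0"
    using magnus_reduced[of l h] assms(1) by blast
  then show ?thesis
    using assms(2)[of "fst l # w"] by (auto split: if_splits)
qed



context group
begin

abbreviation comm :: "'a \<Rightarrow> 'a \<Rightarrow> 'a" where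
  "comm a b \<equiv> a \<otimes> b \<otimes> inv a \<otimes> inv b"

lemma inv_cancel:
  assumes "x \<in> carrier G" "y \<in> carrier G"
  shows "inv x \<otimes> (x \<otimes> y) = y" "x \<otimes> (inv x \<otimes> y) = y"
  using assms by (simp_all flip: m_assoc)

end

interpretation F: group "free_group :: 'a word monoid"
  by (rule group_free_group)

lemma conv_dvd:
  "(\<And>v. length v \<le> length w \<Longrightarrow> d dvd g v) \<Longrightarrow> d dvd conv f g w"
  unfolding conv_sum by (intro dvd_sum) auto

lemma conv_head_dvd:
  assumes "\<And>v. length v < length w \<Longrightarrow> d dvd g v"
  shows "d dvd conv f g w - f [] * g w"
  using assms by (cases w) (auto intro!: conv_dvd)

lemma conv_inner:
  assumes "w \<noteq> []" "f [] = 1" "g [] = 1"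
  shows "conv f g w - f w - g w = (\<Sum>i\<in>{1..<length w}. f (take i w) * g (drop i w))"
proof -
  obtain m where m: "length w = Suc m"
    using assms(1) by (cases w) auto
  have "conv f g w = (\<Sum>i\<le>m. f (take i w) * g (drop i w)) + f w"
    using assms(3) m by (simp add: conv_sum)
  also have "(\<Sum>i\<le>m. f (take i w) * g (drop i w)) = g w + (\<Sum>i\<in>{1..<Suc m}. f (take i w) * g (drop i w))"
    using assms(2) by (simp add: atMost_atLeast0 sum.atLeast_Suc_atMost atLeastLessThanSuc_atLeastAtMost)
  finally show ?thesis
    by (simp add: m)
qed

section \<open>The filtration of the free group by the order of the Magnus expansion\<close>

text \<open>The elements congruent to 1 modulo \<open>d\<close> and terms of degree at least
  \<open>k\<close>. For \<open>d = 0\<close> the congruences are equalities and \<open>k\<close>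
  bounds the order of the expansion; powers of some \<open>p\<close> serve residual
  nilpotence.\<close>

definition mfilt :: "int \<Rightarrow> nat \<Rightarrow> 'a word set" where
  "mfilt d k = {g. reduced g \<and> (\<forall>w. w \<noteq> [] \<longrightarrow> length w < k \<longrightarrow> d dvd magnus g w)}"

lemma mfilt_carrier: "g \<in> mfilt d k \<Longrightarrow> g \<in> carrier free_group"
  by (simp add: mfilt_def carrier_free_group)

lemma mfilt_1: "mfilt d (Suc 0) = carrier free_group"
  by (auto simp: mfilt_def carrier_free_group)

lemma mfilt_dvd: "g \<in> mfilt d k \<Longrightarrow> w \<noteq> [] \<Longrightarrow> length w < k \<Longrightarrow> d dvd magnus g w"
  by (simp add: mfilt_def)

text \<open>From gh - 1 = (g - 1) + (h - 1) + (g - 1)(h - 1): modulo \<open>d\<close> the last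
  summand has order at least \<open>m + n\<close>, and in that degree it is the product of the
  leading forms.\<close>

lemma magnus_mult_top:
  assumes g: "g \<in> mfilt d m" and h: "h \<in> mfilt d n" and mn: "m > 0" "n > 0"
    and w: "w \<noteq> []" "length w \<le> m + n"
  shows "d dvd magnus (g \<otimes>\<^bsub>free_group\<^esub> h) w - magnus g w - magnus h w
    - (if length w = m + n then magnus g (take m w) * magnus h (drop m w) else 0)"
proof -
  let ?t = "\<lambda>i. magnus g (take i w) * magnus h (drop i w)"
  let ?e = "\<lambda>i. if i = m then if length w = m + n then ?t m else 0 else 0"
  have "d dvd ?t i - ?e i" if i: "i \<in> {1..<length w}" for i
  proof -
    consider "i < m" | "length w - i < n" | "i = m" "length w = m + n"
      using w(2) i by fastforce
    then show ?thesis
    proof cases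
      case 1
      then have "d dvd magnus g (take i w)"
        using i w(1) by (intro mfilt_dvd[OF g]) auto
      then show ?thesis using 1 by simp
    next
      case 2
      then have "d dvd magnus h (drop i w)"
        using i by (intro mfilt_dvd[OF h]) auto
      then show ?thesis using 2 by auto
    qed simp
  qed
  then have "d dvd (\<Sum>i\<in>{1..<length w}. ?t i - ?e i)"
    by (rule dvd_sum)
  moreover have "(\<Sum>i\<in>{1..<length w}. ?e i) = (if length w = m + n then ?t m else 0)"
    using mn by (simp add: sum.delta)
  ultimately show ?thesis
    using conv_inner[OF w(1), of "magnus g" "magnus h"] by (simp add: magnus_mult sum_subtractf)
qed

lemma magnus_mult_mfilt:
  assumes g: "g \<in> mfilt d k" and h: "h \<in> carrier free_group" and w: "w \<noteq> []" "length w \<le> k"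
  shows "d dvd magnus (g \<otimes>\<^bsub>free_group\<^esub> h) w - magnus g w - magnus h w"
proof -
  have "k > 0" using w by (cases k) auto
  then show ?thesis
    using magnus_mult_top[of g d k h 1 w] assms by (simp add: mfilt_1)
qed

lemma magnus_inv_mfilt:
  assumes "g \<in> mfilt d k" "w \<noteq> []" "length w \<le> k"
  shows "d dvd magnus g w + magnus (inv\<^bsub>free_group\<^esub> g) w"
proof -
  have "d dvd magnus (g \<otimes>\<^bsub>free_group\<^esub> inv\<^bsub>free_group\<^esub> g) w - magnus g w - magnus (inv\<^bsub>free_group\<^esub> g) w"
    using assms mfilt_carrier by (intro magnus_mult_mfilt) auto
  then have "d dvd - (magnus g w + magnus (inv\<^bsub>free_group\<^esub> g) w)"
    using assms(2) mfilt_carrier[OF assms(1)] by (simp add: magnus_one)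
  then show ?thesis
    by (metis dvd_minus_iff)
qed

lemma dvd_diff_cancel: "(d::int) dvd a - b - c \<Longrightarrow> d dvd b \<Longrightarrow> d dvd c \<Longrightarrow> d dvd a"
  by (metis diff_diff_eq dvd_add dvd_diff_commute zdvd_zdiffD)

lemma subgroup_mfilt: "subgroup (mfilt d k) free_group"
proof
  show "mfilt d k \<subseteq> carrier free_group"
    by (auto intro: mfilt_carrier)
  show "\<one>\<^bsub>free_group\<^esub> \<in> mfilt d k"
    using F.one_closed by (auto simp: mfilt_def magnus_one carrier_free_group)
  fix g :: "'a word" assume g: "g \<in> mfilt d k"
  show "inv\<^bsub>free_group\<^esub> g \<in> mfilt d k"
    using g magnus_inv_mfilt[OF g] F.inv_closed[of g]
    by (fastforce simp: mfilt_def carrier_free_group dvd_add_right_iff)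
next
  fix g h :: "'a word" assume g: "g \<in> mfilt d k" and h: "h \<in> mfilt d k"
  have "d dvd magnus (g \<otimes>\<^bsub>free_group\<^esub> h) w" if "w \<noteq> []" "length w < k" for w
    using magnus_mult_mfilt[OF g mfilt_carrier[OF h], of w] mfilt_dvd[OF g] mfilt_dvd[OF h] that
    by (auto intro: dvd_diff_cancel)
  then show "g \<otimes>\<^bsub>free_group\<^esub> h \<in> mfilt d k"
    using F.m_closed[of g h] g h by (auto simp: mfilt_def carrier_free_group)
qed

lemma mfilt_Suc:
  "g \<in> mfilt d (Suc k) \<longleftrightarrow> g \<in> mfilt d k \<and> (\<forall>w. w \<noteq> [] \<longrightarrow> length w = k \<longrightarrow> d dvd magnus g w)"
  by (auto simp: mfilt_def less_Suc_eq)

text \<open>With z the commutator, compare coefficients in z (hg) = gh. The summands g - 1 and h - 1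
  occur in both gh and hg and cancel; what remains is the Lie bracket of the leading forms, in
  degree \<open>m + n\<close>.\<close>

lemma magnus_comm:
  assumes g: "g \<in> mfilt d m" and h: "h \<in> mfilt d n" and mn: "m > 0" "n > 0"
  shows "F.comm g h \<in> mfilt d (m + n)"
    and "length w = m + n \<Longrightarrow> d dvd magnus (F.comm g h) w
      - (magnus g (take m w) * magnus h (drop m w) - magnus h (take n w) * magnus g (drop n w))"
proof -
  let ?z = "F.comm g h"
  note gh = mfilt_carrier[OF g] mfilt_carrier[OF h]
  have z: "?z \<otimes>\<^bsub>free_group\<^esub> (h \<otimes>\<^bsub>free_group\<^esub> g) = g \<otimes>\<^bsub>free_group\<^esub> h"
    using gh by (simp add: F.m_assoc F.inv_cancel)
  have zc: "?z \<in> carrier free_group"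
    using gh by simp
  let ?t = "\<lambda>w. magnus g (take m w) * magnus h (drop m w) - magnus h (take n w) * magnus g (drop n w)"
  \<comment> \<open>Membership in \<open>mfilt d j\<close> lets the coefficients of z (hg) split
    additively up to degree \<open>j\<close>; this lifts the order of z one by one up to
    \<open>m + n\<close>.\<close>
  have step: "d dvd magnus ?z w - (if length w = m + n then ?t w else 0)"
    if zj: "?z \<in> mfilt d j" and w: "w \<noteq> []" "length w \<le> j" "j \<le> m + n" for w j
  proof -
    define r q e e' where "r = magnus (g \<otimes>\<^bsub>free_group\<^esub> h) w" and "q = magnus (h \<otimes>\<^bsub>free_group\<^esub> g) w"
      and "e = (if length w = m + n then magnus g (take m w) * magnus h (drop m w) else 0)"
      and "e' = (if length w = m + n then magnus h (take n w) * magnus g (drop n w) else 0)"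
    have "d dvd r - magnus ?z w - q"
      using magnus_mult_mfilt[OF zj _ w(1,2), of "h \<otimes>\<^bsub>free_group\<^esub> g"] gh by (simp only: z r_def q_def) simp
    moreover have "d dvd r - magnus g w - magnus h w - e"
      unfolding r_def e_def using w by (intro magnus_mult_top g h mn) auto
    moreover have "d dvd q - magnus h w - magnus g w - e'"
      using magnus_mult_top[OF h g mn(2,1) w(1)] w(2,3) by (simp add: q_def e'_def add.commute)
    moreover have "magnus ?z w - (e - e')
      = (r - magnus g w - magnus h w - e) - (q - magnus h w - magnus g w - e') - (r - magnus ?z w - q)"
      by simp
    ultimately have "d dvd magnus ?z w - (e - e')"
      by (simp only: dvd_diff)
    then show ?thesis
      by (auto simp: e_def e'_def)
  qed
  have "j \<le> m + n \<Longrightarrow> ?z \<in> mfilt d j" for j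
  proof (induction j)
    case 0
    show ?case using zc by (simp add: mfilt_def carrier_free_group)
  next
    case (Suc j)
    then have "d dvd magnus ?z w" if "w \<noteq> []" "length w = j" for w
      using step[of j w] that by simp
    then show ?case
      using Suc by (auto simp: mfilt_Suc)
  qed
  then show zmn: "?z \<in> mfilt d (m + n)" by simp
  show "d dvd magnus ?z w - ?t w" if "length w = m + n"
    using step[OF zmn, of w] that mn by (cases w) auto
qed

section \<open>The action of endomorphisms on leading coefficients\<close>

text \<open>Substitution in a power series: the variable \<open>a\<close> is replaced by
  \<open>P a\<close> without its constant term, as only coefficients of \<open>P a\<close> on
  nonempty words \<open>b # u\<close> enter.\<close>

function subst :: "('a::finite \<Rightarrow> 'a list \<Rightarrow> int) \<Rightarrow> ('a list \<Rightarrow> int) \<Rightarrow> 'a list \<Rightarrow> int" where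
  "subst P f [] = f []"
| "subst P f (b # w) = (\<Sum>a\<in>UNIV. conv (\<lambda>u. P a (b # u)) (subst P (\<lambda>u. f (a # u))) w)"
  by pat_completeness auto
termination
  by (relation "measure (\<lambda>(P, f, w). length w)") auto

lemma subst_add: "subst P (\<lambda>u. f u + g u) w = subst P f w + subst P g w"
proof (induction w arbitrary: f g rule: length_induct)
  case (1 w)
  show ?case
  proof (cases w)
    case (Cons b v)
    have "conv (\<lambda>u. P a (b # u)) (subst P (\<lambda>u. f (a # u) + g (a # u))) v
      = conv (\<lambda>u. P a (b # u)) (\<lambda>u. subst P (\<lambda>u. f (a # u)) u + subst P (\<lambda>u. g (a # u)) u) v" for a
      using 1 by (intro conv_cong) (auto simp: Cons)
    then show ?thesis
      by (simp add: Cons conv_add_right sum.distrib)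
  qed simp
qed

lemma subst_zero: "subst P (\<lambda>u. 0) w = 0"
  using subst_add[of P "\<lambda>u. 0" "\<lambda>u. 0" w] by simp

lemma subst_magnus_Nil: "subst P (magnus []) w = magnus [] w"
proof (cases w)
  case (Cons b v)
  have "subst P (\<lambda>u. 0) = (\<lambda>u. 0)"
    by (simp add: subst_zero fun_eq_iff)
  then show ?thesis
    by (simp add: Cons conv_zero_right)
qed simp

text \<open>The hypotheses on \<open>f'\<close> say that it is the series (1 + a) f, and
  \<open>P a [] = 1\<close> makes \<open>P a\<close> the image of 1 + a under the
  substitution.\<close>

lemma subst_letter:
  assumes "f' [] = f []" "\<And>c u. f' (c # u) = f (c # u) + (if a = c then f u else 0)" "P a [] = 1"
  shows "subst P f' w = conv (P a) (subst P f) w"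
proof (cases w)
  case (Cons b v)
  have "(\<lambda>u. f' (c # u)) = (\<lambda>u. f (c # u) + (if a = c then f u else 0))" for c
    using assms(2) by auto
  moreover have "subst P (\<lambda>u. if a = c then f u else 0) = (\<lambda>u. if a = c then subst P f u else 0)" for c
    by (auto simp: subst_zero)
  ultimately have "subst P (\<lambda>u. f' (c # u)) = (\<lambda>u. subst P (\<lambda>u. f (c # u)) u + (if a = c then subst P f u else 0))" for c
    by (auto simp: subst_add fun_eq_iff)
  moreover have "conv f (\<lambda>u. if a = c then g u else 0) v = (if a = c then conv f g v else 0)" for f g c
    by (simp add: conv_zero_right)
  ultimately show ?thesis
    by (simp add: Cons assms(3) conv_add_right sum.distrib)
qed (simp add: assms)

lemma letter_mult:
  "reduced (l # g) \<Longrightarrow> [l] \<otimes>\<^bsub>free_group\<^esub> g = l # g"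
  by (simp add: free_group_def push_reduced)

lemma letter_carrier [simp]: "[l] \<in> carrier free_group"
  by (simp add: carrier_free_group reduced_Cons)

lemma inv_letter_word: "inv\<^bsub>free_group\<^esub> [(a, s)] = [(a, \<not> s)]"
  by (rule F.inv_equality) (simp_all, simp add: free_group_def inv_letter_def)

text \<open>Letter by letter: \<open>subst_letter\<close> matches left multiplication by a generator
  with multiplication by the expansion of its image.\<close>

lemma magnus_hom:
  fixes \<theta> :: "'a::finite word \<Rightarrow> 'a word"
  assumes \<theta>: "\<theta> \<in> hom free_group free_group" and g: "reduced g"
  shows "magnus (\<theta> g) w = subst (\<lambda>a. magnus (\<theta> [(a, True)])) (magnus g) w"
  using g
proof (induction g arbitrary: w)
  case Nil
  have "\<theta> [] = []"
    using hom_one[OF \<theta> group_free_group group_free_group] by (simp add: free_group_def)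
  then show ?case by (simp add: subst_magnus_Nil)
next
  case (Cons l g)
  let ?P = "\<lambda>a. magnus (\<theta> [(a, True)])"
  have g: "reduced g" "g \<in> carrier free_group"
    using Cons.prems by (auto simp: reduced_Cons carrier_free_group)
  obtain a s where l: "l = (a, s)" by force
  have closed: "\<theta> u \<in> carrier free_group" if "u \<in> carrier free_group" for u
    using \<theta> that by (auto simp: hom_def)
  show ?case
  proof (cases s)
    case True
    have "\<theta> (l # g) = \<theta> [l] \<otimes>\<^bsub>free_group\<^esub> \<theta> g"
      using hom_mult[OF \<theta>, of "[l]" g] g by (simp add: letter_mult[OF Cons.prems])
    then have "magnus (\<theta> (l # g)) w = conv (?P a) (magnus (\<theta> g)) w"
      using True by (simp add: magnus_mult l)
    also have "\<dots> = conv (?P a) (subst ?P (magnus g)) w"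
      using Cons.IH[OF g(1)] by (intro conv_cong) auto
    also have "\<dots> = subst ?P (magnus (l # g)) w"
      by (rule subst_letter[symmetric]) (auto simp: l True)
    finally show ?thesis .
  next
    case False
    \<comment> \<open>For an inverse letter \<open>subst_letter\<close> only describes g as the
      product of \<open>?x\<close> and \<open>?g\<close>; the resulting equation is solved for
      \<open>\<theta> ?g\<close> by multiplying with the inverse of
      \<open>\<theta> ?x\<close>.\<close>
    let ?x = "[(a, True)]" and ?g = "l # g"
    have gc: "?g \<in> carrier free_group"
      using Cons.prems by (simp add: carrier_free_group)
    have "?x \<otimes>\<^bsub>free_group\<^esub> ?g = g"
    proof -
      have "?x \<otimes>\<^bsub>free_group\<^esub> ?g = ?x \<otimes>\<^bsub>free_group\<^esub> (inv\<^bsub>free_group\<^esub> ?x \<otimes>\<^bsub>free_group\<^esub> g)"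
        using letter_mult[OF Cons.prems] False by (simp add: inv_letter_word l)
      also have "\<dots> = g"
        using g(2) by (simp del: inv_letter_word add: F.m_assoc[symmetric])
      finally show ?thesis .
    qed
    then have "\<theta> g = \<theta> ?x \<otimes>\<^bsub>free_group\<^esub> \<theta> ?g"
      using hom_mult[OF \<theta>, of ?x ?g] gc by simp
    then have "\<theta> ?g = inv\<^bsub>free_group\<^esub> \<theta> ?x \<otimes>\<^bsub>free_group\<^esub> \<theta> g"
      using closed[OF gc] closed[of ?x] closed[OF g(2)] by (simp add: F.inv_solve_left)
    then have "magnus (\<theta> ?g) w = conv (magnus (inv\<^bsub>free_group\<^esub> \<theta> ?x)) (magnus (\<theta> g)) w"
      by (simp add: magnus_mult)
    also have "\<dots> = conv (magnus (inv\<^bsub>free_group\<^esub> \<theta> ?x)) (conv (?P a) (subst ?P (magnus ?g))) w"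
    proof (intro conv_cong refl)
      fix u
      have "magnus (\<theta> g) u = subst ?P (magnus g) u" by (rule Cons.IH[OF g(1)])
      also have "\<dots> = conv (?P a) (subst ?P (magnus ?g)) u"
        by (rule subst_letter) (auto simp: l False)
      finally show "magnus (\<theta> g) u = conv (?P a) (subst ?P (magnus ?g)) u" .
    qed
    also have "\<dots> = conv (magnus (inv\<^bsub>free_group\<^esub> \<theta> ?x \<otimes>\<^bsub>free_group\<^esub> \<theta> ?x)) (subst ?P (magnus ?g)) w"
      unfolding conv_assoc[symmetric] by (intro conv_cong) (simp_all add: magnus_mult)
    also have "\<dots> = subst ?P (magnus ?g) w"
      using closed[of ?x] by (simp add: conv_magnus_Nil) (simp add: free_group_def conv_magnus_Nil)
    finally show ?thesis .
  qed
qed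

text \<open>\<open>act M\<close> is the tensor power of the linear map \<open>M\<close> on the coefficients of words of each length.\<close>

fun act :: "('a::finite \<Rightarrow> 'a \<Rightarrow> int) \<Rightarrow> ('a list \<Rightarrow> int) \<Rightarrow> 'a list \<Rightarrow> int" where
  "act M f [] = f []"
| "act M f (b # w) = (\<Sum>a\<in>UNIV. M b a * act M (\<lambda>u. f (a # u)) w)"

lemma act_add: "act M (\<lambda>u. f u + g u) w = act M f w + act M g w"
  by (induction w arbitrary: f g) (simp_all add: sum.distrib algebra_simps)

lemma act_scale: "act M (\<lambda>u. c * f u) w = c * act M f w"
  by (induction w arbitrary: f) (simp_all add: sum_distrib_left algebra_simps)

lemma act_diff: "act M (\<lambda>u. f u - g u) w = act M f w - act M g w"
  using act_add[of M f "\<lambda>u. (-1) * g u" w] by (simp only: act_scale) simp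

lemma act_dvd: "(\<And>u. length u = length w \<Longrightarrow> d dvd f u) \<Longrightarrow> d dvd act M f w"
  by (induction w arbitrary: f) (auto intro!: dvd_sum)

text \<open>In the lowest degree only the linear part of each \<open>P a\<close> contributes: a
  longer piece of \<open>P a\<close> is paired with coefficients of \<open>f\<close> on shorter
  words, which vanish modulo \<open>d\<close>.\<close>

lemma subst_lead:
  assumes "\<And>u. u \<noteq> [] \<Longrightarrow> length u < length w \<Longrightarrow> d dvd f u"
  shows "d dvd subst P f w - act (\<lambda>b a. P a [b]) f w"
  using assms
proof (induction w arbitrary: f rule: length_induct)
  case (1 w)
  show ?case
  proof (cases w)
    case (Cons b v)
    have *: "d dvd conv (\<lambda>u. P a (b # u)) (subst P (\<lambda>u. f (a # u))) v
      - P a [b] * act (\<lambda>b a. P a [b]) (\<lambda>u. f (a # u)) v" for a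
    proof -
      let ?f = "\<lambda>u. f (a # u)" and ?M = "\<lambda>b a. P a [b]"
      have f: "d dvd ?f u" if "length u < length v" for u
        using 1(2) that by (simp add: Cons)
      have "d dvd subst P ?f u" if "length u < length v" for u
      proof -
        have "d dvd subst P ?f u - act ?M ?f u" "d dvd act ?M ?f u"
          using 1(1) f that by (auto simp: Cons intro!: act_dvd)
        then show ?thesis by (rule zdvd_zdiffD)
      qed
      then have "d dvd conv (\<lambda>u. P a (b # u)) (subst P ?f) v - P a [b] * subst P ?f v"
        using conv_head_dvd[of v d "subst P ?f" "\<lambda>u. P a (b # u)"] by simp
      moreover have "d dvd P a [b] * (subst P ?f v - act ?M ?f v)"
        using 1(1) f by (auto simp: Cons intro!: dvd_mult)
      ultimately have "d dvd conv (\<lambda>u. P a (b # u)) (subst P ?f) v - P a [b] * subst P ?f v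
        + P a [b] * (subst P ?f v - act ?M ?f v)"
        by (rule dvd_add)
      then show ?thesis by (simp add: algebra_simps)
    qed
    show ?thesis
      unfolding Cons subst.simps act.simps sum_subtractf[symmetric] by (intro dvd_sum *)
  qed simp
qed

lemma magnus_hom_lead:
  fixes \<theta> :: "'a::finite word \<Rightarrow> 'a word"
  assumes \<theta>: "\<theta> \<in> hom free_group free_group" and g: "g \<in> mfilt d k"
    and w: "length w \<le> k" "w \<noteq> []"
  shows "d dvd magnus (\<theta> g) w - act (\<lambda>b a. magnus (\<theta> [(a, True)]) [b]) (magnus g) w"
  using subst_lead[of w d "magnus g" "\<lambda>a. magnus (\<theta> [(a, True)])"] g w magnus_hom[OF \<theta>, of g w]
  by (auto simp: mfilt_def)



section \<open>The transfinite lower central series of a group\<close>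

declare lower_central.simps [simp del]

lemma le_ord_succ: "\<alpha> \<le> ord_succ \<beta> \<longleftrightarrow> \<alpha> \<le> \<beta> \<or> \<alpha> = ord_succ \<beta>"
  by (cases \<alpha>; cases \<beta>) (auto simp: less_eq_ord_def)

lemma not_less_ord_zero: "\<not> \<beta> < Ord 0 0 0"
  by (cases \<beta>) simp

lemma less_ord_succ: "\<delta> < ord_succ \<delta>"
  by (cases \<delta>) simp

lemma ord_fin_1_le: "ord_fin (Suc 0) \<le> \<alpha> \<longleftrightarrow> \<alpha> \<noteq> Ord 0 0 0"
  by (cases \<alpha>) (auto simp: less_eq_ord_def ord_fin_def)

lemma ord_cases [case_names succ limit]:
  obtains \<beta> where "\<alpha> = ord_succ \<beta>" | a b where "\<alpha> = Ord a b 0"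
proof (cases \<alpha>)
  case (Ord a b c)
  then show ?thesis
    using that by (cases c) (auto, metis ord_succ.simps)
qed

lemma lower_central_limit:
  "lower_central G (Ord a b 0) = {g \<in> carrier G. \<forall>\<beta>. \<beta> \<noteq> Ord 0 0 0 \<longrightarrow> \<beta> < Ord a b 0 \<longrightarrow> g \<in> lower_central G \<beta>}"
  by (subst lower_central.simps) (auto simp: ord_fin_1_le)

lemma lower_central_ord_succ:
  "lower_central G (ord_succ \<beta>) = (if \<beta> = Ord 0 0 0 then carrier G
    else commutator_subgroup G (lower_central G \<beta>) (carrier G))"
  by (cases \<beta>) (simp add: ord_fin_def lower_central.simps(1))

lemma lower_central_Suc:
  "Ord i j c \<noteq> Ord 0 0 0 \<Longrightarrow>
    lower_central G (Ord i j (Suc c)) = commutator_subgroup G (lower_central G (Ord i j c)) (carrier G)"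
  using lower_central_ord_succ[of G "Ord i j c"] by (simp only: ord_succ.simps if_False)

lemma lower_central_0: "lower_central G (Ord 0 0 0) = carrier G"
  by (auto simp: lower_central_limit not_less_ord_zero)

context group
begin

lemma comm_conj:
  assumes "a \<in> carrier G" "b \<in> carrier G" "g \<in> carrier G"
  shows "g \<otimes> comm a b \<otimes> inv g = comm (g \<otimes> a \<otimes> inv g) (g \<otimes> b \<otimes> inv g)"
  using assms by (simp add: m_assoc inv_mult_group inv_cancel)

lemma comm_in_commutator_subgroup:
  "a \<in> H \<Longrightarrow> b \<in> K \<Longrightarrow> comm a b \<in> commutator_subgroup G H K"
  unfolding commutator_subgroup_def by (intro generate.incl) auto

lemma commutator_subgroup_incl:
  assumes "subgroup S G" "\<And>h k. h \<in> H \<Longrightarrow> k \<in> K \<Longrightarrow> comm h k \<in> S"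
  shows "commutator_subgroup G H K \<subseteq> S"
  unfolding commutator_subgroup_def using assms by (intro generate_subgroup_incl) auto

lemma commutator_subgroup_normal:
  assumes "H \<lhd> G"
  shows "commutator_subgroup G H (carrier G) \<lhd> G"
  unfolding commutator_subgroup_def
proof (rule normal_generateI)
  interpret H: normal H G by fact
  show "(\<Union>h\<in>H. \<Union>k\<in>carrier G. {comm h k}) \<subseteq> carrier G"
    by auto
  fix z g
  assume "z \<in> (\<Union>h\<in>H. \<Union>k\<in>carrier G. {comm h k})" and g: "g \<in> carrier G"
  then obtain h k where "h \<in> H" "k \<in> carrier G" "z = comm h k" by auto
  then have "g \<otimes> z \<otimes> inv g = comm (g \<otimes> h \<otimes> inv g) (g \<otimes> k \<otimes> inv g)"
    "g \<otimes> h \<otimes> inv g \<in> H" "g \<otimes> k \<otimes> inv g \<in> carrier G"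
    using g H.inv_op_closed2 H.subset by (auto simp only: comm_conj subset_eq m_closed inv_closed)
  then show "g \<otimes> z \<otimes> inv g \<in> (\<Union>h\<in>H. \<Union>k\<in>carrier G. {comm h k})"
    by blast
qed

lemma lower_central_normal: "lower_central G \<alpha> \<lhd> G"
proof (induction \<alpha> rule: less_induct)
  case (less \<alpha>)
  have carrier: "carrier G \<lhd> G"
    by (intro normal_invI subgroup_self) auto
  show ?case
  proof (cases \<alpha> rule: ord_cases)
    case (succ \<beta>)
    then have "lower_central G \<beta> \<lhd> G"
      using less by (cases \<beta>) auto
    then show ?thesis
      by (simp add: succ lower_central_ord_succ carrier commutator_subgroup_normal)
  next
    case (limit a b)
    show ?thesis
    proof (rule normal_invI)
      show "subgroup (lower_central G \<alpha>) G"
      proof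
        show "lower_central G \<alpha> \<subseteq> carrier G" "\<one> \<in> lower_central G \<alpha>"
          using less normal_imp_subgroup subgroup.one_closed
          unfolding limit lower_central_limit by fastforce+
      next
        fix x y
        assume xy: "x \<in> lower_central G \<alpha>" "y \<in> lower_central G \<alpha>"
        show "x \<otimes> y \<in> lower_central G \<alpha>"
          using less xy normal_imp_subgroup subgroup.m_closed
          unfolding limit lower_central_limit by fastforce
      next
        fix x
        assume x: "x \<in> lower_central G \<alpha>"
        show "inv x \<in> lower_central G \<alpha>"
          using less x normal_imp_subgroup subgroup.m_inv_closed
          unfolding limit lower_central_limit by fastforce
      qed
    next
      fix x h
      assume x: "x \<in> carrier G" and h: "h \<in> lower_central G \<alpha>"
      show "x \<otimes> h \<otimes> inv x \<in> lower_central G \<alpha>"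
        using less x h normal.inv_op_closed2 unfolding limit lower_central_limit by fastforce
    qed
  qed
qed

lemma lower_central_subgroup: "subgroup (lower_central G \<alpha>) G"
  using lower_central_normal by (rule normal_imp_subgroup)

lemma lower_central_closed: "g \<in> lower_central G \<alpha> \<Longrightarrow> g \<in> carrier G"
  using lower_central_subgroup subgroup.subset by blast

lemma lower_central_Suc_subset: "lower_central G (ord_succ \<alpha>) \<subseteq> lower_central G \<alpha>"
proof (cases "\<alpha> = Ord 0 0 0")
  case True
  then show ?thesis
    using lower_central_ord_succ[of G \<alpha>] by (simp add: lower_central_0)
next
  case False
  interpret H: normal "lower_central G \<alpha>" G by (rule lower_central_normal)
  have "comm h k \<in> lower_central G \<alpha>" if "h \<in> lower_central G \<alpha>" "k \<in> carrier G" for h k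
  proof -
    have "h \<otimes> (k \<otimes> inv h \<otimes> inv k) \<in> lower_central G \<alpha>"
      using that by (intro H.m_closed H.inv_op_closed2) auto
    then show ?thesis
      using that H.subset by (simp add: m_assoc subset_eq)
  qed
  then show ?thesis
    using False by (simp add: lower_central_ord_succ commutator_subgroup_incl lower_central_subgroup)
qed

lemma lower_central_antimono: "\<alpha> \<le> \<beta> \<Longrightarrow> lower_central G \<beta> \<subseteq> lower_central G \<alpha>"
proof (induction \<beta> rule: less_induct)
  case (less \<beta>)
  show ?case
  proof (cases \<beta> rule: ord_cases)
    case (succ \<delta>)
    then show ?thesis
      using less.IH[of \<delta>] less.prems lower_central_Suc_subset[of \<delta>] less_ord_succ[of \<delta>]
      by (auto simp: le_ord_succ)
  next
    case (limit a b)
    show ?thesis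
    proof (cases "\<alpha> = Ord 0 0 0")
      case True
      then show ?thesis using lower_central_closed by (auto simp: lower_central_0)
    next
      case False
      show ?thesis
      proof (cases "\<alpha> = \<beta>")
        case False
        then have "\<alpha> < Ord a b 0" using less.prems limit by simp
        then show ?thesis
          unfolding limit lower_central_limit using \<open>\<alpha> \<noteq> Ord 0 0 0\<close> by blast
      qed simp
    qed
  qed
qed

text \<open>Successor steps reproduce the same commutator subgroup, and limit steps intersect it
  with larger terms only. Index 0 is excluded because its dummy value coincides with the term at
  1.\<close>

lemma lower_central_stable:
  assumes "\<alpha> \<noteq> Ord 0 0 0" "lower_central G (ord_succ \<alpha>) = lower_central G \<alpha>" "\<alpha> \<le> \<beta>"
  shows "lower_central G \<beta> = lower_central G \<alpha>"
  using assms(3)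
proof (induction \<beta> rule: less_induct)
  case (less \<beta>)
  show ?case
  proof (cases "\<alpha> = \<beta>")
    case neq: False
    show ?thesis
    proof (cases \<beta> rule: ord_cases)
      case (succ \<delta>)
      have "\<alpha> \<le> \<delta>" using less.prems succ neq by (simp add: le_ord_succ)
      moreover have "\<delta> < \<beta>" unfolding succ by (rule less_ord_succ)
      ultimately have *: "lower_central G \<delta> = lower_central G \<alpha>"
        using less.IH by blast
      have "\<delta> \<noteq> Ord 0 0 0"
        using \<open>\<alpha> \<le> \<delta>\<close> assms(1) by (metis dual_order.trans ord_fin_1_le)
      then have "lower_central G \<beta> = lower_central G (ord_succ \<alpha>)"
        using assms(1) by (simp add: succ lower_central_ord_succ *)
      then show ?thesis using assms(2) by simp
    next
      case (limit a b)
      have "g \<in> lower_central G \<delta>" if "g \<in> lower_central G \<alpha>" "\<delta> < \<beta>" for g \<delta>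
      proof (cases "\<alpha> \<le> \<delta>")
        case True
        then show ?thesis using less.IH that by blast
      next
        case False
        then have "\<delta> \<le> \<alpha>" by simp
        then show ?thesis using that lower_central_antimono by blast
      qed
      then have "lower_central G \<alpha> \<subseteq> lower_central G \<beta>"
        unfolding limit lower_central_limit using lower_central_closed by blast
      then show ?thesis
        using lower_central_antimono[OF less.prems] by blast
    qed
  qed simp
qed

section \<open>Commutators modulo normal subgroups\<close>

lemma commute_iff_comm:
  assumes "a \<in> carrier G" "b \<in> carrier G"
  shows "comm a b = \<one> \<longleftrightarrow> a \<otimes> b = b \<otimes> a"
proof -
  have "comm a b = (a \<otimes> b) \<otimes> inv (b \<otimes> a)"
    using assms by (simp add: inv_mult_group m_assoc)
  then show ?thesis
    using assms by (simp add: inv_solve_right')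
qed

text \<open>Turns membership in \<open>S\<close> into equations in an abstract group
  \<open>Q\<close>, so that commutators in \<open>S\<close> become commuting pairs.\<close>

lemma quotient_hom:
  assumes "S \<lhd> G"
  obtains Q :: "'a set monoid" and \<pi>
  where "group_hom G Q \<pi>" "\<pi> ` carrier G = carrier Q"
    "\<And>a. a \<in> carrier G \<Longrightarrow> \<pi> a = \<one>\<^bsub>Q\<^esub> \<longleftrightarrow> a \<in> S"
proof (rule that)
  interpret S: normal S G by fact
  show "group_hom G (G Mod S) (\<lambda>a. S #> a)"
    using S.factorgroup_is_group S.r_coset_hom_Mod is_group
    by (simp add: group_hom_def group_hom_axioms_def)
  show "(\<lambda>a. S #> a) ` carrier G = carrier (G Mod S)"
    by (auto simp: carrier_FactGroup)
  show "S #> a = \<one>\<^bsub>G Mod S\<^esub> \<longleftrightarrow> a \<in> S" if "a \<in> carrier G" for a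
    using that S.subgroup_axioms
    by (metis FactGroup_def coset_join1 coset_join2 monoid.select_convs(2) S.is_subgroup)
qed

lemma hom_commute_iff:
  assumes "group_hom G Q \<pi>" "\<And>a. a \<in> carrier G \<Longrightarrow> \<pi> a = \<one>\<^bsub>Q\<^esub> \<longleftrightarrow> a \<in> S"
    and "a \<in> carrier G" "b \<in> carrier G"
  shows "\<pi> a \<otimes>\<^bsub>Q\<^esub> \<pi> b = \<pi> b \<otimes>\<^bsub>Q\<^esub> \<pi> a \<longleftrightarrow> comm a b \<in> S"
proof -
  interpret \<pi>: group_hom G Q \<pi> by fact
  have "\<pi> (comm a b) = \<pi>.H.comm (\<pi> a) (\<pi> b)"
    using assms(3,4) by simp
  then show ?thesis
    using assms(2)[of "comm a b"] assms(3,4) \<pi>.H.commute_iff_comm[of "\<pi> a" "\<pi> b"] by simp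
qed

lemma subgroup_commuting_image:
  assumes "group_hom G Q \<pi>" "A \<subseteq> carrier Q"
  shows "subgroup {z \<in> carrier G. \<forall>a\<in>A. a \<otimes>\<^bsub>Q\<^esub> \<pi> z = \<pi> z \<otimes>\<^bsub>Q\<^esub> a} G" (is "subgroup ?C G")
proof -
  interpret \<pi>: group_hom G Q \<pi> by fact
  show ?thesis
  proof
    fix x y
    assume x: "x \<in> ?C" and y: "y \<in> ?C"
    have "a \<otimes>\<^bsub>Q\<^esub> \<pi> (x \<otimes> y) = \<pi> (x \<otimes> y) \<otimes>\<^bsub>Q\<^esub> a" if a: "a \<in> A" for a
    proof -
      have xy: "x \<in> carrier G" "y \<in> carrier G" "a \<in> carrier Q" using x y a assms(2) by auto
      have "a \<otimes>\<^bsub>Q\<^esub> \<pi> (x \<otimes> y) = (a \<otimes>\<^bsub>Q\<^esub> \<pi> x) \<otimes>\<^bsub>Q\<^esub> \<pi> y"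
        using xy by (simp add: \<pi>.H.m_assoc)
      also have "\<dots> = \<pi> x \<otimes>\<^bsub>Q\<^esub> (a \<otimes>\<^bsub>Q\<^esub> \<pi> y)"
        using xy x a by (simp add: \<pi>.H.m_assoc)
      also have "\<dots> = \<pi> (x \<otimes> y) \<otimes>\<^bsub>Q\<^esub> a"
        using xy y a by (simp add: \<pi>.H.m_assoc)
      finally show ?thesis .
    qed
    then show "x \<otimes> y \<in> ?C" using x y by simp
  next
    fix x
    assume x: "x \<in> ?C"
    have "a \<otimes>\<^bsub>Q\<^esub> \<pi> (inv x) = \<pi> (inv x) \<otimes>\<^bsub>Q\<^esub> a" if a: "a \<in> A" for a
    proof -
      have "a \<in> carrier Q" "\<pi> x \<in> carrier Q" "a \<otimes>\<^bsub>Q\<^esub> \<pi> x = \<pi> x \<otimes>\<^bsub>Q\<^esub> a"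
        using x a assms(2) by auto
      moreover have "\<pi> (inv x) = inv\<^bsub>Q\<^esub> \<pi> x"
        using x by simp
      ultimately show ?thesis
        by (metis \<pi>.H.inv_closed \<pi>.H.inv_solve_left \<pi>.H.inv_solve_right \<pi>.H.m_assoc \<pi>.H.m_closed)
    qed
    then show "inv x \<in> ?C" using x by simp
  qed (use assms(2) in auto)
qed

text \<open>An elementwise form of the three subgroups lemma. With e = g b^-1 g^-1 one has
  \<open>comm b g\<close> = b e; conjugation by \<open>a\<close> maps b to c b and e to e c^-1 for
  the central c = \<open>comm a b\<close>, hence fixes b e.\<close>

lemma three_commutators:
  assumes car: "a \<in> carrier G" "b \<in> carrier G" "g \<in> carrier G"
    and c: "\<And>x. x \<in> carrier G \<Longrightarrow> comm a b \<otimes> x = x \<otimes> comm a b"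
    and d: "comm a g \<otimes> b = b \<otimes> comm a g"
      "comm a g \<otimes> (g \<otimes> inv b \<otimes> inv g) = (g \<otimes> inv b \<otimes> inv g) \<otimes> comm a g"
  shows "a \<otimes> comm b g = comm b g \<otimes> a"
proof -
  define c d e where "c = comm a b" and "d = comm a g" and "e = g \<otimes> inv b \<otimes> inv g"
  have [simp]: "c \<in> carrier G" "d \<in> carrier G" "e \<in> carrier G"
    using car by (auto simp: c_def d_def e_def)
  have be: "comm b g = b \<otimes> e"
    using car by (simp add: e_def m_assoc)
  have ab: "a \<otimes> b \<otimes> inv a = c \<otimes> b" and ag: "a \<otimes> g \<otimes> inv a = d \<otimes> g"
    using car by (simp_all add: c_def d_def m_assoc)
  have "a \<otimes> e \<otimes> inv a = (a \<otimes> g \<otimes> inv a) \<otimes> inv (a \<otimes> b \<otimes> inv a) \<otimes> inv (a \<otimes> g \<otimes> inv a)"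
    using car by (simp add: e_def m_assoc inv_mult_group inv_cancel)
  also have "\<dots> = d \<otimes> g \<otimes> (inv b \<otimes> inv c) \<otimes> (inv g \<otimes> inv d)"
    unfolding ab ag using car by (simp add: inv_mult_group)
  also have "\<dots> = d \<otimes> g \<otimes> inv b \<otimes> (inv c \<otimes> (inv g \<otimes> inv d))"
    using car by (simp add: m_assoc)
  also have "inv c \<otimes> (inv g \<otimes> inv d) = inv (c \<otimes> (d \<otimes> g))"
  proof -
    have "c \<otimes> (d \<otimes> g) = d \<otimes> g \<otimes> c"
      using c[of "d \<otimes> g"] car by (simp add: c_def)
    then show ?thesis using car by (simp add: inv_mult_group)
  qed
  also have "inv (c \<otimes> (d \<otimes> g)) = inv g \<otimes> inv d \<otimes> inv c"
    using car by (simp add: inv_mult_group)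
  also have "d \<otimes> g \<otimes> inv b \<otimes> (inv g \<otimes> inv d \<otimes> inv c) = (d \<otimes> e) \<otimes> (inv d \<otimes> inv c)"
    using car by (simp add: e_def m_assoc)
  also have "d \<otimes> e = e \<otimes> d"
    using d(2) by (simp add: d_def e_def)
  finally have e: "a \<otimes> e \<otimes> inv a = e \<otimes> inv c"
    by (simp add: m_assoc inv_cancel)
  have "a \<otimes> (b \<otimes> e) \<otimes> inv a = (a \<otimes> b \<otimes> inv a) \<otimes> (a \<otimes> e \<otimes> inv a)"
    using car by (simp add: m_assoc inv_cancel)
  also have "\<dots> = c \<otimes> (b \<otimes> e) \<otimes> inv c"
    unfolding ab e using car by (simp add: m_assoc)
  also have "c \<otimes> (b \<otimes> e) = b \<otimes> e \<otimes> c"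
    using c[of "b \<otimes> e"] car by (simp only: c_def) simp
  also have "b \<otimes> e \<otimes> c \<otimes> inv c = b \<otimes> e"
    using car by (simp add: m_assoc)
  finally show ?thesis
    using car unfolding be by (metis \<open>e \<in> carrier G\<close> inv_closed inv_solve_right' m_closed)
qed

text \<open>Modulo the target term \<open>?S\<close>, the elements commuting with all of
  \<open>?A\<close> form a subgroup \<open>C\<close>. By \<open>three_commutators\<close> it
  contains the generators \<open>comm b g\<close> of the next finite term.\<close>

lemma lower_central_comm:
  assumes "Ord i j c \<noteq> Ord 0 0 0"
    and "a \<in> lower_central G (Ord i j c)" "z \<in> lower_central G (Ord 0 0 (Suc n))"
  shows "comm a z \<in> lower_central G (Ord i j (c + Suc n))"
  using assms
proof (induction n arbitrary: a z c)
  case 0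
  then have "comm a z \<in> commutator_subgroup G (lower_central G (Ord i j c)) (carrier G)"
    using lower_central_closed by (intro comm_in_commutator_subgroup)
  then show ?case
    using lower_central_Suc[OF 0(1), of G] by simp
next
  case (Suc n)
  let ?S = "lower_central G (Ord i j (c + Suc (Suc n)))"
  let ?A = "lower_central G (Ord i j c)" and ?Z = "lower_central G (Ord 0 0 (Suc n))"
  obtain Q :: "'a set monoid" and \<pi> where \<pi>: "group_hom G Q \<pi>" "\<pi> ` carrier G = carrier Q"
    "\<And>a. a \<in> carrier G \<Longrightarrow> \<pi> a = \<one>\<^bsub>Q\<^esub> \<longleftrightarrow> a \<in> ?S"
    using quotient_hom[OF lower_central_normal] by blast
  interpret \<pi>: group_hom G Q \<pi> by fact
  interpret Z: normal ?Z G
    by (rule lower_central_normal)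
  note ker = hom_commute_iff[OF \<pi>(1,3)]
  define C where "C = {z \<in> carrier G. \<forall>a\<in>\<pi> ` ?A. a \<otimes>\<^bsub>Q\<^esub> \<pi> z = \<pi> z \<otimes>\<^bsub>Q\<^esub> a}"
  have "subgroup C G"
    unfolding C_def using lower_central_closed by (intro subgroup_commuting_image \<pi>) auto
  moreover have "comm b g \<in> C" if b: "b \<in> ?Z" and g: "g \<in> carrier G" for b g
  proof -
    have bc: "b \<in> carrier G" using b by simp
    have "\<pi> a \<otimes>\<^bsub>Q\<^esub> \<pi>.H.comm (\<pi> b) (\<pi> g) = \<pi>.H.comm (\<pi> b) (\<pi> g) \<otimes>\<^bsub>Q\<^esub> \<pi> a" if a: "a \<in> ?A" for a
    proof (rule \<pi>.H.three_commutators)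
      note ac = lower_central_closed[OF a]
      show "\<pi> a \<in> carrier Q" "\<pi> b \<in> carrier Q" "\<pi> g \<in> carrier Q"
        using ac bc g by auto
      have ab: "comm a b \<in> lower_central G (Ord i j (c + Suc n))"
        using Suc.IH[OF Suc.prems(1) a b] .
      have "comm (comm a b) x \<in> ?S" if "x \<in> carrier G" for x
        using that ab lower_central_Suc[of i j "c + Suc n" G]
        by (simp add: comm_in_commutator_subgroup)
      then have "\<pi> (comm a b) \<otimes>\<^bsub>Q\<^esub> \<pi> x = \<pi> x \<otimes>\<^bsub>Q\<^esub> \<pi> (comm a b)" if "x \<in> carrier G" for x
        using that lower_central_closed[OF ab] by (simp only: ker)
      then show "\<pi>.H.comm (\<pi> a) (\<pi> b) \<otimes>\<^bsub>Q\<^esub> x = x \<otimes>\<^bsub>Q\<^esub> \<pi>.H.comm (\<pi> a) (\<pi> b)" if "x \<in> carrier Q" for x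
        using that ac bc by (auto simp flip: \<pi>(2))
      \<comment> \<open>The unit lost in the second argument is gained in the first: the induction
        hypothesis is applied at \<open>Suc c\<close>.\<close>
      have ag: "comm a g \<in> lower_central G (Ord i j (Suc c))"
        using a g lower_central_Suc[OF Suc.prems(1), of G]
        by (simp add: comm_in_commutator_subgroup)
      have *: "\<pi> (comm a g) \<otimes>\<^bsub>Q\<^esub> \<pi> y = \<pi> y \<otimes>\<^bsub>Q\<^esub> \<pi> (comm a g)" if "y \<in> ?Z" for y
        using Suc.IH[OF _ ag that] lower_central_closed[OF ag] lower_central_closed[OF that]
        by (simp only: ker) simp
      show "\<pi>.H.comm (\<pi> a) (\<pi> g) \<otimes>\<^bsub>Q\<^esub> \<pi> b = \<pi> b \<otimes>\<^bsub>Q\<^esub> \<pi>.H.comm (\<pi> a) (\<pi> g)"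
        using *[OF b] ac g by simp
      have "g \<otimes> inv b \<otimes> inv g \<in> ?Z"
        using b g by (intro Z.inv_op_closed2) auto
      from *[OF this] show "\<pi>.H.comm (\<pi> a) (\<pi> g) \<otimes>\<^bsub>Q\<^esub> (\<pi> g \<otimes>\<^bsub>Q\<^esub> inv\<^bsub>Q\<^esub> \<pi> b \<otimes>\<^bsub>Q\<^esub> inv\<^bsub>Q\<^esub> \<pi> g)
        = (\<pi> g \<otimes>\<^bsub>Q\<^esub> inv\<^bsub>Q\<^esub> \<pi> b \<otimes>\<^bsub>Q\<^esub> inv\<^bsub>Q\<^esub> \<pi> g) \<otimes>\<^bsub>Q\<^esub> \<pi>.H.comm (\<pi> a) (\<pi> g)"
        using ac bc g by simp
    qed
    then show ?thesis using bc g by (simp add: C_def)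
  qed
  ultimately have "commutator_subgroup G ?Z (carrier G) \<subseteq> C"
    by (rule commutator_subgroup_incl)
  then have "z \<in> C"
    using Suc.prems(3) lower_central_Suc[of 0 0 "Suc n" G] by auto
  then show ?case
    using Suc.prems(2) ker[of a z] lower_central_closed[OF Suc.prems(2)] by (simp add: C_def)
qed

end



section \<open>Extensions by an infinite cyclic group\<close>

locale cyclic_extension = group F for F :: "'a monoid" (structure) +
  fixes \<phi> :: "'a \<Rightarrow> 'a"
  assumes auto: "\<phi> \<in> auto F"
begin

abbreviation G :: "(int \<times> 'a) monoid" where
  "G \<equiv> semidirect_int F \<phi>"

definition iter :: "int \<Rightarrow> 'a \<Rightarrow> 'a" where
  "iter n = \<phi> [^]\<^bsub>AutoGroup F\<^esub> n"

text \<open>The part of \<open>H\<close> inside the normal factor F. From \<gamma>_2 on it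
  determines the terms of the series, see \<open>lower_central_eq_fibre\<close>.\<close>

definition fibre :: "(int \<times> 'a) set \<Rightarrow> 'a set" where
  "fibre H = {u \<in> carrier F. (0, u) \<in> H}"

sublocale G: group G
  using auto by (rule group_semidirect_int)

lemma iter_auto: "iter n \<in> auto F"
  using AutoGroup_pow_auto[OF auto] by (simp add: iter_def)

lemma iter_closed [simp]: "u \<in> carrier F \<Longrightarrow> iter n u \<in> carrier F"
  using auto_closed[OF iter_auto] .

lemma iter_mult: "u \<in> carrier F \<Longrightarrow> v \<in> carrier F \<Longrightarrow> iter n (u \<otimes> v) = iter n u \<otimes> iter n v"
  using auto_mult[OF iter_auto] .

lemma iter_inv: "u \<in> carrier F \<Longrightarrow> iter n (inv u) = inv (iter n u)"
  by (rule inv_equality[symmetric]) (auto simp flip: iter_mult simp: auto_one[OF iter_auto])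

lemma iter_0: "u \<in> carrier F \<Longrightarrow> iter 0 u = u"
  by (simp add: AutoGroup_one_apply iter_def)

lemma iter_1: "iter 1 = \<phi>"
  using AutoGroup_pow_1[OF auto] by (simp add: iter_def)

lemma iter_add: "u \<in> carrier F \<Longrightarrow> iter (m + n) u = iter m (iter n u)"
  using AutoGroup_pow_add[OF auto] by (simp add: iter_def)

lemma phi_closed [simp]: "u \<in> carrier F \<Longrightarrow> \<phi> u \<in> carrier F"
  using auto_closed[OF auto] .

lemma phi_hom: "\<phi> \<in> hom F F"
  using auto by (simp add: auto_def)

lemma carrier_G [simp]: "(m, u) \<in> carrier G \<longleftrightarrow> u \<in> carrier F"
  by (simp add: semidirect_int_def)

lemma G_mult [simp]: "(m, u) \<otimes>\<^bsub>G\<^esub> (n, v) = (m + n, iter n u \<otimes> v)"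
  by (simp add: semidirect_int_def iter_def)

lemma G_one: "\<one>\<^bsub>G\<^esub> = (0, \<one>)"
  by (simp add: semidirect_int_def)

lemma G_inv: "u \<in> carrier F \<Longrightarrow> inv\<^bsub>G\<^esub> (m, u) = (- m, iter (- m) (inv u))"
  using iter_add[of "inv u" m "- m"]
  by (intro G.inv_equality) (auto simp: G_one iter_0)

lemma G_comm_fst:
  assumes "a \<in> carrier G" "b \<in> carrier G"
  shows "fst (G.comm a b) = 0"
  using assms by (cases a; cases b) (simp add: G_inv)

lemma G_comm:
  assumes "h \<in> carrier F" "u \<in> carrier F"
  shows "G.comm (0, h) (m, u) = (0, h \<otimes> iter (- m) (u \<otimes> inv h \<otimes> inv u))"
  using assms iter_add[of h "- m" m] by (simp add: G_inv iter_0 iter_mult m_assoc)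

lemma G_comm_F:
  assumes "h \<in> carrier F" "u \<in> carrier F"
  shows "G.comm (0, h) (0, u) = (0, comm h u)"
  using assms by (simp add: G_comm iter_0 m_assoc del: G_mult)

lemma fibre_hom: "group_hom F G (\<lambda>u. (0, u))"
  by unfold_locales (auto simp: hom_def iter_0)

lemma subgroup_zero_times:
  assumes "subgroup T F"
  shows "subgroup ({0} \<times> T) G"
proof -
  interpret i: group_hom F G "\<lambda>u. (0, u)" by (rule fibre_hom)
  have "{0::int} \<times> T = (\<lambda>u. (0, u)) ` T" by auto
  then show ?thesis
    using i.subgroup_img_is_subgroup[OF assms] by (simp only:)
qed

lemma subgroup_fibre:
  assumes "subgroup H G"
  shows "subgroup (fibre H) F"
proof -
  interpret i: group_hom F G "\<lambda>u. (0, u)" by (rule fibre_hom)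
  interpret H: subgroup H G by fact
  show ?thesis
    using i.hom_one i.hom_inv i.hom_mult
    by unfold_locales (auto simp: fibre_def simp del: G_mult)
qed

lemma fibre_carrier: "u \<in> fibre H \<Longrightarrow> u \<in> carrier F"
  by (simp add: fibre_def)

lemma fibre_iter:
  assumes "H \<lhd> G" "u \<in> fibre H"
  shows "iter n u \<in> fibre H"
proof -
  have "inv\<^bsub>G\<^esub> (n, \<one>) \<otimes>\<^bsub>G\<^esub> (0, u) \<otimes>\<^bsub>G\<^esub> (n, \<one>) \<in> H"
    using assms by (intro normal.inv_op_closed1) (auto simp: fibre_def)
  then show ?thesis
    using assms(2) by (simp add: fibre_def G_inv iter_0 auto_one[OF iter_auto] del: G.inv_closed)
qed

lemma fibre_conj:
  assumes "H \<lhd> G" "u \<in> fibre H" "g \<in> carrier F"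
  shows "g \<otimes> u \<otimes> inv g \<in> fibre H"
proof -
  have "(0, g) \<otimes>\<^bsub>G\<^esub> (0, u) \<otimes>\<^bsub>G\<^esub> inv\<^bsub>G\<^esub> (0, g) \<in> H"
    using assms by (intro normal.inv_op_closed2) (auto simp: fibre_def)
  then show ?thesis
    using assms by (simp add: fibre_def G_inv iter_0)
qed

lemma fibre_normal: "H \<lhd> G \<Longrightarrow> fibre H \<lhd> F"
  by (intro normal_invI subgroup_fibre fibre_conj normal_imp_subgroup)

lemma mult_inv_step:
  assumes "a \<in> carrier F" "b \<in> carrier F" "c \<in> carrier F"
  shows "(a \<otimes> inv b) \<otimes> (b \<otimes> inv c) = a \<otimes> inv c"
  using assms by (simp add: m_assoc inv_cancel)

text \<open>Since \<open>t\<^sup>-\<^sup>1 h t = \<phi> h\<close>, the element \<open>\<phi> h \<otimes> inv h\<close> is the commutator of \<open>t\<^sup>-\<^sup>1\<close> and \<open>h\<close>.\<close>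

lemma commutator_subgroup_subset:
  assumes H: "H \<lhd> G" "fst ` H \<subseteq> {0}" and T: "subgroup T F"
    and t: "\<And>h. h \<in> fibre H \<Longrightarrow> \<phi> h \<otimes> inv h \<in> T"
    and F: "\<And>h u. h \<in> fibre H \<Longrightarrow> u \<in> carrier F \<Longrightarrow> comm h u \<in> T"
  shows "commutator_subgroup G H (carrier G) \<subseteq> {0} \<times> T"
proof (rule G.commutator_subgroup_incl)
  interpret T: subgroup T F by fact
  \<comment> \<open>Telescoping: the elements \<open>\<phi> h' \<otimes> inv h'\<close> for h' = h,
    \<phi> h, ... multiply up to every nonnegative power of \<phi>.\<close>
  have pos: "iter (int n) h \<otimes> inv h \<in> T" if h: "h \<in> fibre H" for n h
  proof (induction n)
    case 0
    show ?case using h by (simp add: iter_0 fibre_carrier)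
  next
    case (Suc n)
    have "\<phi> (iter (int n) h) \<otimes> inv (iter (int n) h) \<in> T"
      by (rule t[OF fibre_iter[OF H(1) h]])
    then have "(\<phi> (iter (int n) h) \<otimes> inv (iter (int n) h)) \<otimes> (iter (int n) h \<otimes> inv h) \<in> T"
      using Suc by (rule T.m_closed)
    then show ?case
      using h iter_add[of h 1 "int n"] by (simp add: fibre_carrier mult_inv_step iter_1)
  qed
  have diff: "h \<otimes> inv (iter n h) \<in> T" if h: "h \<in> fibre H" for n h
  proof (cases "n \<ge> 0")
    case True
    then have "inv (iter n h \<otimes> inv h) \<in> T"
      using pos[OF h, of "nat n"] by (intro T.m_inv_closed) simp
    then show ?thesis using h by (simp add: inv_mult_group fibre_carrier)
  next
    \<comment> \<open>For a negative power apply \<open>pos\<close> to \<open>iter n h\<close>,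
      which \<phi> carries back to \<open>h\<close> in \<open>- n\<close> steps.\<close>
    case False
    have "iter (int (nat (- n))) (iter n h) \<otimes> inv (iter n h) \<in> T"
      by (rule pos[OF fibre_iter[OF H(1) h]])
    then show ?thesis
      using False h iter_add[of h "- n" n] by (simp add: fibre_carrier iter_0)
  qed
  fix a g
  assume a: "a \<in> H" and g: "g \<in> carrier G"
  obtain m u where mu: "g = (m, u)" "u \<in> carrier F" using g by (cases g) auto
  have "a \<in> carrier G"
    using a H(1) normal_imp_subgroup subgroup.subset by blast
  then obtain h where h: "a = (0, h)" "h \<in> carrier F" using a H(2) by (cases a) force
  then have hH: "h \<in> fibre H" using a by (simp add: fibre_def)
  have "(h \<otimes> inv (iter (- m) h)) \<otimes> comm (iter (- m) h) (iter (- m) u) \<in> T"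
    using hH H(1) mu(2) by (intro T.m_closed diff F fibre_iter) auto
  also have "(h \<otimes> inv (iter (- m) h)) \<otimes> comm (iter (- m) h) (iter (- m) u)
    = h \<otimes> iter (- m) (u \<otimes> inv h \<otimes> inv u)"
    using h(2) mu(2) by (simp add: iter_mult iter_inv m_assoc inv_cancel)
  finally show "G.comm a g \<in> {0} \<times> T"
    using h mu by (simp add: G_comm del: G_mult)
qed (rule subgroup_zero_times[OF T])

lemma phi_comm_in_commutator:
  assumes "H \<lhd> G" "h \<in> fibre H"
  shows "\<phi> h \<otimes> inv h \<in> fibre (commutator_subgroup G H (carrier G))"
proof -
  have "commutator_subgroup G H (carrier G) \<lhd> G"
    using assms(1) by (rule G.commutator_subgroup_normal)
  then have C: "subgroup (fibre (commutator_subgroup G H (carrier G))) F"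
    by (intro subgroup_fibre normal_imp_subgroup)
  have h: "h \<in> carrier F" "(0, h) \<in> H"
    using assms(2) by (auto simp: fibre_def)
  have "G.comm (0, h) (- 1, \<one>) \<in> commutator_subgroup G H (carrier G)"
    by (rule G.comm_in_commutator_subgroup) (simp_all add: h)
  moreover have "G.comm (0, h) (- 1, \<one>) = (0, h \<otimes> inv (\<phi> h))"
    using G_comm[OF h(1) one_closed, of "- 1"] h(1) iter_inv[of h 1] by (simp add: iter_1 del: G_mult)
  ultimately have "h \<otimes> inv (\<phi> h) \<in> fibre (commutator_subgroup G H (carrier G))"
    using h(1) by (simp add: fibre_def)
  then have "inv (h \<otimes> inv (\<phi> h)) \<in> fibre (commutator_subgroup G H (carrier G))"
    by (rule subgroup.m_inv_closed[OF C])
  then show ?thesis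
    using h(1) by (simp add: inv_mult_group)
qed

lemma comm_in_commutator:
  assumes "h \<in> fibre H" "u \<in> carrier F"
  shows "comm h u \<in> fibre (commutator_subgroup G H (carrier G))"
proof -
  have "G.comm (0, h) (0, u) \<in> commutator_subgroup G H (carrier G)"
    using assms by (intro G.comm_in_commutator_subgroup) (auto simp: fibre_def)
  then show ?thesis
    using assms fibre_carrier[OF assms(1)] by (simp add: G_comm_F fibre_def del: G_mult)
qed

lemma fibre_carrier_G: "fibre (carrier G) = carrier F"
  by (auto simp: fibre_def)

lemma lower_central_1: "lower_central G (Ord 0 0 (Suc 0)) = carrier G"
  using lower_central_ord_succ[of G "Ord 0 0 0"] by simp

lemma lower_central_2:
  "lower_central G (Ord 0 0 (Suc (Suc 0))) = commutator_subgroup G (carrier G) (carrier G)"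
  using lower_central_Suc[of 0 0 "Suc 0" G] by (simp add: lower_central_1)

lemma fst_lower_central:
  assumes "Ord 0 0 (Suc (Suc 0)) \<le> \<alpha>"
  shows "fst ` lower_central G \<alpha> \<subseteq> {0}"
proof -
  have "commutator_subgroup G (carrier G) (carrier G) \<subseteq> {0} \<times> carrier F"
  proof (rule G.commutator_subgroup_incl)
    fix a b
    assume ab: "a \<in> carrier G" "b \<in> carrier G"
    then have "G.comm a b \<in> carrier G" by simp
    then show "G.comm a b \<in> {0} \<times> carrier F"
      using G_comm_fst[OF ab] by (cases "G.comm a b") auto
  qed (rule subgroup_zero_times[OF subgroup_self])
  then show ?thesis
    using G.lower_central_antimono[OF assms] unfolding lower_central_2 by fastforce
qed

lemma lower_central_eq_fibre:
  assumes "Ord 0 0 (Suc (Suc 0)) \<le> \<alpha>"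
  shows "lower_central G \<alpha> = {0} \<times> fibre (lower_central G \<alpha>)"
proof -
  have "x = (0, snd x)" "snd x \<in> carrier F" if "x \<in> lower_central G \<alpha>" for x
    using fst_lower_central[OF assms] G.lower_central_closed[OF that] that by (cases x; force)+
  then show ?thesis by (force simp: fibre_def)
qed

end



section \<open>Leading coefficients along the lower central series\<close>

text \<open>On words of length k this is A - 1, where A is the k-th tensor power of
  \<open>M\<close>. It describes the effect of h |-> \<open>\<phi> h \<otimes> inv h\<close> on
  leading forms.\<close>

definition psi :: "('a::finite \<Rightarrow> 'a \<Rightarrow> int) \<Rightarrow> ('a list \<Rightarrow> int) \<Rightarrow> 'a list \<Rightarrow> int" where
  "psi M f w = act M f w - f w"

lemma psi_pow_add: "(psi M ^^ n) (\<lambda>u. f u + g u) = (\<lambda>w. (psi M ^^ n) f w + (psi M ^^ n) g w)"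
  by (induction n) (auto simp: psi_def act_add)

lemma psi_pow_scale: "(psi M ^^ n) (\<lambda>u. c * f u) = (\<lambda>w. c * (psi M ^^ n) f w)"
  by (induction n) (auto simp: psi_def act_scale algebra_simps)

lemma psi_pow_diff: "(psi M ^^ n) (\<lambda>u. f u - g u) = (\<lambda>w. (psi M ^^ n) f w - (psi M ^^ n) g w)"
  using psi_pow_add[of n M f "\<lambda>u. (-1) * g u"] unfolding psi_pow_scale by simp

lemma psi_pow_dvd:
  "(\<And>u. length u = length w \<Longrightarrow> d dvd f u) \<Longrightarrow> d dvd (psi M ^^ n) f w"
proof (induction n arbitrary: w)
  case (Suc n)
  then have "d dvd (psi M ^^ n) f u" if "length u = length w" for u
    using that by auto
  then show ?case
    by (auto simp: psi_def[of M "(psi M ^^ n) f"] intro!: dvd_diff act_dvd)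
qed auto

text \<open>The result of \<open>J * e\<close> steps is \<open>p ^ e\<close> times an integral
  function on words of length \<open>k\<close>, and \<open>J\<close> more steps applied to that
  function give one more factor \<open>p\<close>.\<close>

lemma psi_pow_nilpotent_power:
  assumes "\<And>f w. length w = k \<Longrightarrow> p dvd (psi M ^^ J) f w" and "length w = k"
  shows "p ^ e dvd (psi M ^^ (J * e)) f w"
  using assms(2)
proof (induction e arbitrary: w)
  case (Suc e)
  define g where "g = (psi M ^^ (J * e)) f"
  define h where "h u = g u div p ^ e" for u
  have g: "g u = p ^ e * h u" if "length u = k" for u
    using Suc.IH[OF that] by (simp add: g_def h_def)
  \<comment> \<open>Divisibility by 0 is equality; \<open>h\<close> reproduces \<open>g\<close> only
    on words of length \<open>k\<close>, the only ones that matter at \<open>w\<close>.\<close>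
  have "0 dvd (psi M ^^ J) (\<lambda>u. g u - p ^ e * h u) w"
    using g Suc.prems by (intro psi_pow_dvd) simp
  then have "(psi M ^^ J) g w = p ^ e * (psi M ^^ J) h w"
    by (simp add: psi_pow_diff psi_pow_scale)
  moreover have "(psi M ^^ (J * Suc e)) f w = (psi M ^^ J) g w"
    by (simp add: g_def funpow_add)
  ultimately show ?case
    using assms(1)[OF Suc.prems, of h] by (simp add: mult.commute mult_dvd_mono)
qed simp

lemma eq_0_if_all_powers_dvd:
  fixes p m :: int
  assumes "\<bar>p\<bar> > 1" "\<And>e. p ^ e dvd m"
  shows "m = 0"
proof (rule ccontr)
  assume "m \<noteq> 0"
  let ?e = "nat \<bar>m\<bar>"
  have "\<bar>m\<bar> < 2 ^ ?e"
    using of_nat_less_two_power[of ?e, where 'a = int] by simp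
  also have "\<dots> \<le> \<bar>p\<bar> ^ ?e"
    using assms(1) by (intro power_mono) auto
  also have "\<dots> \<le> \<bar>m\<bar>"
    using dvd_imp_le_int[OF \<open>m \<noteq> 0\<close> assms(2)[of ?e]] by (simp add: power_abs)
  finally show False by simp
qed

lemma act_sum: "act M (\<lambda>u. \<Sum>a\<in>A. c a * f a u) w = (\<Sum>a\<in>A. c a * act M (f a) w)"
proof (induction A rule: infinite_finite_induct)
  case empty
  show ?case using act_scale[of M 0 "\<lambda>u. 0" w] by simp
next
  case (infinite A)
  then show ?case using act_scale[of M 0 "\<lambda>u. 0" w] by simp
qed (simp add: act_add act_scale)

lemma psi_Cons:
  "psi M f (b # w) = psi M (\<lambda>u. f (b # u)) w
    + (\<Sum>a\<in>UNIV. (M b a - (if a = b then 1 else 0)) * act M (\<lambda>u. f (a # u)) w)"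
proof -
  have "(\<Sum>a\<in>UNIV. (if a = b then 1 else 0) * act M (\<lambda>u. f (a # u)) w) = act M (\<lambda>u. f (b # u)) w"
    by (subst sum.remove[of _ b]) auto
  then show ?thesis
    by (simp add: psi_def left_diff_distrib sum_subtractf)
qed

lemma psi_sum_dvd:
  assumes "\<And>v. length v = length w \<Longrightarrow> d dvd f v - g v - (\<Sum>a\<in>A. c a * h a v)"
  shows "d dvd psi M f w - psi M g w - (\<Sum>a\<in>A. c a * psi M (h a) w)"
proof -
  have "d dvd psi M (\<lambda>v. f v - g v - (\<Sum>a\<in>A. c a * h a v)) w"
    using psi_pow_dvd[of w d _ 1 M] assms by simp
  then show ?thesis
    by (simp only: psi_def act_diff act_sum right_diff_distrib sum_subtractf) (simp add: algebra_simps)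
qed

text \<open>If \<open>M - 1\<close> squares to zero modulo \<open>p\<close>, then every tensor power of \<open>M\<close> is unipotent
  modulo \<open>p\<close>: on \<open>V \<otimes> W\<close> the operator \<open>psi\<close> is \<open>1 \<otimes> psi + (M - 1) \<otimes> act M\<close>, and once the powers
  of \<open>psi\<close> vanish on \<open>W\<close>, an even higher power has its image in \<open>(M - 1) V \<otimes> W\<close> and the next one
  vanishes.\<close>

lemma psi_nilpotent:
  fixes M :: "'a::finite \<Rightarrow> 'a \<Rightarrow> int"
  defines "B \<equiv> \<lambda>b a. M b a - (if a = b then 1 else 0)"
  assumes B: "\<And>b c. p dvd (\<Sum>a\<in>UNIV. B b a * B a c)"
  shows "\<exists>J. \<forall>f w. length w = k \<longrightarrow> p dvd (psi M ^^ J) f w"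
proof (induction k)
  case 0
  show ?case
    by (intro exI[of _ 1]) (simp add: psi_def)
next
  case (Suc k)
  then obtain J where J: "\<And>f w. length w = k \<Longrightarrow> p dvd (psi M ^^ J) f w" by blast
  have Cons: "psi M f (b # v) = psi M (\<lambda>u. f (b # u)) v + (\<Sum>a\<in>UNIV. B b a * act M (\<lambda>u. f (a # u)) v)" for f b v
    by (simp add: psi_Cons B_def)
  \<comment> \<open>Modulo \<open>p\<close> the power \<open>psi M ^^ n\<close> acts on the tail
    alone, up to an error in the image of M - 1 in the first tensor factor; \<open>h\<close> holds
    the tails of this error.\<close>
  have first: "\<exists>h. \<forall>b v. length v = k \<longrightarrow>
      p dvd (psi M ^^ n) f (b # v) - (psi M ^^ n) (\<lambda>u. f (b # u)) v - (\<Sum>a\<in>UNIV. B b a * h a v)" for n f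
  proof (induction n)
    case 0
    show ?case by (intro exI[of _ "\<lambda>a v. 0"]) simp
  next
    case (Suc n)
    let ?g = "(psi M ^^ n) f"
    obtain h where h: "\<And>b v. length v = k \<Longrightarrow>
      p dvd ?g (b # v) - (psi M ^^ n) (\<lambda>u. f (b # u)) v - (\<Sum>a\<in>UNIV. B b a * h a v)"
      using Suc by blast
    have "p dvd psi M ?g (b # v) - psi M ((psi M ^^ n) (\<lambda>u. f (b # u))) v
      - (\<Sum>a\<in>UNIV. B b a * (psi M (h a) v + act M (\<lambda>u. ?g (a # u)) v))" if "length v = k" for b v
    proof -
      have "psi M ?g (b # v) - psi M ((psi M ^^ n) (\<lambda>u. f (b # u))) v
        - (\<Sum>a\<in>UNIV. B b a * (psi M (h a) v + act M (\<lambda>u. ?g (a # u)) v))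
        = psi M (\<lambda>u. ?g (b # u)) v - psi M ((psi M ^^ n) (\<lambda>u. f (b # u))) v - (\<Sum>a\<in>UNIV. B b a * psi M (h a) v)"
        by (simp add: Cons distrib_left sum.distrib)
      moreover have "p dvd psi M (\<lambda>u. ?g (b # u)) v - psi M ((psi M ^^ n) (\<lambda>u. f (b # u))) v - (\<Sum>a\<in>UNIV. B b a * psi M (h a) v)"
        using psi_sum_dvd[of v p "\<lambda>v. ?g (b # v)" "(psi M ^^ n) (\<lambda>u. f (b # u))" "B b" h UNIV M] h that
        by simp
      ultimately show ?thesis by (simp only:)
    qed
    then show ?case
      by (intro exI[of _ "\<lambda>a v. psi M (h a) v + act M (\<lambda>u. ?g (a # u)) v"]) simp
  qed
  \<comment> \<open>On that image \<open>psi M\<close> acts modulo \<open>p\<close> on the tail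
    alone, since another factor M - 1 produces the square of \<open>B\<close>.\<close>
  have second: "p dvd (psi M ^^ n) g (b # v) - (\<Sum>a\<in>UNIV. B b a * (psi M ^^ n) (h a) v)"
    if g: "\<And>b v. length v = k \<Longrightarrow> p dvd g (b # v) - (\<Sum>a\<in>UNIV. B b a * h a v)" and "length v = k"
    for n g h b v
    using that(2)
  proof (induction n arbitrary: b v)
    case 0
    then show ?case using g by simp
  next
    case (Suc n)
    let ?g = "(psi M ^^ n) g" and ?h = "\<lambda>a. (psi M ^^ n) (h a)"
    have 1: "p dvd psi M (\<lambda>u. ?g (b # u)) v - (\<Sum>a\<in>UNIV. B b a * psi M (?h a) v)"
      using psi_sum_dvd[of v p "\<lambda>v. ?g (b # v)" "\<lambda>v. 0" "B b" ?h UNIV M] Suc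
        act_scale[of M 0 "\<lambda>u. 0" v] by (simp add: psi_def[of M "\<lambda>v. 0"])
    have 2: "p dvd (\<Sum>a\<in>UNIV. B b a * act M (\<lambda>u. ?g (a # u)) v)"
    proof -
      have "p dvd act M (\<lambda>u. ?g (a # u) - (\<Sum>c\<in>UNIV. B a c * ?h c u)) v" for a
        using Suc by (intro act_dvd) auto
      then have "p dvd (\<Sum>a\<in>UNIV. B b a * (act M (\<lambda>u. ?g (a # u)) v - (\<Sum>c\<in>UNIV. B a c * act M (?h c) v)))"
        by (intro dvd_sum dvd_mult) (simp add: act_diff act_sum)
      moreover have "(\<Sum>a\<in>UNIV. B b a * (\<Sum>c\<in>UNIV. B a c * act M (?h c) v))
        = (\<Sum>c\<in>UNIV. (\<Sum>a\<in>UNIV. B b a * B a c) * act M (?h c) v)"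
        by (simp add: sum_distrib_left sum_distrib_right mult.assoc) (rule sum.swap)
      moreover have "p dvd \<dots>"
        by (intro dvd_sum dvd_mult2 B)
      ultimately show ?thesis
        by (simp only: right_diff_distrib sum_subtractf) (rule zdvd_zdiffD)
    qed
    show ?case
      using dvd_add[OF 1 2] by (simp add: Cons[of ?g b v] algebra_simps)
  qed
  \<comment> \<open>After the first \<open>J\<close> steps only the error term is left, and the next
    \<open>J\<close> steps kill it.\<close>
  have "p dvd (psi M ^^ (J + J)) f w" if len: "length w = Suc k" for f w
  proof -
    obtain b v where w: "w = b # v" "length v = k"
      using len by (cases w) auto
    let ?g = "(psi M ^^ J) f"
    obtain h where h: "\<And>b v. length v = k \<Longrightarrow>
      p dvd ?g (b # v) - (psi M ^^ J) (\<lambda>u. f (b # u)) v - (\<Sum>a\<in>UNIV. B b a * h a v)"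
      using first by blast
    then have "p dvd ?g (b # v) - (\<Sum>a\<in>UNIV. B b a * h a v)" if "length v = k" for b v
    proof -
      have "?g (b # v) - (\<Sum>a\<in>UNIV. B b a * h a v)
        = (?g (b # v) - (psi M ^^ J) (\<lambda>u. f (b # u)) v - (\<Sum>a\<in>UNIV. B b a * h a v))
          + (psi M ^^ J) (\<lambda>u. f (b # u)) v"
        by simp
      then show ?thesis
        using dvd_add[OF h[OF that] J[OF that]] by (simp only:)
    qed
    then have "p dvd (psi M ^^ J) ?g (b # v) - (\<Sum>a\<in>UNIV. B b a * (psi M ^^ J) (h a) v)"
      using second w(2) by blast
    moreover have "p dvd (\<Sum>a\<in>UNIV. B b a * (psi M ^^ J) (h a) v)"
      using J w(2) by (intro dvd_sum dvd_mult) auto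
    ultimately show ?thesis
      unfolding w(1) funpow_add comp_def by (rule zdvd_zdiffD)
  qed
  then show ?case by blast
qed

section \<open>Leading forms in rank two\<close>

instance gen :: finite
  by standard (metis (full_types) finite.simps gen.exhaust subset_UNIV finite_subset insert_iff subsetI)

lemma UNIV_gen: "UNIV = {gen.X, Y}"
  using gen.exhaust by auto

locale free_by_cyclic =
  fixes \<phi> :: "gen word \<Rightarrow> gen word"
  assumes phi_auto: "\<phi> \<in> auto free_group"

sublocale free_by_cyclic \<subseteq> cyclic_extension free_group \<phi>
  by unfold_locales (rule phi_auto)

context free_by_cyclic
begin

text \<open>The matrix of \<phi> on the abelianization, the image of generator \<open>a\<close>
  being column \<open>a\<close>: coefficients of degree one are exponent sums.\<close>

definition M :: "gen \<Rightarrow> gen \<Rightarrow> int" where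
  "M b a = magnus (\<phi> [(a, True)]) [b]"

text \<open>\<open>n\<close> counts the steps of the lower central series taken in degree
  \<open>k\<close>: each of them contributes one factor \<open>psi M\<close> to the leading
  form.\<close>

definition lead :: "int \<Rightarrow> nat \<Rightarrow> nat \<Rightarrow> gen word set" where
  "lead d k n = {h \<in> mfilt d k. \<exists>\<tau>. \<forall>w. length w = k \<longrightarrow> d dvd magnus h w - (psi M ^^ n) \<tau> w}"

lemma lead_0: "lead d k 0 = mfilt d k"
proof -
  have "\<exists>\<tau>. \<forall>w. length w = k \<longrightarrow> d dvd magnus h w - \<tau> w" for h :: "gen word"
    by (rule exI[of _ "magnus h"]) simp
  then show ?thesis by (auto simp: lead_def)
qed

lemma mfilt_Suc_subset_lead:
  assumes "k > 0"
  shows "mfilt d (Suc k) \<subseteq> lead d k n"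
proof
  fix g :: "gen word"
  assume g: "g \<in> mfilt d (Suc k)"
  have "d dvd magnus g w - (psi M ^^ n) (\<lambda>u. 0) w" if "length w = k" for w
  proof -
    have "(psi M ^^ n) (\<lambda>u. 0) w = 0"
      using psi_pow_scale[of n M 0 "\<lambda>u. 0"] by simp
    moreover have "w \<noteq> []" using that assms by auto
    ultimately show ?thesis using g that by (simp add: mfilt_Suc)
  qed
  then show "g \<in> lead d k n"
    using g by (auto simp: lead_def mfilt_Suc)
qed

lemma subgroup_lead:
  assumes "k > 0"
  shows "subgroup (lead d k n) free_group"
proof
  show "lead d k n \<subseteq> carrier free_group"
    by (auto simp: lead_def mfilt_carrier)
  show "\<one>\<^bsub>free_group\<^esub> \<in> lead d k n"
    using mfilt_Suc_subset_lead[OF assms] subgroup.one_closed[OF subgroup_mfilt] by blast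
next
  fix g h
  assume "g \<in> lead d k n" "h \<in> lead d k n"
  then obtain \<sigma> \<tau> where g: "g \<in> mfilt d k" "\<And>w. length w = k \<Longrightarrow> d dvd magnus g w - (psi M ^^ n) \<sigma> w"
    and h: "h \<in> mfilt d k" "\<And>w. length w = k \<Longrightarrow> d dvd magnus h w - (psi M ^^ n) \<tau> w"
    by (auto simp: lead_def)
  have "d dvd magnus (g \<otimes>\<^bsub>free_group\<^esub> h) w - (psi M ^^ n) (\<lambda>u. \<sigma> u + \<tau> u) w" if w: "length w = k" for w
  proof -
    have "d dvd magnus (g \<otimes>\<^bsub>free_group\<^esub> h) w - magnus g w - magnus h w"
      using assms w g mfilt_carrier[OF h(1)] by (intro magnus_mult_mfilt[where k = k]) auto
    from dvd_add[OF this dvd_add[OF g(2)[OF w] h(2)[OF w]]] show ?thesis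
      by (simp add: psi_pow_add algebra_simps)
  qed
  then show "g \<otimes>\<^bsub>free_group\<^esub> h \<in> lead d k n"
    using g h subgroup.m_closed[OF subgroup_mfilt] by (auto simp: lead_def)
next
  fix g
  assume "g \<in> lead d k n"
  then obtain \<sigma> where g: "g \<in> mfilt d k" "\<And>w. length w = k \<Longrightarrow> d dvd magnus g w - (psi M ^^ n) \<sigma> w"
    by (auto simp: lead_def)
  have "d dvd magnus (inv\<^bsub>free_group\<^esub> g) w - (psi M ^^ n) (\<lambda>u. (-1) * \<sigma> u) w" if w: "length w = k" for w
  proof -
    have "d dvd magnus g w + magnus (inv\<^bsub>free_group\<^esub> g) w"
      using assms w g by (intro magnus_inv_mfilt[where k = k]) auto
    from dvd_diff[OF this g(2)[OF w]] show ?thesis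
      unfolding psi_pow_scale by (simp add: algebra_simps)
  qed
  then show "inv\<^bsub>free_group\<^esub> g \<in> lead d k n"
    using g subgroup.m_inv_closed[OF subgroup_mfilt] by (auto simp: lead_def)
qed

lemma phi_mfilt:
  assumes "h \<in> mfilt d k"
  shows "\<phi> h \<in> mfilt d k"
proof -
  have "d dvd magnus (\<phi> h) w" if "w \<noteq> []" "length w < k" for w
  proof -
    have "d dvd magnus (\<phi> h) w - act (\<lambda>b a. magnus (\<phi> [(a, True)]) [b]) (magnus h) w"
      using phi_hom assms that by (intro magnus_hom_lead) auto
    moreover have "d dvd act (\<lambda>b a. magnus (\<phi> [(a, True)]) [b]) (magnus h) w"
    proof (rule act_dvd)
      fix u :: "gen list"
      assume "length u = length w"
      moreover from this have "u \<noteq> []" using that(1) by auto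
      ultimately show "d dvd magnus h u" using assms that(2) by (auto simp: mfilt_def)
    qed
    ultimately show ?thesis by (rule zdvd_zdiffD)
  qed
  moreover have "\<phi> h \<in> carrier free_group"
    using mfilt_carrier[OF assms] by simp
  ultimately show ?thesis by (auto simp: mfilt_def carrier_free_group)
qed

text \<open>Leading forms add up in products, and that of \<open>\<phi> h\<close> is the image of
  that of \<open>h\<close> under \<open>act M\<close>; the difference is \<open>psi M\<close> of the
  old form.\<close>

lemma phi_lead:
  assumes "k > 0" "h \<in> lead d k n"
  shows "\<phi> h \<otimes>\<^bsub>free_group\<^esub> inv\<^bsub>free_group\<^esub> h \<in> lead d k (Suc n)"
proof -
  obtain \<tau> where h: "h \<in> mfilt d k" "\<And>w. length w = k \<Longrightarrow> d dvd magnus h w - (psi M ^^ n) \<tau> w"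
    using assms(2) by (auto simp: lead_def)
  have "d dvd magnus (\<phi> h \<otimes>\<^bsub>free_group\<^esub> inv\<^bsub>free_group\<^esub> h) w - (psi M ^^ Suc n) \<tau> w" if w: "length w = k" for w
  proof -
    have "w \<noteq> []" using w assms(1) by auto
    then have 1: "d dvd magnus (\<phi> h \<otimes>\<^bsub>free_group\<^esub> inv\<^bsub>free_group\<^esub> h) w - magnus (\<phi> h) w - magnus (inv\<^bsub>free_group\<^esub> h) w"
      and 2: "d dvd magnus h w + magnus (inv\<^bsub>free_group\<^esub> h) w"
      and 3: "d dvd magnus (\<phi> h) w - act M (magnus h) w"
      using w h(1) mfilt_carrier[OF h(1)] phi_mfilt[OF h(1)] magnus_hom_lead[OF phi_hom h(1), of w]
      by (auto intro!: magnus_mult_mfilt[where k = k] magnus_inv_mfilt[where k = k] simp: M_def[abs_def])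
    have 4: "d dvd psi M (\<lambda>u. magnus h u - (psi M ^^ n) \<tau> u) w"
      using psi_pow_dvd[of w d _ 1 M] h(2) w by simp
    show ?thesis
      using dvd_add[OF dvd_add[OF dvd_add[OF 1 2] 3] 4]
      by (simp add: psi_def[of M "\<lambda>u. magnus h u - (psi M ^^ n) \<tau> u"] psi_def[of M "(psi M ^^ n) \<tau>"]
        act_diff algebra_simps)
  qed
  then show ?thesis
    using subgroup.m_closed[OF subgroup_mfilt phi_mfilt[OF h(1)] subgroup.m_inv_closed[OF subgroup_mfilt h(1)]]
    by (auto simp: lead_def simp del: funpow.simps)
qed

text \<open>A commutator with t applies \<open>psi M\<close> to the leading form, while a commutator
  with an element of F raises the order and so contributes 0 in degree \<open>k\<close>. Starting at
  index 2 or later keeps all terms inside F.\<close>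

lemma fibre_lower_central_lead:
  assumes "k > 0" "Ord 0 0 (Suc (Suc 0)) \<le> Ord i j c" "fibre (lower_central G (Ord i j c)) \<subseteq> mfilt d k"
  shows "fibre (lower_central G (Ord i j (c + n))) \<subseteq> lead d k n"
proof (induction n)
  case 0
  show ?case using assms(3) by (simp add: lead_0)
next
  case (Suc n)
  let ?\<alpha> = "Ord i j (c + n)"
  have ge: "Ord 0 0 (Suc (Suc 0)) \<le> ?\<alpha>"
    using assms(2) by (auto simp: less_eq_ord_def)
  then have "?\<alpha> \<noteq> Ord 0 0 0" by (auto simp: less_eq_ord_def)
  then have "lower_central G (Ord i j (c + Suc n)) = commutator_subgroup G (lower_central G ?\<alpha>) (carrier G)"
    using lower_central_Suc[of i j "c + n" G] by simp
  also have "\<dots> \<subseteq> {0} \<times> lead d k (Suc n)"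
  proof (rule commutator_subgroup_subset[OF G.lower_central_normal fst_lower_central[OF ge] subgroup_lead[OF assms(1)]])
    fix h u :: "gen word"
    assume h: "h \<in> fibre (lower_central G ?\<alpha>)" and u: "u \<in> carrier free_group"
    have "h \<in> lead d k n" using Suc h by auto
    then have "h \<in> mfilt d k" by (simp add: lead_def)
    then show "F.comm h u \<in> lead d k (Suc n)"
      using magnus_comm(1)[of h d k u 1] u mfilt_Suc_subset_lead[OF assms(1)] assms(1) by (auto simp: mfilt_1)
  qed (use Suc assms(1) in \<open>auto intro: phi_lead\<close>)
  finally show ?case by (auto simp: fibre_def)
qed

lemma fibre_antimono: "\<alpha> \<le> \<beta> \<Longrightarrow> fibre (lower_central G \<beta>) \<subseteq> fibre (lower_central G \<alpha>)"
  using G.lower_central_antimono by (auto simp: fibre_def)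

lemma lower_central_trivial:
  assumes "Ord 0 0 (Suc (Suc 0)) \<le> \<alpha>"
    and "\<And>u w. u \<in> fibre (lower_central G \<alpha>) \<Longrightarrow> w \<noteq> [] \<Longrightarrow> magnus u w = 0"
  shows "lower_central G \<alpha> = {\<one>\<^bsub>G\<^esub>}"
proof -
  have "fibre (lower_central G \<alpha>) \<subseteq> {[]}"
    using assms(2) magnus_faithful[where 'a = gen] fibre_carrier by (fastforce simp: carrier_free_group)
  moreover have "\<one>\<^bsub>free_group\<^esub> \<in> fibre (lower_central G \<alpha>)"
    using subgroup.one_closed[OF subgroup_fibre[OF G.lower_central_subgroup]] .
  moreover have "\<one>\<^bsub>free_group :: gen word monoid\<^esub> = []" by (simp add: free_group_def)
  ultimately have "fibre (lower_central G \<alpha>) = {\<one>\<^bsub>free_group\<^esub>}" by auto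
  then show ?thesis
    using lower_central_eq_fibre[OF assms(1)] by (simp add: G_one)
qed

text \<open>Hypothesis \<open>B\<close> says that (M - 1)^2 vanishes modulo \<open>p\<close>. For
  each \<open>e\<close>, finitely many steps make all coefficients up to a given degree divisible by
  \<open>p ^ e\<close>, so on the intersection they are divisible by every power of
  \<open>p\<close>.\<close>

lemma residually_nilpotent:
  fixes p :: int
  assumes p: "\<bar>p\<bar> > 1"
    and B: "\<And>b c. p dvd (\<Sum>a\<in>UNIV. (M b a - (if a = b then 1 else 0)) * (M a c - (if c = a then 1 else 0)))"
  shows "lower_central G ord_omega = {\<one>\<^bsub>G\<^esub>}"
proof (rule lower_central_trivial)
  have filt: "\<exists>n. fibre (lower_central G (Ord 0 0 (Suc (Suc n)))) \<subseteq> mfilt (p ^ e) (Suc k)" for e k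
  proof (induction k)
    case 0
    show ?case by (metis One_nat_def fibre_carrier mfilt_1 subsetI)
  next
    case (Suc k)
    then obtain n where n: "fibre (lower_central G (Ord 0 0 (Suc (Suc n)))) \<subseteq> mfilt (p ^ e) (Suc k)" by blast
    obtain J where "\<And>f w. length w = Suc k \<Longrightarrow> p dvd (psi M ^^ J) f w"
      using psi_nilpotent[OF B] by blast
    then have J: "p ^ e dvd (psi M ^^ (J * e)) f w" if "length w = Suc k" for f w
      using psi_pow_nilpotent_power that by blast
    \<comment> \<open>\<open>J * e\<close> further steps make the leading form of degree
      \<open>Suc k\<close> divisible by \<open>p ^ e\<close>, which raises the order modulo
      \<open>p ^ e\<close> by one.\<close>
    have "fibre (lower_central G (Ord 0 0 (Suc (Suc n) + J * e))) \<subseteq> lead (p ^ e) (Suc k) (J * e)"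
      by (rule fibre_lower_central_lead[OF _ _ n]) (auto simp: less_eq_ord_def)
    also have "\<dots> \<subseteq> mfilt (p ^ e) (Suc (Suc k))"
    proof
      fix h
      assume "h \<in> lead (p ^ e) (Suc k) (J * e)"
      then obtain \<tau> where h: "h \<in> mfilt (p ^ e) (Suc k)"
        "\<And>w. length w = Suc k \<Longrightarrow> p ^ e dvd magnus h w - (psi M ^^ (J * e)) \<tau> w"
        by (auto simp: lead_def)
      have "p ^ e dvd magnus h w" if "length w = Suc k" for w
        using h(2)[OF that] J[OF that] by (rule zdvd_zdiffD)
      then show "h \<in> mfilt (p ^ e) (Suc (Suc k))"
        using h(1) by (simp add: mfilt_Suc[of _ _ "Suc k"])
    qed
    finally show ?case by auto
  qed
  fix u and w :: "gen list"
  assume u: "u \<in> fibre (lower_central G ord_omega)" and w: "w \<noteq> []"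
  have dvd: "p ^ e dvd magnus u w" for e
  proof -
    obtain n where n: "fibre (lower_central G (Ord 0 0 (Suc (Suc n)))) \<subseteq> mfilt (p ^ e) (Suc (length w))"
      using filt by blast
    have "u \<in> fibre (lower_central G (Ord 0 0 (Suc (Suc n))))"
      using u fibre_antimono[of "Ord 0 0 (Suc (Suc n))" ord_omega] by (auto simp: ord_omega_def less_eq_ord_def)
    then show ?thesis using n w by (auto simp: mfilt_def)
  qed
  show "magnus u w = 0"
    using eq_0_if_all_powers_dvd[OF p dvd] .
qed (simp add: ord_omega_def less_eq_ord_def)

end



section \<open>Eigenfunctionals of the tensor powers\<close>

text \<open>The tensor product of the linear functionals \<open>\<eta> e\<close>, for
  \<open>e\<close> in \<open>s\<close>, evaluated at the tensor with coefficients
  \<open>f\<close>.\<close>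

fun ell :: "('e \<Rightarrow> 'a::finite \<Rightarrow> real) \<Rightarrow> 'e list \<Rightarrow> ('a list \<Rightarrow> int) \<Rightarrow> real" where
  "ell \<eta> [] f = of_int (f [])"
| "ell \<eta> (e # s) f = (\<Sum>a\<in>UNIV. \<eta> e a * ell \<eta> s (\<lambda>u. f (a # u)))"

lemma ell_add: "ell \<eta> s (\<lambda>u. f u + g u) = ell \<eta> s f + ell \<eta> s g"
  by (induction s arbitrary: f g) (simp_all add: sum.distrib distrib_left)

lemma ell_scale: "ell \<eta> s (\<lambda>u. c * f u) = of_int c * ell \<eta> s f"
  by (induction s arbitrary: f) (simp_all add: sum_distrib_left mult.left_commute)

lemma ell_diff: "ell \<eta> s (\<lambda>u. f u - g u) = ell \<eta> s f - ell \<eta> s g"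
  using ell_add[of \<eta> s f "\<lambda>u. (-1) * g u"] unfolding ell_scale by simp

lemma ell_sum: "ell \<eta> s (\<lambda>u. \<Sum>a\<in>A. c a * f a u) = (\<Sum>a\<in>A. of_int (c a) * ell \<eta> s (f a))"
proof (induction A rule: infinite_finite_induct)
  case empty
  show ?case using ell_scale[of \<eta> s 0 "\<lambda>u. 0"] by simp
next
  case (infinite A)
  then show ?case using ell_scale[of \<eta> s 0 "\<lambda>u. 0"] by simp
qed (simp add: ell_add ell_scale)

lemma ell_cong: "(\<And>w. length w = length s \<Longrightarrow> f w = g w) \<Longrightarrow> ell \<eta> s f = ell \<eta> s g"
proof (induction s arbitrary: f g)
  case (Cons e s)
  have "ell \<eta> s (\<lambda>u. f (a # u)) = ell \<eta> s (\<lambda>u. g (a # u))" for a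
    by (rule Cons.IH) (simp add: Cons.prems)
  then show ?case by simp
qed simp

text \<open>The hypothesis makes \<open>\<eta> e\<close> a left eigenvector of \<open>M\<close> for
  \<open>\<mu> e\<close>; eigenvalues multiply in tensor products.\<close>

lemma ell_act:
  assumes "\<And>e a. (\<Sum>b\<in>UNIV. \<eta> e b * of_int (M b a)) = \<mu> e * \<eta> e a"
  shows "ell \<eta> s (act M f) = prod_list (map \<mu> s) * ell \<eta> s f"
proof (induction s arbitrary: f)
  case (Cons e s)
  have "ell \<eta> (e # s) (act M f)
    = (\<Sum>b\<in>UNIV. \<eta> e b * (\<Sum>a\<in>UNIV. of_int (M b a) * ell \<eta> s (act M (\<lambda>u. f (a # u)))))"
    by (simp add: ell_sum[of _ _ _ "\<lambda>a. act M (\<lambda>u. f (a # u))"])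
  also have "\<dots> = (\<Sum>a\<in>UNIV. (\<Sum>b\<in>UNIV. \<eta> e b * of_int (M b a)) * ell \<eta> s (act M (\<lambda>u. f (a # u))))"
    by (simp add: sum_distrib_left sum_distrib_right mult.assoc) (rule sum.swap)
  finally show ?case
    by (simp add: assms Cons.IH sum_distrib_left mult_ac)
qed simp

lemma ell_psi_pow:
  assumes "\<And>e a. (\<Sum>b\<in>UNIV. \<eta> e b * of_int (M b a)) = \<mu> e * \<eta> e a"
  shows "ell \<eta> s ((psi M ^^ n) f) = (prod_list (map \<mu> s) - 1) ^ n * ell \<eta> s f"
proof (induction n)
  case (Suc n)
  have "ell \<eta> s ((psi M ^^ Suc n) f) = ell \<eta> s (\<lambda>w. act M ((psi M ^^ n) f) w - (psi M ^^ n) f w)"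
    by (simp add: psi_def[of M "(psi M ^^ n) f", abs_def])
  then show ?case
    by (simp add: ell_diff ell_act[OF assms] Suc algebra_simps)
qed simp

lemma linear_system_trivial:
  fixes a b c d x y :: real
  assumes "a * x + b * y = 0" "c * x + d * y = 0" "a * d - b * c \<noteq> 0"
  shows "x = 0 \<and> y = 0"
proof -
  have "(a * d - b * c) * x = d * (a * x + b * y) - b * (c * x + d * y)"
    "(a * d - b * c) * y = a * (c * x + d * y) - c * (a * x + b * y)"
    by (simp_all add: algebra_simps)
  then have "(a * d - b * c) * x = 0" "(a * d - b * c) * y = 0"
    unfolding assms(1,2) by simp_all
  then show ?thesis using assms(3) by simp
qed

text \<open>By \<open>det\<close> the two functionals form a basis of the dual plane, so their
  tensor products form a basis of the dual of each tensor power.\<close>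

lemma ell_separates:
  fixes \<eta> :: "bool \<Rightarrow> gen \<Rightarrow> real"
  assumes det: "\<eta> True gen.X * \<eta> False Y - \<eta> True Y * \<eta> False gen.X \<noteq> 0"
    and "\<And>s. length s = length w \<Longrightarrow> ell \<eta> s f = 0"
  shows "f w = 0"
  using assms(2)
proof (induction w arbitrary: f)
  case Nil
  then show ?case by fastforce
next
  case (Cons a w)
  have "ell \<eta> s (\<lambda>u. f (c # u)) = 0" if s: "length s = length w" for s c
  proof -
    let ?x = "ell \<eta> s (\<lambda>u. f (gen.X # u))" and ?y = "ell \<eta> s (\<lambda>u. f (Y # u))"
    have eq: "\<eta> e gen.X * ?x + \<eta> e Y * ?y = 0" for e
      using Cons.prems[of "e # s"] s by (simp add: UNIV_gen)
    have "?x = 0 \<and> ?y = 0"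
      using eq[of True] eq[of False] det by (rule linear_system_trivial)
    then show ?thesis by (cases c) auto
  qed
  then show ?case using Cons.IH by blast
qed

section \<open>Norms in the quadratic ring generated by an eigenvalue\<close>

locale quadratic_unit =
  fixes N :: int and l l' :: real
  assumes sum_roots: "l + l' = of_int N" and prod_roots: "l * l' = - 1"
    and odd: "odd N" and large: "\<bar>N\<bar> \<ge> 3"
begin

text \<open>An element of Z[l] together with its Galois conjugate, where l and l' are the roots of
  z^2 - N z - 1.\<close>

definition conj_pair :: "real \<Rightarrow> real \<Rightarrow> bool" where
  "conj_pair z z' \<longleftrightarrow> (\<exists>P Q::int. z = of_int P + of_int Q * l \<and> z' = of_int P + of_int Q * l')"

lemma root_sq: "l * l = of_int N * l + 1" "l' * l' = of_int N * l' + 1"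
  unfolding sum_roots[symmetric] using prod_roots by (simp_all add: distrib_right mult.commute[of l' l])

lemma conj_pair_of_int: "conj_pair (of_int m) (of_int m)"
  unfolding conj_pair_def by (intro exI[of _ m] exI[of _ 0]) simp

lemma conj_pair_root: "conj_pair l l'" "conj_pair l' l"
proof -
  show "conj_pair l l'"
    unfolding conj_pair_def by (intro exI[of _ 0] exI[of _ 1]) simp
  show "conj_pair l' l"
    unfolding conj_pair_def using sum_roots by (intro exI[of _ N] exI[of _ "-1"]) simp
qed

lemma conj_pair_add: "conj_pair x x' \<Longrightarrow> conj_pair y y' \<Longrightarrow> conj_pair (x + y) (x' + y')"
proof -
  assume "conj_pair x x'" "conj_pair y y'"
  then obtain P Q R S :: int where "x = of_int P + of_int Q * l" "x' = of_int P + of_int Q * l'"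
    "y = of_int R + of_int S * l" "y' = of_int R + of_int S * l'"
    unfolding conj_pair_def by blast
  then show ?thesis
    unfolding conj_pair_def by (intro exI[of _ "P + R"] exI[of _ "Q + S"]) (simp add: algebra_simps)
qed

lemma conj_pair_mult: "conj_pair x x' \<Longrightarrow> conj_pair y y' \<Longrightarrow> conj_pair (x * y) (x' * y')"
proof -
  assume "conj_pair x x'" "conj_pair y y'"
  then obtain P Q R S :: int where xy: "x = of_int P + of_int Q * l" "x' = of_int P + of_int Q * l'"
    "y = of_int R + of_int S * l" "y' = of_int R + of_int S * l'"
    unfolding conj_pair_def by blast
  have "(of_int P + of_int Q * z) * (of_int R + of_int S * z)
    = of_int (P * R + Q * S) + of_int (P * S + Q * R + N * Q * S) * z" if "z * z = of_int N * z + 1" for z :: real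
  proof -
    have "(of_int P + of_int Q * z) * (of_int R + of_int S * z)
      = of_int (P * R) + of_int (P * S + Q * R) * z + of_int (Q * S) * (z * z)"
      by (simp add: algebra_simps)
    then show ?thesis unfolding that by (simp add: algebra_simps)
  qed
  then show ?thesis
    unfolding conj_pair_def xy using root_sq by blast
qed

lemma conj_pair_diff: "conj_pair x x' \<Longrightarrow> conj_pair y y' \<Longrightarrow> conj_pair (x - y) (x' - y')"
  using conj_pair_add[of x x' "- 1 * y" "- 1 * y'"] conj_pair_mult[of "- 1" "- 1" y y'] conj_pair_of_int[of "- 1"]
  by simp

lemma norm_int:
  fixes P Q :: int
  shows "(of_int P + of_int Q * l) * (of_int P + of_int Q * l') = of_int (P * P + N * P * Q - Q * Q)"
proof -
  have "(of_int P + of_int Q * l) * (of_int P + of_int Q * l')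
    = of_int (P * P) + of_int (P * Q) * (l + l') + of_int (Q * Q) * (l * l')"
    by (simp add: algebra_simps)
  then show ?thesis
    unfolding sum_roots prod_roots by (simp add: algebra_simps)
qed

text \<open>The norm form is anisotropic already modulo 2: for odd \<open>N\<close> it is even only
  at pairs of even numbers, which coprimality excludes after division by the gcd.\<close>

lemma norm_eq_0:
  fixes P Q :: int
  assumes "P * P + N * P * Q - Q * Q = 0"
  shows "P = 0 \<and> Q = 0"
proof (rule ccontr)
  assume neq: "\<not> (P = 0 \<and> Q = 0)"
  define g where "g = gcd P Q"
  have "g \<noteq> 0" using neq by (simp add: g_def)
  then obtain p q where pq: "P = p * g" "Q = q * g" "coprime p q"
    using gcd_coprime_exists unfolding g_def by blast
  have "(g * g) * (p * p + N * p * q - q * q) = P * P + N * P * Q - Q * Q"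
    unfolding pq(1,2) by (simp add: algebra_simps)
  then have "(g * g) * (p * p + N * p * q - q * q) = 0"
    using assms by (simp only:)
  then have "p * p + N * p * q - q * q = 0"
    using \<open>g \<noteq> 0\<close> by simp
  then have "even (p * p + N * p * q - q * q)" by simp
  then have "even p \<and> even q" using odd by auto
  then show False using pq(3) by (meson coprime_common_divisor odd_one)
qed

lemma conj_pair_norm:
  assumes "conj_pair z z'"
  obtains m :: int where "z * z' = of_int m" "m = 0 \<Longrightarrow> z = 0"
proof -
  obtain P Q :: int where PQ: "z = of_int P + of_int Q * l" "z' = of_int P + of_int Q * l'"
    using assms unfolding conj_pair_def by blast
  show ?thesis
  proof (rule that)
    show "z * z' = of_int (P * P + N * P * Q - Q * Q)"
      unfolding PQ by (rule norm_int)
    show "z = 0" if "P * P + N * P * Q - Q * Q = 0"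
      using norm_eq_0[OF that] by (simp add: PQ)
  qed
qed

definition ev :: "bool \<Rightarrow> real" where
  "ev e = (if e then l else l')"

lemma ev_simps [simp]: "ev True = l" "ev False = l'"
  by (simp_all add: ev_def)

lemma conj_pair_ev: "conj_pair (prod_list (map ev s)) (prod_list (map ev (map Not s)))"
proof (induction s)
  case Nil
  show ?case using conj_pair_of_int[of 1] by simp
next
  case (Cons e s)
  then show ?case
    using conj_pair_root by (cases e) (auto simp: ev_def intro!: conj_pair_mult)
qed

lemma abs_prod_ev:
  "\<exists>i j. \<bar>prod_list (map ev s)\<bar> = \<bar>l\<bar> ^ i * \<bar>l'\<bar> ^ j \<and> \<bar>prod_list (map ev (map Not s))\<bar> = \<bar>l\<bar> ^ j * \<bar>l'\<bar> ^ i"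
proof (induction s)
  case Nil
  show ?case by (intro exI[of _ 0]) simp
next
  case (Cons e s)
  then obtain i j where ij: "\<bar>prod_list (map ev s)\<bar> = \<bar>l\<bar> ^ i * \<bar>l'\<bar> ^ j"
    "\<bar>prod_list (map ev (map Not s))\<bar> = \<bar>l\<bar> ^ j * \<bar>l'\<bar> ^ i" by blast
  show ?case
  proof (cases e)
    case True
    then show ?thesis using ij
      by (intro exI[of _ "Suc i"] exI[of _ j]) (simp add: abs_mult mult_ac del: map_map)
  next
    case False
    then show ?thesis using ij
      by (intro exI[of _ i] exI[of _ "Suc j"]) (simp add: abs_mult mult_ac del: map_map)
  qed
qed

lemma abs_roots: "\<bar>l\<bar> * \<bar>l'\<bar> = 1" "\<bar>l\<bar> \<ge> 3 \<or> \<bar>l'\<bar> \<ge> 3"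
proof -
  show 1: "\<bar>l\<bar> * \<bar>l'\<bar> = 1"
    using prod_roots by (simp flip: abs_mult)
  have "(of_int N :: real) \<ge> 3 \<or> (of_int N :: real) \<le> - 3"
    using large by linarith
  \<comment> \<open>The product -1 gives opposite signs, so the root with the sign of
    \<open>N\<close> exceeds \<open>N\<close> in absolute value.\<close>
  moreover have "l > 0 \<and> l' < 0 \<or> l < 0 \<and> l' > 0"
    using prod_roots by (metis linorder_neqE_linordered_idom mult_neg_neg mult_pos_pos mult_zero_left
        mult_zero_right neg_0_less_iff_less neg_equal_0_iff_equal not_one_less_zero one_neq_zero)
  ultimately show "\<bar>l\<bar> \<ge> 3 \<or> \<bar>l'\<bar> \<ge> 3"
    using sum_roots by linarith
qed

text \<open>With x = |z| the absolute value is at least (x - 1)(1 - 1/x) = (x - 1)^2 / x, and x < (x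
  - 1)^2 once x \<ge> 3.\<close>

lemma abs_product_large:
  fixes z z' :: real
  assumes "\<bar>z\<bar> \<ge> 3" "\<bar>z\<bar> * \<bar>z'\<bar> = 1"
  shows "\<bar>(z - 1) * (z' - 1)\<bar> > 1"
proof -
  define x where "x = \<bar>z\<bar>"
  have x: "x \<ge> 3" "\<bar>z'\<bar> = 1 / x"
    using assms by (simp_all add: x_def field_simps)
  have "x * 3 \<le> x * x" using x(1) by (intro mult_left_mono) auto
  then have "x < (x - 1) * (x - 1)" by (simp add: algebra_simps)
  then have "1 < (x - 1) * (x - 1) / x" using x(1) by simp
  also have "\<dots> = (x - 1) * (1 - 1 / x)" using x(1) by (simp add: field_simps)
  also have "\<dots> \<le> \<bar>z - 1\<bar> * \<bar>z' - 1\<bar>"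
  proof (rule mult_mono)
    show "x - 1 \<le> \<bar>z - 1\<bar>" unfolding x_def by linarith
    show "1 - 1 / x \<le> \<bar>z' - 1\<bar>" unfolding x(2)[symmetric] by linarith
  qed (use x(1) in auto)
  finally show ?thesis by (simp add: abs_mult)
qed

text \<open>Let the product have i factors l and j factors l'. Since |l l'| = 1, for i \<noteq> j
  one of the two conjugates is at least 3 in absolute value and \<open>abs_product_large\<close>
  applies; for i = j both are 1 or -1 and the norm is 0 or 4.\<close>

lemma norm_ev_minus_1:
  assumes "(prod_list (map ev s) - 1) * (prod_list (map ev (map Not s)) - 1) = of_int m"
  shows "\<bar>m\<bar> \<noteq> 1"
proof
  assume m: "\<bar>m\<bar> = 1"
  let ?z = "prod_list (map ev s)" and ?z' = "prod_list (map ev (map Not s))"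
  have not_large: "\<not> 1 < \<bar>(?z - 1) * (?z' - 1)\<bar>"
    unfolding assms using m by linarith
  obtain i j where ij: "\<bar>?z\<bar> = \<bar>l\<bar> ^ i * \<bar>l'\<bar> ^ j" "\<bar>?z'\<bar> = \<bar>l\<bar> ^ j * \<bar>l'\<bar> ^ i"
    using abs_prod_ev by blast
  have pow: "\<bar>l\<bar> ^ n * \<bar>l'\<bar> ^ n = 1" for n
    using abs_roots(1) by (simp flip: power_mult_distrib)
  have prod: "\<bar>?z\<bar> * \<bar>?z'\<bar> = 1"
  proof -
    have "\<bar>?z\<bar> * \<bar>?z'\<bar> = (\<bar>l\<bar> ^ i * \<bar>l'\<bar> ^ i) * (\<bar>l\<bar> ^ j * \<bar>l'\<bar> ^ j)"
      unfolding ij by (simp only: mult_ac)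
    then show ?thesis by (simp only: pow)
  qed
  have red: "\<bar>l\<bar> ^ (a + b) * \<bar>l'\<bar> ^ a = \<bar>l\<bar> ^ b" "\<bar>l\<bar> ^ a * \<bar>l'\<bar> ^ (a + b) = \<bar>l'\<bar> ^ b" for a b
  proof -
    have "\<bar>l\<bar> ^ (a + b) * \<bar>l'\<bar> ^ a = (\<bar>l\<bar> ^ a * \<bar>l'\<bar> ^ a) * \<bar>l\<bar> ^ b"
      "\<bar>l\<bar> ^ a * \<bar>l'\<bar> ^ (a + b) = (\<bar>l\<bar> ^ a * \<bar>l'\<bar> ^ a) * \<bar>l'\<bar> ^ b"
      by (simp_all only: power_add mult_ac)
    then show "\<bar>l\<bar> ^ (a + b) * \<bar>l'\<bar> ^ a = \<bar>l\<bar> ^ b" "\<bar>l\<bar> ^ a * \<bar>l'\<bar> ^ (a + b) = \<bar>l'\<bar> ^ b"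
      by (simp_all only: pow mult_1)
  qed
  have ge: "x ^ n \<ge> 3" if "x \<ge> 3" "n > 0" for x :: real and n
    using that self_le_power[of x n] by linarith
  have "i = j"
  proof (rule ccontr)
    assume "i \<noteq> j"
    then consider n where "i = j + n" "n > 0" | n where "j = i + n" "n > 0"
      by (metis less_imp_add_positive linorder_neqE_nat)
    then have "\<exists>n>0. \<bar>?z\<bar> = \<bar>l\<bar> ^ n \<and> \<bar>?z'\<bar> = \<bar>l'\<bar> ^ n \<or> \<bar>?z\<bar> = \<bar>l'\<bar> ^ n \<and> \<bar>?z'\<bar> = \<bar>l\<bar> ^ n"
    proof cases
      case 1
      then show ?thesis unfolding ij using red[of j n] by auto
    next
      case 2
      then show ?thesis unfolding ij using red[of i n] by auto
    qed
    then have "\<bar>?z\<bar> \<ge> 3 \<or> \<bar>?z'\<bar> \<ge> 3"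
    proof -
      obtain n where n: "n > 0" "\<bar>?z\<bar> = \<bar>l\<bar> ^ n \<and> \<bar>?z'\<bar> = \<bar>l'\<bar> ^ n \<or> \<bar>?z\<bar> = \<bar>l'\<bar> ^ n \<and> \<bar>?z'\<bar> = \<bar>l\<bar> ^ n"
        using \<open>\<exists>n>0. _\<close> by blast
      have "\<bar>l\<bar> ^ n \<ge> 3 \<or> \<bar>l'\<bar> ^ n \<ge> 3"
        using abs_roots(2) ge n(1) by blast
      then show ?thesis using n(2) by argo
    qed
    then show False
      using abs_product_large[of ?z ?z'] abs_product_large[of ?z' ?z] prod not_large
      by (metis mult.commute)
  qed
  then have "\<bar>?z\<bar> = 1" "\<bar>?z'\<bar> = 1"
    using ij pow by auto
  then have "(?z - 1) * (?z' - 1) = 0 \<or> (?z - 1) * (?z' - 1) = 4"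
    by (auto simp: abs_if split: if_splits)
  then show False
    unfolding assms using m by auto
qed

lemma conj_pair_sum:
  "(\<And>a. a \<in> A \<Longrightarrow> conj_pair (f a) (g a)) \<Longrightarrow> conj_pair (sum f A) (sum g A)"
  using conj_pair_of_int[of 0]
  by (induction A rule: infinite_finite_induct) (auto intro: conj_pair_add)

lemma conj_pair_ell:
  assumes "\<And>e a. conj_pair (\<eta> e a) (\<eta> (\<not> e) a)"
  shows "conj_pair (ell \<eta> s f) (ell \<eta> (map Not s) f)"
proof (induction s arbitrary: f)
  case (Cons e s)
  show ?case
    unfolding ell.simps list.map by (intro conj_pair_sum conj_pair_mult assms Cons.IH)
qed (simp add: conj_pair_of_int)

text \<open>An eigenfunctional for the eigenvalue \<mu> takes at \<tau> a value that is (\<mu> -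
  1)^n times an element of Z[l], for every n. On norms, \<open>m\<close> is divisible by all powers
  of the non-unit \<open>c\<close>, so the value is 0; and eigenfunctionals separate
  tensors.\<close>

lemma psi_powers_intersection:
  fixes M :: "gen \<Rightarrow> gen \<Rightarrow> int"
  assumes M: "M gen.X gen.X + M Y Y = N" "M gen.X gen.X * M Y Y - M gen.X Y * M Y gen.X = - 1"
    and \<tau>: "\<And>n. \<exists>\<sigma>. \<forall>w. length w = k \<longrightarrow> \<tau> w = (psi M ^^ n) \<sigma> w" and w: "length w = k"
  shows "\<tau> w = 0"
proof -
  \<comment> \<open>A left eigenvector of \<open>M\<close> for each of the eigenvalues
    \<open>ev e\<close>.\<close>
  define \<eta> :: "bool \<Rightarrow> gen \<Rightarrow> real" where
    "\<eta> e a = (case a of gen.X \<Rightarrow> of_int (M Y gen.X) | Y \<Rightarrow> ev e - of_int (M gen.X gen.X))" for e a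
  have ev_sq: "ev e * ev e = of_int N * ev e + 1" for e
    using root_sq by (simp add: ev_def)
  have eigen: "(\<Sum>b\<in>UNIV. \<eta> e b * of_int (M b a)) = ev e * \<eta> e a" for e a
  proof (cases a)
    case X
    then show ?thesis by (simp add: UNIV_gen \<eta>_def algebra_simps)
  next
    case Y
    have "ev e * ev e = (of_int (M gen.X gen.X) + of_int (M Y Y)) * ev e + (of_int (M gen.X Y) * of_int (M Y gen.X) - of_int (M gen.X gen.X) * of_int (M Y Y))"
      using ev_sq[of e] M by (simp flip: of_int_add of_int_mult of_int_diff)
    then show ?thesis by (simp add: Y UNIV_gen \<eta>_def algebra_simps)
  qed
  have conj: "conj_pair (\<eta> e a) (\<eta> (\<not> e) a)" for e a
    using conj_pair_root by (cases a; cases e) (auto simp: \<eta>_def ev_def intro!: conj_pair_diff conj_pair_of_int)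
  \<comment> \<open>Were this entry 0, the diagonal entries would have product -1, hence be odd, and
    the trace would be even. Together with \<open>l \<noteq> l'\<close> it makes the two
    eigenvectors independent.\<close>
  have "M Y gen.X \<noteq> 0"
  proof
    assume "M Y gen.X = 0"
    then have 1: "M gen.X gen.X * M Y Y = - 1" using M(2) by simp
    then have "odd (M gen.X gen.X)" "odd (M Y Y)"
      by (metis dvd_mult2 dvd_minus_iff odd_one, metis dvd_mult dvd_minus_iff odd_one)
    then show False using M(1) odd by auto
  qed
  moreover have "l \<noteq> l'"
  proof
    assume "l = l'"
    then have "l' * l' = - 1" using prod_roots by simp
    moreover have "0 \<le> l' * l'" by (rule zero_le_square)
    ultimately show False by linarith
  qed
  ultimately have det: "\<eta> True gen.X * \<eta> False Y - \<eta> True Y * \<eta> False gen.X \<noteq> 0"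
    by (auto simp: \<eta>_def ev_def algebra_simps)
  have "ell \<eta> s \<tau> = 0" if s: "length s = k" for s
  proof -
    let ?z = "prod_list (map ev s)" and ?z' = "prod_list (map ev (map Not s))"
    obtain m where m: "ell \<eta> s \<tau> * ell \<eta> (map Not s) \<tau> = of_int m" "m = 0 \<Longrightarrow> ell \<eta> s \<tau> = 0"
      using conj_pair_norm[OF conj_pair_ell[of \<eta>, OF conj]] by blast
    have "conj_pair (?z - 1) (?z' - 1)"
      using conj_pair_diff[OF conj_pair_ev conj_pair_of_int[of 1]] by simp
    then obtain c :: int where c: "(?z - 1) * (?z' - 1) = of_int c"
      using conj_pair_norm by blast
    have dvd: "c ^ n dvd m" for n
    proof -
      obtain \<sigma> where "\<forall>w. length w = k \<longrightarrow> \<tau> w = (psi M ^^ n) \<sigma> w" using \<tau> by blast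
      then have eq: "ell \<eta> s \<tau> = (?z - 1) ^ n * ell \<eta> s \<sigma>" "ell \<eta> (map Not s) \<tau> = (?z' - 1) ^ n * ell \<eta> (map Not s) \<sigma>"
        using ell_cong[of s \<tau> "(psi M ^^ n) \<sigma>" \<eta>] ell_cong[of "map Not s" \<tau> "(psi M ^^ n) \<sigma>" \<eta>]
          ell_psi_pow[OF eigen] s by (auto simp del: map_map)
      obtain r :: int where r: "ell \<eta> s \<sigma> * ell \<eta> (map Not s) \<sigma> = of_int r"
        using conj_pair_norm[OF conj_pair_ell[of \<eta>, OF conj]] by blast
      have "of_int m = ((?z - 1) * (?z' - 1)) ^ n * (ell \<eta> s \<sigma> * ell \<eta> (map Not s) \<sigma>)"
        unfolding m(1)[symmetric] eq by (simp only: power_mult_distrib mult_ac)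
      then have "(of_int m :: real) = of_int (c ^ n * r)"
        unfolding c r by simp
      then have "m = c ^ n * r" by (simp only: of_int_eq_iff)
      then show ?thesis by simp
    qed
    have "m = 0"
    proof (cases "c = 0")
      case True
      then show ?thesis using dvd[of 1] by simp
    next
      case False
      then have "\<bar>c\<bar> > 1" using norm_ev_minus_1[OF c] by linarith
      then show ?thesis using dvd eq_0_if_all_powers_dvd by blast
    qed
    then show ?thesis using m(2) by simp
  qed
  then show ?thesis
    using ell_separates[OF det, of w \<tau>] w by simp
qed

end

text \<open>Each limit step raises the order of the Magnus expansion by one: beyond it the leading
  form lies in the image of every power of \<open>psi M\<close> and is 0 by
  \<open>psi_powers_intersection\<close>.\<close>

lemma (in free_by_cyclic) lower_central_omega_sq_trivial:
  assumes N: "M gen.X gen.X + M Y Y = N" "M gen.X gen.X * M Y Y - M gen.X Y * M Y gen.X = - 1" "odd N" "\<bar>N\<bar> \<ge> 3"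
  shows "lower_central G ord_omega_sq = {\<one>\<^bsub>G\<^esub>}"
proof (rule lower_central_trivial)
  let ?l = "(of_int N + sqrt (of_int (N * N + 4))) / 2" and ?l' = "(of_int N - sqrt (of_int (N * N + 4))) / 2"
  have "0 \<le> (of_int (N * N + 4) :: real)"
    by (simp only: of_int_0_le_iff) simp
  then have "sqrt (of_int (N * N + 4)) * sqrt (of_int (N * N + 4)) = (of_int (N * N + 4) :: real)"
    by simp
  then have "?l * ?l' = - 1"
    by (simp add: algebra_simps)
  moreover have "?l + ?l' = of_int N"
    by (simp add: add_divide_distrib[symmetric])
  ultimately interpret quadratic_unit N ?l ?l'
    using N(3,4) by unfold_locales
  \<comment> \<open>The offset 2 puts even the case \<open>k = 0\<close> inside the normal factor,
    as \<open>fibre_lower_central_lead\<close> requires; \<open>d = 0\<close> turns congruences into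
    equations.\<close>
  have filt: "fibre (lower_central G (Ord 0 k (Suc (Suc 0)))) \<subseteq> mfilt 0 (Suc k)" for k
  proof (induction k)
    case 0
    show ?case by (metis One_nat_def fibre_carrier mfilt_1 subsetI)
  next
    case (Suc k)
    show ?case
    proof
      fix u
      assume u: "u \<in> fibre (lower_central G (Ord 0 (Suc k) (Suc (Suc 0))))"
      have lead: "u \<in> lead 0 (Suc k) n" for n
      proof -
        have "u \<in> fibre (lower_central G (Ord 0 k (Suc (Suc 0) + n)))"
          using u fibre_antimono[of "Ord 0 k (Suc (Suc 0) + n)" "Ord 0 (Suc k) (Suc (Suc 0))"]
          by (auto simp: less_eq_ord_def)
        then show ?thesis
          using fibre_lower_central_lead[OF _ _ Suc, of n] by (auto simp: less_eq_ord_def)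
      qed
      have "magnus u w = 0" if "length w = Suc k" for w
        using lead by (intro psi_powers_intersection[OF N(1,2) _ that]) (auto simp: lead_def)
      then show "u \<in> mfilt 0 (Suc (Suc k))"
        using lead[of 0] by (simp add: lead_0 mfilt_Suc[of u _ "Suc k"])
    qed
  qed
  fix u and w :: "gen list"
  assume u: "u \<in> fibre (lower_central G ord_omega_sq)" and w: "w \<noteq> []"
  have "u \<in> mfilt 0 (Suc (length w))"
    using u filt[of "length w"] fibre_antimono[of "Ord 0 (length w) (Suc (Suc 0))" ord_omega_sq]
    by (auto simp: ord_omega_sq_def less_eq_ord_def)
  then show "magnus u w = 0"
    using w by (simp add: mfilt_def)
qed (simp add: ord_omega_sq_def less_eq_ord_def)



section \<open>Class two quotients\<close>

context group
begin

lemma int_pow_conj: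
  assumes "x \<in> carrier G" "y \<in> carrier G"
  shows "y \<otimes> x [^] (i::int) \<otimes> inv y = (y \<otimes> x \<otimes> inv y) [^] i"
proof -
  have "group_hom G G (\<lambda>z. y \<otimes> z \<otimes> inv y)"
    using assms(2) by unfold_locales (auto simp: hom_def m_assoc inv_cancel)
  then show ?thesis
    using group_hom.hom_int_pow[OF _ assms(1)] by fastforce
qed

lemma int_pow_commute:
  assumes "x \<in> carrier G" "y \<in> carrier G" "x \<otimes> y = y \<otimes> x"
  shows "x [^] (i::int) \<otimes> y = y \<otimes> x [^] i"
proof -
  have "y \<otimes> x \<otimes> inv y = x"
    using assms by (metis inv_solve_right' m_closed)
  then have "y \<otimes> x [^] i \<otimes> inv y = x [^] i"
    using int_pow_conj[OF assms(1,2), of i] by simp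
  then show ?thesis
    using assms by (metis int_pow_closed inv_solve_right' m_closed)
qed

lemma mult_int_pow_central_comm:
  assumes x: "x \<in> carrier G" and y: "y \<in> carrier G"
    and central: "comm x y \<otimes> x = x \<otimes> comm x y" "comm x y \<otimes> y = y \<otimes> comm x y"
  shows "y \<otimes> x [^] (i::int) = x [^] i \<otimes> y \<otimes> comm x y [^] (- i)"
    and "inv y \<otimes> x [^] i = x [^] i \<otimes> inv y \<otimes> comm x y [^] i"
proof -
  define u where "u = comm x y"
  have u: "u \<in> carrier G" "u \<otimes> x = x \<otimes> u" "u \<otimes> y = y \<otimes> u"
    using x y central by (auto simp: u_def)
  have ux: "u [^] k \<otimes> x [^] m = x [^] m \<otimes> u [^] k" for k m :: int
    using u x by (intro int_pow_commute int_pow_commute[symmetric]) auto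
  have uy: "u [^] k \<otimes> y = y \<otimes> u [^] k" for k :: int
    using u y by (intro int_pow_commute) auto
  have uy_inv: "u [^] k \<otimes> inv y = inv y \<otimes> u [^] k" for k :: int
    using u(1) y uy[of k] by (metis inv_closed inv_solve_left inv_solve_right int_pow_closed m_assoc m_closed)
  have "y \<otimes> x \<otimes> inv y = inv u \<otimes> x"
    using x y by (simp add: u_def inv_mult_group m_assoc)
  then have "y \<otimes> x [^] i \<otimes> inv y = (inv u \<otimes> x) [^] i"
    using int_pow_conj[OF x y, of i] by simp
  also have "\<dots> = inv u [^] i \<otimes> x [^] i"
    using ux[of "- 1" 1] u(1) x by (intro int_pow_mult_distrib) (simp_all add: int_pow_neg)
  also have "\<dots> = x [^] i \<otimes> u [^] (- i)"
    using ux[of "- i" i] u(1) by (simp add: int_pow_inv int_pow_neg)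
  finally have conj: "y \<otimes> x [^] i \<otimes> inv y = x [^] i \<otimes> u [^] (- i)" .
  have "y \<otimes> x [^] i = (y \<otimes> x [^] i \<otimes> inv y) \<otimes> y"
    using x y by (simp add: m_assoc)
  then show 1: "y \<otimes> x [^] i = x [^] i \<otimes> y \<otimes> comm x y [^] (- i)"
    unfolding conj u_def[symmetric] using x y u(1) uy by (simp add: m_assoc)
  have "inv y \<otimes> x [^] i = inv y \<otimes> (x [^] i \<otimes> u [^] (- i)) \<otimes> u [^] i"
    using x y u(1) by (simp add: m_assoc flip: int_pow_mult)
  also have "\<dots> = x [^] i \<otimes> (inv y \<otimes> u [^] i)"
    unfolding conj[symmetric] using x y u(1) by (simp add: m_assoc inv_cancel)
  finally show "inv y \<otimes> x [^] i = x [^] i \<otimes> inv y \<otimes> comm x y [^] i"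
    using x y u(1) by (simp add: m_assoc u_def)
qed

end

text \<open>Collection when u = [x, y] is central. The exponents of x and y are exponent sums;
  moving a new y past x^i costs u^-i, and these costs add up to minus the Magnus coefficient of the
  monomial YX.\<close>

lemma heisenberg_normal_form:
  fixes Q (structure) and \<theta> :: "gen word \<Rightarrow> 'q"
  assumes \<theta>: "group_hom free_group Q \<theta>"
  defines "x \<equiv> \<theta> [(gen.X, True)]" and "y \<equiv> \<theta> [(Y, True)]"
  defines "u \<equiv> x \<otimes> y \<otimes> inv x \<otimes> inv y"
  assumes central: "u \<otimes> x = x \<otimes> u" "u \<otimes> y = y \<otimes> u"
    and g: "reduced g"
  shows "\<theta> g = x [^] magnus g [gen.X] \<otimes> y [^] magnus g [Y] \<otimes> u [^] (- magnus g [Y, gen.X])"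
proof -
  interpret \<theta>: group_hom free_group Q \<theta> by fact
  have xy: "x \<in> carrier Q" "y \<in> carrier Q" and uc: "u \<in> carrier Q"
    by (auto simp: x_def y_def u_def)
  have uy: "u [^] k \<otimes> y [^] m = y [^] m \<otimes> u [^] k" for k m :: int
    using uc xy central by (intro \<theta>.H.int_pow_commute \<theta>.H.int_pow_commute[symmetric]) auto
  have yx: "y \<otimes> x [^] i = x [^] i \<otimes> y \<otimes> u [^] (- i)" "inv y \<otimes> x [^] i = x [^] i \<otimes> inv y \<otimes> u [^] i" for i :: int
    unfolding u_def using central xy by (intro \<theta>.H.mult_int_pow_central_comm; simp add: u_def)+
  show ?thesis
    using g
  proof (induction g)
    case Nil
    have "\<theta> [] = \<one>" using \<theta>.hom_one by (simp add: free_group_def)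
    then show ?case using xy uc by simp
  next
    case (Cons l g)
    have red: "reduced g" "g \<in> carrier free_group"
      using Cons.prems by (auto simp: reduced_Cons carrier_free_group)
    obtain a s where l: "l = (a, s)" by force
    let ?i = "magnus g [gen.X]" and ?j = "magnus g [Y]" and ?k = "magnus g [Y, gen.X]"
    have cong: "\<theta> (l # g) = \<theta> [l] \<otimes> (x [^] ?i \<otimes> y [^] ?j \<otimes> u [^] (- ?k))"
      using \<theta>.hom_mult[of "[l]" g] red by (simp add: letter_mult[OF Cons.prems] Cons.IH)
    have neg: "\<theta> [(b, False)] = inv (\<theta> [(b, True)])" for b
      using \<theta>.hom_inv[of "[(b, True)]"] by (simp add: inv_letter_word)
    have y_case: "z \<otimes> (x [^] ?i \<otimes> y [^] ?j \<otimes> u [^] (- ?k)) = x [^] ?i \<otimes> y [^] (?j + e) \<otimes> u [^] (- ?k + f)"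
      if "z = y [^] e" "z \<otimes> x [^] ?i = x [^] ?i \<otimes> z \<otimes> u [^] f" for z and e f :: int
    proof -
      have z: "z \<in> carrier Q" using that xy by simp
      have "z \<otimes> (x [^] ?i \<otimes> y [^] ?j \<otimes> u [^] (- ?k)) = (z \<otimes> x [^] ?i) \<otimes> (y [^] ?j \<otimes> u [^] (- ?k))"
        using z xy uc by (simp add: \<theta>.H.m_assoc)
      also have "\<dots> = x [^] ?i \<otimes> z \<otimes> ((u [^] f \<otimes> y [^] ?j) \<otimes> u [^] (- ?k))"
        unfolding that(2) using z xy uc by (simp add: \<theta>.H.m_assoc)
      also have "\<dots> = x [^] ?i \<otimes> (z \<otimes> y [^] ?j) \<otimes> (u [^] f \<otimes> u [^] (- ?k))"
        unfolding uy using z xy uc by (simp add: \<theta>.H.m_assoc)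
      also have "z \<otimes> y [^] ?j = y [^] (?j + e)"
        using that(1) xy by (simp add: add.commute flip: \<theta>.H.int_pow_mult)
      also have "u [^] f \<otimes> u [^] (- ?k) = u [^] (- ?k + f)"
        using uc by (simp flip: \<theta>.H.int_pow_mult)
      finally show ?thesis .
    qed
    have x_case: "x [^] e \<otimes> (x [^] ?i \<otimes> y [^] ?j \<otimes> u [^] (- ?k)) = x [^] (e + ?i) \<otimes> y [^] ?j \<otimes> u [^] (- ?k)" for e :: int
      using xy uc by (simp add: \<theta>.H.m_assoc \<theta>.H.int_pow_mult)
    show ?case
    proof (cases a)
      case X
      then have "\<theta> [l] = x [^] (if s then 1 else - 1 :: int)"
        using xy by (auto simp: l x_def neg \<theta>.H.int_pow_neg)
      then show ?thesis
        unfolding cong using x_case[of "if s then 1 else - 1"] by (simp add: l X add.commute)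
    next
      case Y
      then have "\<theta> [l] = y [^] (if s then 1 else - 1 :: int)"
        using xy by (auto simp: l y_def neg \<theta>.H.int_pow_neg)
      moreover from this have "\<theta> [l] \<otimes> x [^] ?i = x [^] ?i \<otimes> \<theta> [l] \<otimes> u [^] (if s then - ?i else ?i)"
        using yx[of ?i] xy by (auto simp: \<theta>.H.int_pow_neg)
      ultimately have "\<theta> (l # g) = x [^] ?i \<otimes> y [^] (?j + (if s then 1 else - 1)) \<otimes> u [^] (- ?k + (if s then - ?i else ?i))"
        unfolding cong by (rule y_case)
      then show ?thesis
        by (cases s) (simp_all add: l Y)
    qed
  qed
qed

lemma magnus_comm_pair:
  assumes "a \<in> carrier free_group" "b \<in> carrier free_group"
  shows "magnus (F.comm a b) [i, j] = magnus a [i] * magnus b [j] - magnus b [i] * magnus a [j]"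
    and "magnus (F.comm a b) [i] = 0"
proof -
  have ab: "a \<in> mfilt 0 1" "b \<in> mfilt 0 1" using assms by (simp_all add: mfilt_1)
  show "magnus (F.comm a b) [i, j] = magnus a [i] * magnus b [j] - magnus b [i] * magnus a [j]"
    using magnus_comm(2)[OF ab, of "[i, j]"] by simp
  show "magnus (F.comm a b) [i] = 0"
    using magnus_comm(1)[OF ab] mfilt_dvd[of _ 0 2 "[i]"] by (simp add: numeral_2_eq_2)
qed

lemma exists_magnus:
  "\<exists>v \<in> carrier free_group. magnus v [gen.X] = i \<and> magnus v [Y] = j"
proof -
  have red: "reduced (replicate n l)" for n and l :: "gen \<times> bool"
    by (induction n) (auto simp: reduced_Cons hd_replicate)
  have pow: "magnus (replicate n (a, s)) [b] = (if a = b then if s then int n else - int n else 0)" for n a b s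
    by (induction n) auto
  have ex: "\<exists>v \<in> carrier free_group. \<forall>b. magnus v [b] = (if a = b then i else 0)" for a :: gen and i
  proof (intro bexI[of _ "replicate (nat \<bar>i\<bar>) (a, i \<ge> 0)"] allI)
    show "replicate (nat \<bar>i\<bar>) (a, 0 \<le> i) \<in> carrier free_group" using red by (simp add: carrier_free_group)
  qed (auto simp: pow)
  obtain v where v: "v \<in> carrier free_group" "\<And>b. magnus v [b] = (if gen.X = b then i else 0)" using ex by blast
  obtain w where w: "w \<in> carrier free_group" "\<And>b. magnus w [b] = (if Y = b then j else 0)" using ex by blast
  have "magnus (v \<otimes>\<^bsub>free_group\<^esub> w) [b] = magnus v [b] + magnus w [b]" for b
    by (simp add: magnus_mult)
  then show ?thesis
    using v w by (intro bexI[of _ "v \<otimes>\<^bsub>free_group\<^esub> w"]) auto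
qed

context free_by_cyclic
begin

abbreviation x where "x \<equiv> [(gen.X, True)]"
abbreviation y where "y \<equiv> [(Y, True)]"
abbreviation u where "u \<equiv> F.comm x y"

lemma magnus_phi:
  assumes "v \<in> carrier free_group"
  shows "magnus (\<phi> v) [b] = M b gen.X * magnus v [gen.X] + M b Y * magnus v [Y]"
proof -
  have "v \<in> mfilt 0 1" using assms by (simp add: mfilt_1)
  then show ?thesis
    using magnus_hom_lead[OF phi_hom, of v 0 1 "[b]"] by (simp add: UNIV_gen M_def)
qed

lemma magnus_phi_inv:
  assumes "v \<in> carrier free_group"
  shows "magnus (\<phi> v \<otimes>\<^bsub>free_group\<^esub> inv\<^bsub>free_group\<^esub> v) [b]
    = M b gen.X * magnus v [gen.X] + M b Y * magnus v [Y] - magnus v [b]"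
proof -
  have v: "v \<in> mfilt 0 1" using assms by (simp add: mfilt_1)
  have "magnus v [b] + magnus (inv\<^bsub>free_group\<^esub> v) [b] = 0"
    using magnus_inv_mfilt[OF v, of "[b]"] by simp
  then show ?thesis
    using magnus_phi[OF assms, of b] by (simp add: magnus_mult)
qed

text \<open>Modulo \<open>fibre S\<close> the group F is abelian, generated by x and y, and
  \<open>\<phi> v \<otimes> inv v\<close> has exponent vector (M - 1) v. As M - 1 is invertible over
  the integers, these elements exhaust F.\<close>

lemma fibre_eq_carrier:
  assumes S: "S \<lhd> G" and det: "\<bar>(M gen.X gen.X - 1) * (M Y Y - 1) - M gen.X Y * M Y gen.X\<bar> = 1"
    and comm: "u \<in> fibre S"
    and phi: "\<And>v. v \<in> carrier free_group \<Longrightarrow> \<phi> v \<otimes>\<^bsub>free_group\<^esub> inv\<^bsub>free_group\<^esub> v \<in> fibre S"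
  shows "fibre S = carrier free_group"
proof -
  obtain Q :: "gen word set monoid" and \<theta> where \<theta>: "group_hom free_group Q \<theta>"
    and "\<theta> ` carrier free_group = carrier Q"
    and ker: "\<And>a. a \<in> carrier free_group \<Longrightarrow> \<theta> a = \<one>\<^bsub>Q\<^esub> \<longleftrightarrow> a \<in> fibre S"
    by (rule F.quotient_hom[OF fibre_normal[OF S]]) (rule that)
  interpret \<theta>: group_hom free_group Q \<theta> by fact
  have u1: "\<theta>.H.comm (\<theta> x) (\<theta> y) = \<one>\<^bsub>Q\<^esub>"
    using ker[of u] comm by simp
  have form: "\<theta> g = \<theta> x [^]\<^bsub>Q\<^esub> magnus g [gen.X] \<otimes>\<^bsub>Q\<^esub> \<theta> y [^]\<^bsub>Q\<^esub> magnus g [Y]" if "g \<in> carrier free_group" for g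
  proof -
    have "\<theta> x \<in> carrier Q" "\<theta> y \<in> carrier Q" by simp_all
    moreover have "reduced g" using that by (simp add: carrier_free_group)
    ultimately show ?thesis
      using heisenberg_normal_form[OF \<theta>, of g] unfolding u1 by simp
  qed
  let ?d = "(M gen.X gen.X - 1) * (M Y Y - 1) - M gen.X Y * M Y gen.X"
  have d2: "?d * ?d = 1"
    using det abs_mult_self_eq[of ?d] by (simp only: mult_1)
  have gen: "\<exists>v \<in> carrier free_group. M gen.X gen.X * magnus v [gen.X] + M gen.X Y * magnus v [Y] - magnus v [gen.X] = i
    \<and> M Y gen.X * magnus v [gen.X] + M Y Y * magnus v [Y] - magnus v [Y] = j" for i j
  proof -
    \<comment> \<open>Cramer's rule; \<open>?d\<close> is its own inverse.\<close>
    obtain v where v: "v \<in> carrier free_group" "magnus v [gen.X] = ?d * ((M Y Y - 1) * i - M gen.X Y * j)"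
      "magnus v [Y] = ?d * ((M gen.X gen.X - 1) * j - M Y gen.X * i)"
      using exists_magnus by blast
    have "M gen.X gen.X * magnus v [gen.X] + M gen.X Y * magnus v [Y] - magnus v [gen.X] = (?d * ?d) * i"
      "M Y gen.X * magnus v [gen.X] + M Y Y * magnus v [Y] - magnus v [Y] = (?d * ?d) * j"
    proof -
      have "a * (D * ((d - 1) * i - b * j)) + b * (D * ((a - 1) * j - c * i)) - D * ((d - 1) * i - b * j)
          = D * ((a - 1) * (d - 1) - b * c) * i"
        "c * (D * ((d - 1) * i - b * j)) + d * (D * ((a - 1) * j - c * i)) - D * ((a - 1) * j - c * i)
          = D * ((a - 1) * (d - 1) - b * c) * j" for a b c d D :: int
        by (simp_all add: algebra_simps)
      then show "M gen.X gen.X * magnus v [gen.X] + M gen.X Y * magnus v [Y] - magnus v [gen.X] = (?d * ?d) * i"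
        "M Y gen.X * magnus v [gen.X] + M Y Y * magnus v [Y] - magnus v [Y] = (?d * ?d) * j"
        unfolding v(2,3) by blast+
    qed
    then show ?thesis using v(1) d2 by auto
  qed
  have "g \<in> fibre S" if g: "g \<in> carrier free_group" for g
  proof -
    obtain v where v: "v \<in> carrier free_group"
      "M gen.X gen.X * magnus v [gen.X] + M gen.X Y * magnus v [Y] - magnus v [gen.X] = magnus g [gen.X]"
      "M Y gen.X * magnus v [gen.X] + M Y Y * magnus v [Y] - magnus v [Y] = magnus g [Y]"
      using gen by blast
    let ?w = "\<phi> v \<otimes>\<^bsub>free_group\<^esub> inv\<^bsub>free_group\<^esub> v"
    have "\<theta> g = \<theta> ?w"
      using form[OF g] form[of ?w] v magnus_phi_inv[OF v(1)] by (simp del: \<theta>.hom_mult)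
    also have "\<dots> = \<one>\<^bsub>Q\<^esub>"
      using ker[of ?w] phi[OF v(1)] v(1) by (simp del: \<theta>.hom_mult)
    finally show ?thesis using ker[OF g] by simp
  qed
  then show ?thesis by (auto simp: fibre_carrier)
qed

lemma lower_central_omega_eq_2:
  assumes det: "\<bar>(M gen.X gen.X - 1) * (M Y Y - 1) - M gen.X Y * M Y gen.X\<bar> = 1"
  shows "lower_central G ord_omega = lower_central G (ord_fin 2)"
proof -
  let ?\<gamma> = "\<lambda>n. lower_central G (Ord 0 0 n)"
  have step: "fibre (?\<gamma> (Suc n)) = carrier free_group" if "fibre (?\<gamma> n) = carrier free_group" "n > 0" for n
  proof (rule fibre_eq_carrier[OF G.lower_central_normal det])
    have eq: "?\<gamma> (Suc n) = commutator_subgroup G (?\<gamma> n) (carrier G)"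
      using that by (intro lower_central_Suc) simp
    show "u \<in> fibre (?\<gamma> (Suc n))"
      unfolding eq using that by (intro comm_in_commutator) auto
    show "\<phi> v \<otimes>\<^bsub>free_group\<^esub> inv\<^bsub>free_group\<^esub> v \<in> fibre (?\<gamma> (Suc n))" if "v \<in> carrier free_group" for v
      unfolding eq using that \<open>fibre (?\<gamma> n) = _\<close> by (intro phi_comm_in_commutator G.lower_central_normal) auto
  qed
  have "fibre (?\<gamma> 1) = carrier free_group"
    using lower_central_1 fibre_carrier_G by simp
  then have 2: "fibre (?\<gamma> 2) = carrier free_group" and 3: "fibre (?\<gamma> 3) = carrier free_group"
    using step[of 1] step[of 2] by (auto simp: numeral_2_eq_2 numeral_3_eq_3)
  have "?\<gamma> 3 = ?\<gamma> 2"
    using lower_central_eq_fibre[of "Ord 0 0 3"] lower_central_eq_fibre[of "Ord 0 0 2"] 2 3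
    by (simp add: less_eq_ord_def numeral_2_eq_2 numeral_3_eq_3)
  then show ?thesis
    using G.lower_central_stable[of "Ord 0 0 2" ord_omega]
    by (simp add: ord_fin_def ord_omega_def less_eq_ord_def numeral_2_eq_2 numeral_3_eq_3)
qed

end



section \<open>The commutator of the generators\<close>

context free_by_cyclic
begin

text \<open>M - 1 is invertible modulo 2, so v |-> \<open>\<phi> v \<otimes> inv v\<close>, which
  moves one step down the series, preserves the presence of an odd exponent sum.\<close>

lemma fibre_odd_exponent:
  assumes odd: "odd ((M gen.X gen.X - 1) * (M Y Y - 1) - M gen.X Y * M Y gen.X)"
  shows "\<exists>v \<in> fibre (lower_central G (Ord 0 0 (Suc n))). odd (magnus v [gen.X]) \<or> odd (magnus v [Y])"
proof (induction n)
  case 0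
  have "x \<in> fibre (lower_central G (Ord 0 0 (Suc 0)))"
    unfolding lower_central_1 fibre_carrier_G by simp
  moreover have "odd (magnus x [gen.X])" by simp
  ultimately show ?case by blast
next
  case (Suc n)
  let ?H = "lower_central G (Ord 0 0 (Suc n))"
  obtain v where v: "v \<in> fibre ?H" "odd (magnus v [gen.X]) \<or> odd (magnus v [Y])"
    using Suc by blast
  let ?w = "\<phi> v \<otimes>\<^bsub>free_group\<^esub> inv\<^bsub>free_group\<^esub> v"
  have "lower_central G (Ord 0 0 (Suc (Suc n))) = commutator_subgroup G ?H (carrier G)"
    by (intro lower_central_Suc) simp
  then have w: "?w \<in> fibre (lower_central G (Ord 0 0 (Suc (Suc n))))"
    using phi_comm_in_commutator[OF G.lower_central_normal v(1)] by simp
  let ?i = "magnus v [gen.X]" and ?j = "magnus v [Y]" and ?d = "(M gen.X gen.X - 1) * (M Y Y - 1) - M gen.X Y * M Y gen.X"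
  \<comment> \<open>Multiplication of (M - 1) v by the adjugate of M - 1.\<close>
  have eq: "?d * ?i = (M Y Y - 1) * magnus ?w [gen.X] - M gen.X Y * magnus ?w [Y]"
    "?d * ?j = (M gen.X gen.X - 1) * magnus ?w [Y] - M Y gen.X * magnus ?w [gen.X]"
    unfolding magnus_phi_inv[OF fibre_carrier[OF v(1)]] by (simp_all add: algebra_simps)
  have "odd (magnus ?w [gen.X]) \<or> odd (magnus ?w [Y])"
  proof (rule ccontr)
    assume "\<not> ?thesis"
    then have "even (?d * ?i)" "even (?d * ?j)"
      unfolding eq by simp_all
    then show False using odd v(2) by (simp only: even_mult_iff) blast
  qed
  then show ?case using w by blast
qed

lemma u_in_lower_central:
  assumes det: "M gen.X gen.X * M Y Y - M gen.X Y * M Y gen.X = - 1" and tr: "odd (M gen.X gen.X + M Y Y)"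
  shows "u \<in> fibre (lower_central G (Ord 0 0 (Suc (Suc n))))"
proof (induction n)
  case 0
  have "u \<in> fibre (commutator_subgroup G (carrier G) (carrier G))"
    by (intro comm_in_commutator) (simp_all add: fibre_carrier_G)
  then show ?case by (simp only: lower_central_2)
next
  case (Suc n)
  let ?H = "lower_central G (Ord 0 0 (Suc (Suc n)))" and ?S = "lower_central G (Ord 0 0 (Suc (Suc (Suc n))))"
  have S: "?S = commutator_subgroup G ?H (carrier G)"
    by (intro lower_central_Suc) simp
  obtain Q :: "gen word set monoid" and \<theta> where \<theta>: "group_hom free_group Q \<theta>"
    and "\<theta> ` carrier free_group = carrier Q"
    and ker: "\<And>a. a \<in> carrier free_group \<Longrightarrow> \<theta> a = \<one>\<^bsub>Q\<^esub> \<longleftrightarrow> a \<in> fibre ?S"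
    by (rule F.quotient_hom[OF fibre_normal[OF G.lower_central_normal]]) (rule that)
  interpret \<theta>: group_hom free_group Q \<theta> by fact
  have xy: "x \<in> carrier free_group" "y \<in> carrier free_group" by simp_all
  have uc: "u \<in> carrier free_group" by simp
  have U: "\<theta> u \<in> carrier Q" using uc by (rule \<theta>.hom_closed)
  have \<theta>u: "\<theta> u = \<theta>.H.comm (\<theta> x) (\<theta> y)" by simp
  \<comment> \<open>By induction u lies in \<open>?H\<close>, so its commutators lie in
    \<open>?S\<close>.\<close>
  have central: "\<theta> u \<otimes>\<^bsub>Q\<^esub> \<theta> v = \<theta> v \<otimes>\<^bsub>Q\<^esub> \<theta> u" if v: "v \<in> carrier free_group" for v
    using comm_in_commutator[OF Suc v] F.hom_commute_iff[OF \<theta> ker uc v] S by simp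
  have form: "\<theta> g = \<theta> x [^]\<^bsub>Q\<^esub> magnus g [gen.X] \<otimes>\<^bsub>Q\<^esub> \<theta> y [^]\<^bsub>Q\<^esub> magnus g [Y] \<otimes>\<^bsub>Q\<^esub> \<theta> u [^]\<^bsub>Q\<^esub> (- magnus g [Y, gen.X])"
    if "g \<in> carrier free_group" for g
  proof -
    have "reduced g" using that by (simp add: carrier_free_group)
    then show ?thesis
      unfolding \<theta>u by (intro heisenberg_normal_form \<theta>; simp only: \<theta>u[symmetric] central xy)
  qed
  \<comment> \<open>In class two a commutator depends only on the exponent vectors, through their
    determinant. For \<open>\<phi> x\<close> and \<open>\<phi> y\<close> this is the determinant -1
    of \<open>M\<close>.\<close>
  have comm_form: "\<theta> (F.comm a b) = \<theta> u [^]\<^bsub>Q\<^esub> (magnus a [gen.X] * magnus b [Y] - magnus b [gen.X] * magnus a [Y])"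
    if "a \<in> carrier free_group" "b \<in> carrier free_group" for a b
  proof -
    have "F.comm a b \<in> carrier free_group" using that by simp
    from form[OF this] show ?thesis
      unfolding magnus_comm_pair[OF that] using \<theta>.hom_closed[OF xy(1)] \<theta>.hom_closed[OF xy(2)] \<theta>.hom_closed[OF uc]
      by (simp add: mult.commute del: \<theta>.hom_mult \<theta>.hom_inv \<theta>.hom_closed)
  qed
  have "\<phi> u = F.comm (\<phi> x) (\<phi> y)"
    using hom_mult[OF phi_hom] group_hom.hom_inv[of free_group free_group \<phi>] phi_hom xy
    by (simp add: group_hom_def group_hom_axioms_def group_free_group)
  then have "\<theta> (\<phi> u) = \<theta> u [^]\<^bsub>Q\<^esub> (- 1 :: int)"
    using comm_form[of "\<phi> x" "\<phi> y"] det by (simp add: M_def[symmetric] mult.commute del: \<theta>.hom_mult \<theta>.hom_inv)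
  \<comment> \<open>On the other hand \<open>\<phi> u\<close> and \<open>u\<close> agree modulo
    \<open>?S\<close>, so the image of u is its own inverse.\<close>
  moreover have "\<theta> (\<phi> u \<otimes>\<^bsub>free_group\<^esub> inv\<^bsub>free_group\<^esub> u) = \<one>\<^bsub>Q\<^esub>"
    using phi_comm_in_commutator[OF G.lower_central_normal Suc] ker[of "\<phi> u \<otimes>\<^bsub>free_group\<^esub> inv\<^bsub>free_group\<^esub> u"] S
    by (simp del: \<theta>.hom_mult)
  moreover have "\<theta> (\<phi> u \<otimes>\<^bsub>free_group\<^esub> inv\<^bsub>free_group\<^esub> u) = \<theta> (\<phi> u) \<otimes>\<^bsub>Q\<^esub> inv\<^bsub>Q\<^esub> \<theta> u"
    using \<theta>.hom_mult[OF phi_closed[OF uc] F.inv_closed[OF uc]] \<theta>.hom_inv[OF uc] by (simp only:)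
  ultimately have "\<theta> u [^]\<^bsub>Q\<^esub> (- 1 :: int) \<otimes>\<^bsub>Q\<^esub> inv\<^bsub>Q\<^esub> \<theta> u = \<one>\<^bsub>Q\<^esub>"
    by (simp only:)
  then have "\<theta> u [^]\<^bsub>Q\<^esub> (- 1 :: int) = \<theta> u [^]\<^bsub>Q\<^esub> (1 :: int)"
    using U by (simp add: \<theta>.H.inv_solve_right' del: \<theta>.hom_mult \<theta>.hom_inv)
  then have "\<theta> u [^]\<^bsub>Q\<^esub> (1 - (- 1) :: int) = \<one>\<^bsub>Q\<^esub>"
    using U \<theta>.H.int_pow_diff[OF U, of 1 "- 1"] by (simp only: \<theta>.H.r_inv \<theta>.H.int_pow_closed)
  then have sq: "\<theta> u [^]\<^bsub>Q\<^esub> (2::int) = \<one>\<^bsub>Q\<^esub>"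
    by (simp only: diff_minus_eq_add one_add_one)
  have "odd ((M gen.X gen.X - 1) * (M Y Y - 1) - M gen.X Y * M Y gen.X)"
  proof -
    have "(M gen.X gen.X - 1) * (M Y Y - 1) - M gen.X Y * M Y gen.X = - (M gen.X gen.X + M Y Y)"
      using det by (simp add: algebra_simps)
    then show ?thesis using tr by simp
  qed
  then obtain v where v: "v \<in> fibre ?H" "odd (magnus v [gen.X]) \<or> odd (magnus v [Y])"
    using fibre_odd_exponent by blast
  have v_comm: "\<theta> (F.comm v b) = \<one>\<^bsub>Q\<^esub>" if "b \<in> carrier free_group" for b
    using comm_in_commutator[OF v(1) that] ker[of "F.comm v b"] S fibre_carrier[OF v(1)] that by simp
  \<comment> \<open>\<open>v\<close> commutes with everything modulo \<open>?S\<close>, while its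
    commutator with y or with x is an odd power of u.\<close>
  have "\<exists>k. odd k \<and> \<theta> u [^]\<^bsub>Q\<^esub> (k::int) = \<one>\<^bsub>Q\<^esub>"
    using v(2)
  proof
    assume "odd (magnus v [gen.X])"
    then show ?thesis
      using comm_form[OF fibre_carrier[OF v(1)] xy(2)] v_comm[OF xy(2)] by (intro exI[of _ "magnus v [gen.X]"]) simp
  next
    assume "odd (magnus v [Y])"
    then show ?thesis
      using comm_form[OF fibre_carrier[OF v(1)] xy(1)] v_comm[OF xy(1)] by (intro exI[of _ "- magnus v [Y]"]) simp
  qed
  then obtain k where k: "odd k" "\<theta> u [^]\<^bsub>Q\<^esub> (k::int) = \<one>\<^bsub>Q\<^esub>" by blast
  obtain m where m: "k = 2 * m + 1" using k(1) by (rule oddE)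
  have "\<theta> u = \<theta> u [^]\<^bsub>Q\<^esub> (k - 2 * m)"
    using U by (simp add: m del: \<theta>.hom_mult \<theta>.hom_inv)
  also have "\<dots> = \<theta> u [^]\<^bsub>Q\<^esub> k \<otimes>\<^bsub>Q\<^esub> inv\<^bsub>Q\<^esub> ((\<theta> u [^]\<^bsub>Q\<^esub> (2::int)) [^]\<^bsub>Q\<^esub> m)"
    unfolding \<theta>.H.int_pow_pow[OF U] by (rule \<theta>.H.int_pow_diff[OF U])
  also have "\<dots> = \<one>\<^bsub>Q\<^esub>"
    unfolding sq k(2) by simp
  finally show ?case using ker[OF uc] by blast
qed

section \<open>Nontrivial elements at the multiples of \<omega>\<close>

primrec iterated_comm :: "nat \<Rightarrow> gen word" where
  "iterated_comm 0 = x"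
| "iterated_comm (Suc j) = F.comm (iterated_comm j) u"

lemma iterated_comm_carrier: "iterated_comm j \<in> carrier free_group"
proof (induction j)
  case (Suc j)
  then show ?case
    unfolding iterated_comm.simps by (intro F.m_closed F.inv_closed) simp_all
qed simp

text \<open>Since u lies in every \<gamma>_n, its commutator with an element of \<gamma>_(\<omega>j)
  lies in every \<gamma>_(\<omega>j+n) by \<open>lower_central_comm\<close>, hence in the next limit
  term.\<close>

lemma iterated_comm_lower_central:
  assumes u: "\<And>n. u \<in> fibre (lower_central G (Ord 0 0 (Suc (Suc n))))"
  shows "iterated_comm (Suc j) \<in> fibre (lower_central G (Ord 0 (Suc j) 0))"
proof -
  have limit: "v \<in> fibre (lower_central G (Ord 0 (Suc i) 0))"
    if "v \<in> carrier free_group" "\<And>n. v \<in> fibre (lower_central G (Ord 0 i (Suc n)))" for v i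
  proof -
    have "(0, v) \<in> lower_central G \<beta>" if "\<beta> < Ord 0 (Suc i) 0" for \<beta>
    proof -
      obtain a b c where \<beta>: "\<beta> = Ord a b c" by (cases \<beta>)
      then have "\<beta> \<le> Ord 0 i (Suc c)" using that by (auto simp: less_eq_ord_def)
      moreover have "(0, v) \<in> lower_central G (Ord 0 i (Suc c))"
        using \<open>\<And>n. v \<in> fibre (lower_central G (Ord 0 i (Suc n)))\<close> by (simp add: fibre_def)
      ultimately show ?thesis using G.lower_central_antimono by blast
    qed
    then show ?thesis using that(1) by (simp add: fibre_def lower_central_limit)
  qed
  have u1: "u \<in> fibre (lower_central G (Ord 0 0 (Suc n)))" for n
    using u[of n] fibre_antimono[of "Ord 0 0 (Suc n)" "Ord 0 0 (Suc (Suc n))"] by (auto simp: less_eq_ord_def)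
  show ?thesis
  proof (induction j)
    case 0
    show ?case
    proof (rule limit)
      fix n
      let ?H = "fibre (lower_central G (Ord 0 0 (Suc n)))"
      have H: "subgroup ?H free_group"
        by (rule subgroup_fibre[OF G.lower_central_subgroup])
      \<comment> \<open>The start uses normality instead: u and its conjugate by x both lie in every
        finite term.\<close>
      have "x \<otimes>\<^bsub>free_group\<^esub> u \<otimes>\<^bsub>free_group\<^esub> inv\<^bsub>free_group\<^esub> x \<in> ?H"
        using u1 by (intro fibre_conj G.lower_central_normal) simp_all
      moreover have "inv\<^bsub>free_group\<^esub> u \<in> ?H"
        using u1 H by (simp only: subgroup.m_inv_closed)
      ultimately show "iterated_comm (Suc 0) \<in> ?H"
        using subgroup.m_closed[OF H] by simp
    qed (rule iterated_comm_carrier)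
  next
    case (Suc j)
    show ?case
    proof (rule limit)
      fix n
      have "G.comm (0, iterated_comm (Suc j)) (0, u) \<in> lower_central G (Ord 0 (Suc j) (0 + Suc n))"
        using Suc u1[of n] by (intro G.lower_central_comm) (simp_all add: fibre_def)
      then show "iterated_comm (Suc (Suc j)) \<in> fibre (lower_central G (Ord 0 (Suc j) (Suc n)))"
        using iterated_comm_carrier[of "Suc (Suc j)"] G_comm_F[OF iterated_comm_carrier[of "Suc j"], of u]
        by (simp add: fibre_def del: G_mult)
    qed (rule iterated_comm_carrier)
  qed
qed

text \<open>Follow the coefficient of (YX)^j X through the Lie bracket with the leading form of u.
  One summand vanishes, because the monomial ends in XX, whose coefficient in u is 0; the other
  strips YX, with coefficient -1.\<close>

lemma iterated_comm_neq_one: "iterated_comm j \<noteq> \<one>\<^bsub>free_group\<^esub>"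
proof -
  define W where "W j = concat (replicate j [Y, gen.X]) @ [gen.X]" for j
  have len: "length (W j) = 2 * j + 1" for j
    by (induction j) (auto simp: W_def)
  have u: "u \<in> mfilt 0 2" "magnus u [Y, gen.X] = - 1" "magnus u [gen.X, gen.X] = 0"
    using magnus_comm(1)[of x 0 1 y 1] by (simp_all add: mfilt_1 magnus_comm_pair numeral_2_eq_2)
  have last: "drop (2 * j + 1) (W (Suc j)) = [gen.X, gen.X]" for j
    by (induction j) (simp_all add: W_def)
  have "iterated_comm j \<in> mfilt 0 (2 * j + 1) \<and> \<bar>magnus (iterated_comm j) (W j)\<bar> = 1"
  proof (induction j)
    case 0
    show ?case by (simp add: mfilt_1 W_def)
  next
    case (Suc j)
    let ?z = "iterated_comm j"
    have z: "?z \<in> mfilt 0 (2 * j + 1)" and c: "\<bar>magnus ?z (W j)\<bar> = 1"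
      using Suc by auto
    have "magnus (F.comm ?z u) (W (Suc j))
      = magnus ?z (take (2 * j + 1) (W (Suc j))) * magnus u (drop (2 * j + 1) (W (Suc j)))
        - magnus u (take 2 (W (Suc j))) * magnus ?z (drop 2 (W (Suc j)))"
      using magnus_comm(2)[OF z u(1), of "W (Suc j)"] len[of "Suc j"] by simp
    also have "\<dots> = magnus ?z (W j)"
      unfolding last u(3) by (simp add: W_def u(2))
    finally show ?case
      using magnus_comm(1)[OF z u(1)] c by simp
  qed
  then have "magnus (iterated_comm j) (W j) \<noteq> 0" by auto
  then show ?thesis
    using magnus_one[of "W j"] by (auto simp: W_def)
qed

text \<open>If the series stopped at \<beta> = \<omega>b + c, it would already be trivial there,
  contrary to the element \<open>iterated_comm (Suc b)\<close> of the later term at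
  \<omega>(b+1).\<close>

lemma lower_central_length_omega_sq:
  assumes u: "\<And>n. u \<in> fibre (lower_central G (Ord 0 0 (Suc (Suc n))))"
    and triv: "lower_central G ord_omega_sq = {\<one>\<^bsub>G\<^esub>}"
  shows "lower_central_length G ord_omega_sq"
proof -
  have "lower_central G (ord_succ ord_omega_sq) \<subseteq> {\<one>\<^bsub>G\<^esub>}"
    using G.lower_central_Suc_subset[of ord_omega_sq] triv by simp
  moreover have "\<one>\<^bsub>G\<^esub> \<in> lower_central G (ord_succ ord_omega_sq)"
    by (rule subgroup.one_closed[OF G.lower_central_subgroup])
  ultimately have "lower_central G ord_omega_sq = lower_central G (ord_succ ord_omega_sq)"
    using triv by auto
  moreover have "lower_central G \<beta> \<noteq> lower_central G (ord_succ \<beta>)" if "\<beta> \<noteq> Ord 0 0 0" "\<beta> < ord_omega_sq" for \<beta>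
  proof
    assume eq: "lower_central G \<beta> = lower_central G (ord_succ \<beta>)"
    obtain a b c where \<beta>: "\<beta> = Ord a b c" by (cases \<beta>)
    then have "\<beta> \<le> Ord 0 (Suc b) 0" using that by (auto simp: ord_omega_sq_def less_eq_ord_def)
    then have "lower_central G (Ord 0 (Suc b) 0) \<subseteq> lower_central G \<beta>"
      by (rule G.lower_central_antimono)
    also have "\<dots> = lower_central G ord_omega_sq"
      using G.lower_central_stable[OF that(1) eq[symmetric], of ord_omega_sq] that(2) by simp
    finally have "(0, iterated_comm (Suc b)) = \<one>\<^bsub>G\<^esub>"
      using iterated_comm_lower_central[OF u, of b] triv by (auto simp: fibre_def)
    then show False
      using iterated_comm_neq_one[of "Suc b"] by (simp add: G_one del: iterated_comm.simps)
  qed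
  ultimately show ?thesis
    by (auto simp: lower_central_length_def ord_fin_1_le) (simp_all add: ord_omega_sq_def)
qed

section \<open>The case distinction by trace and determinant\<close>

lemma det_M: "M gen.X gen.X * M Y Y - M gen.X Y * M Y gen.X = 1 \<or> M gen.X gen.X * M Y Y - M gen.X Y * M Y gen.X = - 1"
proof -
  have surj: "\<exists>v \<in> carrier free_group. \<phi> v = w" if "w \<in> carrier free_group" for w
    using auto that by (force simp: auto_def Bij_def bij_betw_def)
  \<comment> \<open>Surjectivity of \<phi> makes \<open>M\<close> surjective on integer vectors;
    preimages of the unit vectors then form an inverse matrix, so the determinant is a unit.\<close>
  have "\<exists>i j. M gen.X gen.X * i + M gen.X Y * j = p \<and> M Y gen.X * i + M Y Y * j = q" for p q
  proof -
    obtain w where w: "w \<in> carrier free_group" "magnus w [gen.X] = p" "magnus w [Y] = q"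
      using exists_magnus by blast
    then obtain v where "v \<in> carrier free_group" "\<phi> v = w" using surj by blast
    then show ?thesis using magnus_phi[of v gen.X] magnus_phi[of v Y] w by auto
  qed
  note ex = this
  obtain i j where ij: "M gen.X gen.X * i + M gen.X Y * j = 1" "M Y gen.X * i + M Y Y * j = 0"
    using ex by blast
  obtain k l where kl: "M gen.X gen.X * k + M gen.X Y * l = 0" "M Y gen.X * k + M Y Y * l = 1"
    using ex by blast
  have "(M gen.X gen.X * M Y Y - M gen.X Y * M Y gen.X) * (i * l - k * j)
    = (M gen.X gen.X * i + M gen.X Y * j) * (M Y gen.X * k + M Y Y * l)
      - (M gen.X gen.X * k + M gen.X Y * l) * (M Y gen.X * i + M Y Y * j)"
    by (simp add: algebra_simps)
  then have "(M gen.X gen.X * M Y Y - M gen.X Y * M Y gen.X) * (i * l - k * j) = 1"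
    unfolding ij kl by simp
  then show ?thesis using zmult_eq_1_iff by blast
qed

text \<open>Cayley-Hamilton for M - 1, whose trace is tr M - 2: (M - 1)^2 = (tr M - 2)(M - 1) -
  det(M - 1).\<close>

lemma unipotent_mod:
  fixes p :: int
  assumes det: "p dvd (M gen.X gen.X - 1) * (M Y Y - 1) - M gen.X Y * M Y gen.X" and tr: "p dvd M gen.X gen.X + M Y Y - 2"
  shows "p dvd (\<Sum>a\<in>UNIV. (M b a - (if a = b then 1 else 0)) * (M a c - (if c = a then 1 else 0)))"
proof -
  let ?d = "(M gen.X gen.X - 1) * (M Y Y - 1) - M gen.X Y * M Y gen.X" and ?t = "M gen.X gen.X + M Y Y - 2"
  have "(\<Sum>a\<in>UNIV. (M b a - (if a = b then 1 else 0)) * (M a c - (if c = a then 1 else 0)))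
    = ?t * (M b c - (if b = c then 1 else 0)) - ?d * (if b = c then 1 else 0)"
    by (cases b; cases c) (simp_all add: UNIV_gen algebra_simps)
  then show ?thesis using det tr by simp
qed

lemma trichotomy:
  "lower_central G ord_omega = lower_central G (ord_fin 2)
    \<or> lower_central G ord_omega = {\<one>\<^bsub>G\<^esub>}
    \<or> lower_central G ord_omega_sq = {\<one>\<^bsub>G\<^esub>} \<and> lower_central_length G ord_omega_sq"
proof -
  let ?D = "M gen.X gen.X * M Y Y - M gen.X Y * M Y gen.X" and ?N = "M gen.X gen.X + M Y Y"
  let ?d = "(M gen.X gen.X - 1) * (M Y Y - 1) - M gen.X Y * M Y gen.X"
  have d: "?d = 1 - ?N + ?D" by (simp add: algebra_simps)
  show ?thesis
  proof (cases "\<bar>?d\<bar> = 1")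
    case True
    then show ?thesis using lower_central_omega_eq_2 by blast
  next
    case False
    show ?thesis
    proof (cases "?D = 1")
      case True
      \<comment> \<open>As det M = 1, \<open>?N - 2\<close> equals \<open>- ?d\<close>, so any
        non-unit divisor \<open>p\<close> of \<open>?d\<close> meets both conditions of
        \<open>unipotent_mod\<close>; for \<open>?d = 0\<close> the choice is 2.\<close>
      have "\<exists>p::int. \<bar>p\<bar> > 1 \<and> p dvd ?d"
      proof (cases "?d = 0")
        case True
        then show ?thesis by (intro exI[of _ 2]) simp
      next
        case d0: False
        then show ?thesis using False by (intro exI[of _ ?d] conjI dvd_refl) linarith
      qed
      then obtain p :: int where p: "\<bar>p\<bar> > 1" "p dvd ?d" by blast
      moreover have "p dvd ?N - 2"
      proof -
        have "?N - 2 = - ?d" using d True by linarith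
        then show ?thesis using p(2) by (simp only: dvd_minus_iff)
      qed
      ultimately show ?thesis
        using residually_nilpotent[OF p(1) unipotent_mod] by blast
    next
      case D: False
      then have D: "?D = - 1" using det_M by blast
      show ?thesis
      proof (cases "even ?N")
        case True
        have "(2::int) dvd ?d" "(2::int) dvd ?N - 2" using d D True by simp_all
        then show ?thesis
          using residually_nilpotent[OF _ unipotent_mod, of 2] by simp
      next
        case odd: False
        \<comment> \<open>For determinant -1 one has \<open>?d = - ?N\<close>, and \<open>?d\<close>
          is not a unit in this branch.\<close>
        have "\<bar>?N\<bar> \<noteq> 1" using False d D by linarith
        moreover have "\<bar>n\<bar> \<ge> 3" if "odd n" "\<bar>n\<bar> \<noteq> 1" for n :: int
          using that by presburger
        ultimately have "\<bar>?N\<bar> \<ge> 3" using odd by blast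
        then have "lower_central G ord_omega_sq = {\<one>\<^bsub>G\<^esub>}"
          using lower_central_omega_sq_trivial[OF refl D odd] by blast
        then show ?thesis
          using lower_central_length_omega_sq u_in_lower_central[OF D odd] by blast
      qed
    qed
  qed
qed

end

theorem theorem7p2:
  fixes \<phi> :: "gen word \<Rightarrow> gen word" and G :: "(int \<times> gen word) monoid"
  assumes "\<phi> \<in> auto F2"
    and "G = semidirect_int F2 \<phi>"
  shows "lower_central G ord_omega = lower_central G (ord_fin 2)
    \<or> lower_central G ord_omega = {\<one>\<^bsub>G\<^esub>}
    \<or> lower_central G ord_omega_sq = {\<one>\<^bsub>G\<^esub>} \<and> lower_central_length G ord_omega_sq"
proof -
  interpret free_by_cyclic \<phi>
    using assms(1) by unfold_locales (simp add: F2_def)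
  show ?thesis
    using trichotomy by (simp add: assms(2) F2_def)
qed

end
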